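(* Let $n\ge1$ be an integer, let $1\le q<4$ and set $M_q=\lfloor\frac{2n}{4-q}\rfloor+1$. Assume that $m\in L^q(\mathbb R^{2n})\cap\mathcal C^{M_q}(\mathbb R^{2n})$ satisfies $$\|\partial^\alpha m\|_{L^\infty}\le C_0<\infty\quad\text{for all multiindices }\alpha\text{ with }|\alpha|\le M_q.$$ Then $$\|T_m\|_{L^{p_1}\times L^{p_2}\to L^p}<\infty$$ for all indices $(p_1,p_2,p)$ satisfying $2\le p_1,p_2\le\infty$, $1\le p\le2$, and $1/p=1/p_1+1/p_2$.
   Context: The Fourier transform is $\widehat f(\xi)=\int_{\mathbb R^n} f(x)e^{-2\pi i x\cdot\xi}\,dx$. For a bounded function $m$ on $\mathbb R^{2n}$, the bilinear multiplier operator $T_m$ is defined on pairs of Schwartz functions $f,g$ on $\mathbb R^n$ by $$T_m(f,g)(x)=\int_{\mathbb R^n}\int_{\mathbb R^n} m(\xi,\eta)\widehat f(\xi)\widehat g(\eta)e^{2\pi i x\cdot(\xi+\eta)}\,d\xi\,d\eta .$$ $\|T_m\|_{L^{p_1}\times L^{p_2}\to L^p}$ denotes its norm from $L^{p_1}(\mathbb R^n)\times L^{p_2}(\mathbb R^n)$ to $L^p(\mathbb R^n)$, i.e. the smallest $A$ with $\|T_m(f,g)\|_{L^p}\le A\|f\|_{L^{p_1}}\|g\|_{L^{p_2}}$ for all Schwartz $f,g$. $\lfloor b\rfloor$ denotes the integer part of $b$. $\mathcal C^M(\mathbb R^{2n})$ is the class of functions on $\mathbb R^{2n}$ whose partial derivatives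 of order up to and including $M$ are continuous. *)

theory Defs
  imports "HOL-Analysis.Analysis" "HOL-Probability.Essential_Supremum"
begin

definition partial_deriv :: "'a::euclidean_space \<Rightarrow> ('a \<Rightarrow> complex) \<Rightarrow> 'a \<Rightarrow> complex" where
  "partial_deriv b f x = vector_derivative (\<lambda>t::real. f (x + t *\<^sub>R b)) (at 0)"

(* A multiindex alpha is represented by a list of |alpha| coordinate directions, in which
   the i-th basis vector occurs alpha_i times. Where these derivatives are used
   below, they are continuous, so the order of the list does not matter (Schwarz). *)
definition multiindex :: "'a::euclidean_space list \<Rightarrow> bool" where
  "multiindex \<alpha> \<longleftrightarrow> set \<alpha> \<subseteq> Basis"

primrec iter_partial :: "'a::euclidean_space list \<Rightarrow> ('a \<Rightarrow> complex) \<Rightarrow> 'a \<Rightarrow> complex" where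
  "iter_partial [] f = f"
| "iter_partial (b # \<alpha>) f = partial_deriv b (iter_partial \<alpha> f)"

(* Existence of the partial derivatives is demanded separately, since vector_derivative
   is a total function. *)
definition C_class :: "nat \<Rightarrow> ('a::euclidean_space \<Rightarrow> complex) set" where
  "C_class M = {f.
     (\<forall>\<alpha>. multiindex \<alpha> \<and> length \<alpha> < M \<longrightarrow>
        (\<forall>b\<in>Basis. \<forall>x. (\<lambda>t::real. iter_partial \<alpha> f (x + t *\<^sub>R b)) differentiable (at 0))) \<and>
     (\<forall>\<alpha>. multiindex \<alpha> \<and> length \<alpha> \<le> M \<longrightarrow> continuous_on UNIV (iter_partial \<alpha> f))}"

definition schwartz :: "('a::euclidean_space \<Rightarrow> complex) set" where
  "schwartz = {f. (\<forall>M. f \<in> C_class M) \<and>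
     (\<forall>(\<beta> :: 'a \<Rightarrow> nat) \<alpha>. multiindex \<alpha> \<longrightarrow>
        bounded (range (\<lambda>x. (\<Prod>b\<in>Basis. (x \<bullet> b) ^ \<beta> b) *\<^sub>R iter_partial \<alpha> f x)))}"

(* Meant for measurable f and exponents 0 < p \<le> \<infinity>. *)
definition Lp_norm :: "ennreal \<Rightarrow> ('a::euclidean_space \<Rightarrow> complex) \<Rightarrow> ennreal" where
  "Lp_norm p f =
     (if p = \<infinity> then esssup lborel (\<lambda>x. ennreal (norm (f x)))
      else let r = enn2real p; I = (\<integral>\<^sup>+x. ennreal (norm (f x) powr r) \<partial>lborel)
           in if I = \<infinity> then \<infinity> else ennreal (enn2real I powr (1 / r)))"

definition Lp_space :: "ennreal \<Rightarrow> ('a::euclidean_space \<Rightarrow> complex) set" where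
  "Lp_space p = {f \<in> borel_measurable lborel. Lp_norm p f < \<infinity>}"

definition fourier :: "('a::euclidean_space \<Rightarrow> complex) \<Rightarrow> 'a \<Rightarrow> complex" where
  "fourier f \<xi> = (LINT x|lborel. f x * exp (- 2 * pi * \<i> * complex_of_real (x \<bullet> \<xi>)))"

definition bilinear_multiplier ::
    "('a::euclidean_space \<times> 'a \<Rightarrow> complex) \<Rightarrow> ('a \<Rightarrow> complex) \<Rightarrow> ('a \<Rightarrow> complex) \<Rightarrow> 'a \<Rightarrow> complex" where
  "bilinear_multiplier m f g x =
     (LINT \<eta>|lborel. LINT \<xi>|lborel.
        m (\<xi>, \<eta>) * fourier f \<xi> * fourier g \<eta> * exp (2 * pi * \<i> * complex_of_real (x \<bullet> (\<xi> + \<eta>))))"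

definition bilinear_multiplier_norm ::
    "ennreal \<Rightarrow> ennreal \<Rightarrow> ennreal \<Rightarrow> ('a::euclidean_space \<times> 'a \<Rightarrow> complex) \<Rightarrow> ennreal" where
  "bilinear_multiplier_norm p1 p2 p m =
     Inf {A. \<forall>f\<in>schwartz. \<forall>g\<in>schwartz.
            Lp_norm p (bilinear_multiplier m f g) \<le> A * Lp_norm p1 f * Lp_norm p2 g}"

end

theory Submission
  imports Defs "HOL-Probability.Probability" "HOL-Real_Asymp.Real_Asymp"
begin

text \<open>
  Pairing \<open>T_m(f,g)\<close> with a function \<open>h\<close> gives the trilinear form with integrand
  \<open>m(\<xi>,\<eta>) f^(\<xi>) g^(\<eta>) h^(-(\<xi>+\<eta>))\<close>. By Cauchy-Schwarz and Plancherel it is bounded by the \<open>L^4\<close> norm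
  of \<open>m\<close> times the \<open>L^2\<close> norms of \<open>f\<close>, \<open>g\<close>, \<open>h\<close>, and \<open>L^q \<inter> L^\<infinity>\<close> is contained in \<open>L^4\<close>.
  Averaging translates of \<open>m\<close> against a band-limited kernel of width \<open>2^-j\<close>, with the coefficients of an
  \<open>M\<close>-th difference, yields a form that is local at spatial scale \<open>2^j\<close> and differs from the original one
  by \<open>O(2^(-j M (4-q)/4))\<close> in the \<open>L^2\<close> sense. On cubes of side \<open>2^j\<close>, Hoelder's inequality passes from
  \<open>L^2\<close> to exponents at least 2 with \<open>1/p_1 + 1/p_2 + 1/p_3 = 1\<close> at the price of a factor \<open>2^(j n/2)\<close>,
  and the sum over the dyadic scales converges exactly when \<open>M > 2n/(4-q)\<close>. All exponents are
  treated at once, so no interpolation is needed.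
\<close>

section \<open>Gaussians and Plancherel's inequality\<close>

text \<open>Translating \<open>m\<close> by \<open>s *\<^sub>R y\<close> modulates the three
  functions in space, so averaging with a kernel inserts its transform at \<open>s\<close> times a
  difference of positions. Exact locality, with no tails to sum, asks for a compactly supported
  transform; a high power of sinc has one and still has \<open>M\<close> finite moments. A
  nonnegative kernel alone approximates only to low order, hence the combination of the scales
  \<open>i * s\<close> with binomial coefficients, whose error is an average of \<open>M\<close>-th
  differences. Such a difference is O(|y|^M) in sup norm but merely bounded in L^q; the L^4 norm
  inherits the fraction (4 - q)/4 of the exponent \<open>M\<close>, which is the origin of the rate.
  The form is the approximation at scale 1, plus consecutive differences, plus a remainder. The
  remainder is controlled by L^2 norms of fixed functions and vanishes in the limit, so only the
  local pieces enter the final bound. On cubes of volume V, Hoelder costs V^(1/2 - 1/p_i) for each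
  function, and these factors multiply to V^(1/2) because the reciprocal exponents add up to 1. The
  dual function has bounded support, so that only finitely many cubes occur.\<close>

lemma has_bochner_integral_lborel_prod:
  fixes g :: "'a::euclidean_space \<Rightarrow> real \<Rightarrow> 'b::{real_normed_field,banach,second_countable_topology}"
  assumes g: "\<And>b. b \<in> Basis \<Longrightarrow> integrable lborel (g b)"
  shows "has_bochner_integral lborel (\<lambda>x. \<Prod>b\<in>Basis. g b (x \<bullet> b)) (\<Prod>b\<in>Basis. integral\<^sup>L lborel (g b))"
proof -
  interpret product_sigma_finite "\<lambda>b::'a. lborel :: real measure" ..
  have [measurable]: "b \<in> Basis \<Longrightarrow> g b \<in> borel_measurable borel" for b
    using g[of b] by auto
  have eq: "(\<Prod>b\<in>Basis. g b ((\<Sum>c\<in>Basis. f c *\<^sub>R c) \<bullet> b)) = (\<Prod>b\<in>Basis. g b (f b))" for f :: "'a \<Rightarrow> real"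
    by (intro prod.cong) (auto simp: inner_sum_left inner_Basis if_distrib cong: if_cong)
  have "has_bochner_integral (\<Pi>\<^sub>M b\<in>(Basis::'a set). lborel) (\<lambda>f. \<Prod>b\<in>Basis. g b (f b)) (\<Prod>b\<in>Basis. integral\<^sup>L lborel (g b))"
    using product_integrable_prod[of "Basis::'a set" g] product_integral_prod[of "Basis::'a set" g] g
    by (simp add: has_bochner_integral_iff)
  then show ?thesis
    by (subst lborel_eq, intro has_bochner_integral_distr) (simp_all only: eq, measurable)
qed

text \<open>The characteristic function of the standard normal distribution at frequency
  \<open>u / e\<close>, rescaled by the substitution x = \<open>e * t\<close>.\<close>

lemma wave_gaussian_integral:
  fixes e u :: real
  assumes "e > 0"
  shows "has_bochner_integral lborel (\<lambda>t. cis (u * t) * of_real (exp (-(e * t)\<^sup>2 / 2)))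
           (of_real (sqrt (2 * pi) / e * exp (-(u / e)\<^sup>2 / 2)))"
proof -
  have char: "(LINT x|lborel. std_normal_density x *\<^sub>R iexp (s * x)) = exp (-(s\<^sup>2) / 2)" for s :: real
    using fun_cong[OF char_std_normal_distribution, of s]
    by (simp add: char_def integral_density)
  have int: "integrable lborel (\<lambda>x. std_normal_density x *\<^sub>R iexp (s * x))" for s :: real
    by (rule Bochner_Integration.integrable_bound[OF integrable_normal_density[of 1 0]]) auto
  have *: "has_bochner_integral lborel (\<lambda>x. sqrt (2 * pi) *\<^sub>R (std_normal_density x *\<^sub>R iexp ((u / e) * x)))
      (sqrt (2 * pi) *\<^sub>R complex_of_real (exp (-((u / e)\<^sup>2) / 2)))"
    using char[of "u / e"] int[of "u / e"] by (intro has_bochner_integral_scaleR_right) (simp add: has_bochner_integral_iff)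
  have "has_bochner_integral lborel (\<lambda>t. sqrt (2 * pi) *\<^sub>R (std_normal_density (0 + e * t) *\<^sub>R iexp ((u / e) * (0 + e * t))))
      ((sqrt (2 * pi) *\<^sub>R complex_of_real (exp (-((u / e)\<^sup>2) / 2))) /\<^sub>R \<bar>e\<bar>)"
    using * assms by (intro lborel_has_bochner_integral_real_affine_iff[THEN iffD1]) auto
  moreover have "sqrt (2 * pi) *\<^sub>R (std_normal_density (0 + e * t) *\<^sub>R iexp ((u / e) * (0 + e * t)))
     = cis (u * t) * of_real (exp (-(e * t)\<^sup>2 / 2))" for t
    using assms by (simp add: std_normal_density_def scaleR_conv_of_real cis_conv_exp mult.commute)
  ultimately show ?thesis
    using assms by (simp add: scaleR_conv_of_real field_simps)
qed

lemma has_bochner_integral_lborel_pair: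
  fixes f :: "'a::euclidean_space \<Rightarrow> 'c::{real_normed_field,banach,second_countable_topology}"
    and g :: "'b::euclidean_space \<Rightarrow> 'c"
  assumes f: "integrable lborel f" and g: "integrable lborel g"
  shows "has_bochner_integral lborel (\<lambda>z. f (fst z) * g (snd z)) (integral\<^sup>L lborel f * integral\<^sup>L lborel g)"
proof -
  have int: "integrable (lborel \<Otimes>\<^sub>M lborel) (\<lambda>z. f (fst z) * g (snd z))"
    using f g by (intro lborel_pair.Fubini_integrable) (auto simp: norm_mult)
  from lborel_pair.integral_fst'[OF int]
  have "integral\<^sup>L (lborel \<Otimes>\<^sub>M lborel) (\<lambda>z. f (fst z) * g (snd z)) = integral\<^sup>L lborel f * integral\<^sup>L lborel g"
    by simp
  with int show ?thesis
    by (simp add: has_bochner_integral_iff lborel_prod)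
qed

lemma cis_inner_prod:
  fixes x y :: "'a::euclidean_space"
  shows "cis (c * (x \<bullet> y)) = (\<Prod>b\<in>Basis. cis (c * (y \<bullet> b) * (x \<bullet> b)))"
proof -
  have "(\<Prod>b\<in>Basis. cis (c * (y \<bullet> b) * (x \<bullet> b))) = cis (\<Sum>b\<in>Basis. c * (y \<bullet> b) * (x \<bullet> b))"
    by (simp add: cis_conv_exp exp_sum sum_distrib_left)
  also have "(\<Sum>b\<in>Basis. c * (y \<bullet> b) * (x \<bullet> b)) = c * (x \<bullet> y)"
    by (subst euclidean_inner[of x y]) (simp add: sum_distrib_left mult_ac)
  finally show ?thesis by simp
qed

text \<open>Kept as a product over coordinates, so that its integrals reduce to one-dimensional ones
  by \<open>has_bochner_integral_lborel_prod\<close>.\<close>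

definition gaussian :: "real \<Rightarrow> 'a::euclidean_space \<Rightarrow> real" where
  "gaussian e x = (\<Prod>b\<in>Basis. exp (-(e * (x \<bullet> b))\<^sup>2 / 2))"

text \<open>For \<open>e > 0\<close> this is the Fourier transform of \<open>gaussian e\<close> in
  closed form: a positive density of width proportional to \<open>e\<close>.\<close>

definition gaussian_hat :: "real \<Rightarrow> 'a::euclidean_space \<Rightarrow> real" where
  "gaussian_hat e u = (\<Prod>b\<in>Basis. sqrt (2 * pi) / e * exp (-(2 * pi * (u \<bullet> b) / e)\<^sup>2 / 2))"

lemma borel_measurable_gaussian [measurable]: "gaussian e \<in> borel_measurable borel"
  "gaussian_hat e \<in> borel_measurable borel"
  unfolding gaussian_def gaussian_hat_def by measurable

lemma gaussian_nonneg: "0 \<le> gaussian e x"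
  by (auto simp: gaussian_def intro!: prod_nonneg)

lemma gaussian_hat_nonneg: "e > 0 \<Longrightarrow> 0 \<le> gaussian_hat e u"
  by (auto simp: gaussian_hat_def intro!: prod_nonneg)

lemma has_bochner_integral_gaussian:
  assumes "e > 0"
  shows "has_bochner_integral lborel (\<lambda>\<xi>. cis (- (2 * pi) * (\<xi> \<bullet> u)) * complex_of_real (gaussian e \<xi>))
           (complex_of_real (gaussian_hat e u))"
proof -
  have w: "has_bochner_integral lborel (\<lambda>t. cis (- (2 * pi) * (u \<bullet> b) * t) * of_real (exp (-(e * t)\<^sup>2 / 2)))
           (of_real (sqrt (2 * pi) / e * exp (-(2 * pi * (u \<bullet> b) / e)\<^sup>2 / 2)))" for b
    using wave_gaussian_integral[OF assms, of "- (2 * pi) * (u \<bullet> b)"] by simp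
  have "has_bochner_integral lborel (\<lambda>\<xi>. \<Prod>b\<in>Basis. cis (- (2 * pi) * (u \<bullet> b) * (\<xi> \<bullet> b)) * complex_of_real (exp (-(e * (\<xi> \<bullet> b))\<^sup>2 / 2)))
     (\<Prod>b\<in>Basis. (LINT t|lborel. cis (- (2 * pi) * (u \<bullet> b) * t) * of_real (exp (-(e * t)\<^sup>2 / 2))))"
    by (rule has_bochner_integral_lborel_prod) (rule integrable.intros[OF w])
  then show ?thesis
    using has_bochner_integral_integral_eq[OF w]
    by (subst cis_inner_prod) (simp add: gaussian_def gaussian_hat_def prod.distrib)
qed

lemma borel_measurable_fst_snd [measurable]:
  "fst \<in> borel_measurable (borel :: ('a::second_countable_topology \<times> 'b::second_countable_topology) measure)"
  "snd \<in> borel_measurable (borel :: ('a \<times> 'b) measure)"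
  by (auto intro!: borel_measurable_continuous_onI continuous_intros)

lemma fourier_cis: "fourier f \<xi> = (LINT x|lborel. f x * cis (- (2 * pi) * (x \<bullet> \<xi>)))"
  by (simp add: fourier_def cis_conv_exp algebra_simps)

lemma integrable_mult_cis [simp, intro]:
  fixes f :: "'a \<Rightarrow> complex"
  assumes "integrable M f" and [measurable]: "g \<in> borel_measurable M"
  shows "integrable M (\<lambda>x. f x * cis (g x))" "integrable M (\<lambda>x. cis (g x) * f x)"
  using assms(1) by (auto intro: Bochner_Integration.integrable_bound[OF assms(1)] simp: norm_mult cis_conv_exp)

lemma borel_measurable_fourier [measurable]:
  assumes [measurable]: "f \<in> borel_measurable borel"
  shows "fourier f \<in> borel_measurable borel"
  unfolding fourier_cis[abs_def] cis_conv_exp by measurable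

lemma norm_fourier_le: "norm (fourier f \<xi>) \<le> (LINT x|lborel. norm (f x))"
  unfolding fourier_cis by (rule order_trans[OF integral_norm_bound]) (simp add: norm_mult)

section \<open>Fubini, translation and reflection for Lebesgue measure\<close>

lemma lborel_fubini:
  fixes f :: "'a::euclidean_space \<Rightarrow> 'b::euclidean_space \<Rightarrow> 'c::{banach, second_countable_topology}"
  assumes "integrable lborel (\<lambda>z. f (fst z) (snd z))"
  shows "(LINT y|lborel. LINT x|lborel. f x y) = (LINT x|lborel. LINT y|lborel. f x y)"
  using lborel_pair.Fubini_integral[of f] assms by (simp add: lborel_prod case_prod_beta')

lemma integral_lborel_pair:
  fixes f :: "'a::euclidean_space \<times> 'b::euclidean_space \<Rightarrow> 'c::{banach, second_countable_topology}"
  assumes "integrable lborel f"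
  shows "integral\<^sup>L lborel f = (LINT x|lborel. LINT y|lborel. f (x, y))"
  using lborel_pair.integral_fst'[of f] assms by (simp add: lborel_prod)

lemma nn_integral_lborel_pair:
  fixes f :: "'a::euclidean_space \<times> 'b::euclidean_space \<Rightarrow> ennreal"
  assumes [measurable]: "f \<in> borel_measurable borel"
  shows "integral\<^sup>N lborel f = (\<integral>\<^sup>+x. \<integral>\<^sup>+y. f (x, y) \<partial>lborel \<partial>lborel)"
    and "integral\<^sup>N lborel f = (\<integral>\<^sup>+y. \<integral>\<^sup>+x. f (x, y) \<partial>lborel \<partial>lborel)"
proof -
  have f: "f \<in> borel_measurable (lborel \<Otimes>\<^sub>M lborel)"
    by (simp add: lborel_prod)
  show "integral\<^sup>N lborel f = (\<integral>\<^sup>+x. \<integral>\<^sup>+y. f (x, y) \<partial>lborel \<partial>lborel)"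
    using lborel.nn_integral_fst[OF f] by (simp add: lborel_prod)
  show "integral\<^sup>N lborel f = (\<integral>\<^sup>+y. \<integral>\<^sup>+x. f (x, y) \<partial>lborel \<partial>lborel)"
    using lborel_pair.nn_integral_snd[OF f] by (simp add: lborel_prod)
qed

lemma nn_integral_lborel_translate:
  fixes f :: "'a::euclidean_space \<Rightarrow> ennreal"
  assumes [measurable]: "f \<in> borel_measurable borel"
  shows "(\<integral>\<^sup>+x. f (t + x) \<partial>lborel) = integral\<^sup>N lborel f"
  using lborel_distr_plus[of t] nn_integral_distr[of "(+) t" lborel borel f] by simp

lemma nn_integral_lborel_reflect:
  fixes f :: "'a::euclidean_space \<Rightarrow> ennreal"
  assumes [measurable]: "f \<in> borel_measurable borel"
  shows "(\<integral>\<^sup>+x. f (t - x) \<partial>lborel) = integral\<^sup>N lborel f"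
  by (subst (2) lborel_affine[of "-1" t]) (simp_all add: density_1 nn_integral_distr)

text \<open>Per coordinate this is \<open>wave_gaussian_integral\<close> at frequency 0 with
  \<open>2 * pi / e\<close> in place of \<open>e\<close>. Mass exactly 1 is what lets Schur's test
  in \<open>plancherel_damped\<close> lose no constant.\<close>

lemma nn_integral_gaussian_hat:
  assumes "e > 0"
  shows "(\<integral>\<^sup>+u. ennreal (gaussian_hat e u) \<partial>(lborel :: 'a::euclidean_space measure)) = 1"
proof -
  have "has_bochner_integral lborel (\<lambda>t. complex_of_real (exp (-((2 * pi / e) * t)\<^sup>2 / 2)))
      (complex_of_real (sqrt (2 * pi) / (2 * pi / e)))"
    using wave_gaussian_integral[of "2 * pi / e" 0] assms by simp
  then have "has_bochner_integral lborel (\<lambda>t. exp (-((2 * pi / e) * t)\<^sup>2 / 2)) (sqrt (2 * pi) / (2 * pi / e))"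
    using has_bochner_integral_bounded_linear[OF bounded_linear_Re] by fastforce
  then have "has_bochner_integral lborel (\<lambda>t. sqrt (2 * pi) / e * exp (-((2 * pi / e) * t)\<^sup>2 / 2))
     (sqrt (2 * pi) / e * (sqrt (2 * pi) / (2 * pi / e)))"
    by (rule has_bochner_integral_mult_right)
  then have w: "has_bochner_integral lborel (\<lambda>t. sqrt (2 * pi) / e * exp (-(2 * pi * t / e)\<^sup>2 / 2)) 1"
    using assms by simp
  have "has_bochner_integral lborel (gaussian_hat e :: 'a \<Rightarrow> real)
     (\<Prod>b\<in>(Basis::'a set). LINT t|lborel. sqrt (2 * pi) / e * exp (-(2 * pi * t / e)\<^sup>2 / 2))"
    unfolding gaussian_hat_def
    by (rule has_bochner_integral_lborel_prod) (rule integrable.intros[OF w])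
  then show ?thesis
    using has_bochner_integral_integral_eq[OF w] gaussian_hat_nonneg[OF assms]
    by (subst nn_integral_eq_integral) (auto simp: has_bochner_integral_iff)
qed

text \<open>The damping makes Fubini applicable; positivity and unit mass of the transformed Gaussian then give the bound by Schur's test.\<close>

lemma plancherel_damped:
  fixes F :: "'a::euclidean_space \<Rightarrow> complex"
  assumes F: "integrable lborel F" and e: "e > 0"
  shows "(\<integral>\<^sup>+\<xi>. ennreal ((norm (fourier F \<xi>))\<^sup>2 * gaussian e \<xi>) \<partial>lborel) \<le> (\<integral>\<^sup>+x. ennreal ((norm (F x))\<^sup>2) \<partial>lborel)"
proof -
  have [measurable]: "F \<in> borel_measurable borel" using F by auto
  \<comment> \<open>The squared modulus of the transform is the integral of this kernel against the
    character of x - y; the damping turns that character into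
    \<open>gaussian_hat e (x - y)\<close>.\<close>
  define K where "K z = F (fst z) * cnj (F (snd z))" for z
  have K: "integrable lborel K"
    unfolding K_def using has_bochner_integral_lborel_pair[of F "\<lambda>y. cnj (F y)"] F
    by (auto simp: has_bochner_integral_iff)
  then have [measurable]: "K \<in> borel_measurable borel" by auto
  have gauss: "integrable lborel (gaussian e :: 'a \<Rightarrow> real)"
    using has_bochner_integral_gaussian[OF e, of 0] integrable_Re by (fastforce simp: has_bochner_integral_iff)
  have hat: "complex_of_real ((norm (fourier F \<xi>))\<^sup>2) = (LINT z|lborel. K z * cis (- (2 * pi) * ((fst z - snd z) \<bullet> \<xi>)))" for \<xi>
  proof -
    have c: "cnj (fourier F \<xi>) = (LINT y|lborel. cnj (F y) * cis (2 * pi * (y \<bullet> \<xi>)))"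
      using Bochner_Integration.integral_cnj[of lborel "\<lambda>x. F x * cis (- (2 * pi) * (x \<bullet> \<xi>))"]
      by (simp add: fourier_cis cis_cnj)
    have "complex_of_real ((norm (fourier F \<xi>))\<^sup>2) = fourier F \<xi> * cnj (fourier F \<xi>)"
      by (rule complex_norm_square)
    also have "\<dots> = (LINT z|lborel. (F (fst z) * cis (- (2 * pi) * (fst z \<bullet> \<xi>))) * (cnj (F (snd z)) * cis (2 * pi * (snd z \<bullet> \<xi>))))"
      unfolding c unfolding fourier_cis using F
      by (intro has_bochner_integral_integral_eq[symmetric] has_bochner_integral_lborel_pair) auto
    also have "\<dots> = (LINT z|lborel. K z * cis (- (2 * pi) * ((fst z - snd z) \<bullet> \<xi>)))"
      by (intro Bochner_Integration.integral_cong refl) (simp add: K_def cis_mult inner_diff_left algebra_simps)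
    finally show ?thesis .
  qed
  have S: "integrable lborel (\<lambda>w. K (snd w) * cis (- (2 * pi) * ((fst (snd w) - snd (snd w)) \<bullet> fst w)) * complex_of_real (gaussian e (fst w)))"
  proof (rule Bochner_Integration.integrable_bound)
    show "integrable lborel (\<lambda>w::'a \<times> ('a \<times> 'a). gaussian e (fst w) * norm (K (snd w)))"
      using has_bochner_integral_lborel_pair[of "gaussian e" "\<lambda>z. norm (K z)"] gauss K
      by (auto simp: has_bochner_integral_iff)
    show "(\<lambda>w. K (snd w) * cis (- (2 * pi) * ((fst (snd w) - snd (snd w)) \<bullet> fst w)) * complex_of_real (gaussian e (fst w)))
        \<in> borel_measurable lborel"
      unfolding cis_conv_exp by measurable
  qed (auto simp: norm_mult gaussian_nonneg)
  \<comment> \<open>This crude bound makes the damped square integrable, so that it can be handled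
    as a real integral.\<close>
  have le: "gaussian e \<xi> * (norm (fourier F \<xi>))\<^sup>2 \<le> gaussian e \<xi> * (LINT x|lborel. norm (F x))\<^sup>2" for \<xi>
    by (intro mult_left_mono power_mono norm_fourier_le gaussian_nonneg) auto
  have int: "integrable lborel (\<lambda>\<xi>. (norm (fourier F \<xi>))\<^sup>2 * gaussian e \<xi>)"
    by (rule Bochner_Integration.integrable_bound[OF integrable_mult_left[OF gauss, of "(LINT x|lborel. norm (F x))\<^sup>2"]])
       (use le in \<open>auto simp: mult.commute abs_mult abs_of_nonneg[OF gaussian_nonneg]\<close>)
  have "complex_of_real (LINT \<xi>|lborel. (norm (fourier F \<xi>))\<^sup>2 * gaussian e \<xi>)
      = (LINT \<xi>|lborel. LINT z|lborel. K z * cis (- (2 * pi) * ((fst z - snd z) \<bullet> \<xi>)) * complex_of_real (gaussian e \<xi>))"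
    by (simp add: hat integral_complex_of_real[symmetric] del: of_real_power)
  also have "\<dots> = (LINT z|lborel. LINT \<xi>|lborel. K z * cis (- (2 * pi) * ((fst z - snd z) \<bullet> \<xi>)) * complex_of_real (gaussian e \<xi>))"
    by (rule lborel_fubini[symmetric, OF S])
  also have "\<dots> = (LINT z|lborel. K z * complex_of_real (gaussian_hat e (fst z - snd z)))"
  proof (intro Bochner_Integration.integral_cong refl)
    fix z :: "'a \<times> 'a"
    show "(LINT \<xi>|lborel. K z * cis (- (2 * pi) * ((fst z - snd z) \<bullet> \<xi>)) * complex_of_real (gaussian e \<xi>))
      = K z * complex_of_real (gaussian_hat e (fst z - snd z))"
      using has_bochner_integral_integral_eq[OF has_bochner_integral_mult_right[OF has_bochner_integral_gaussian[OF e, of "fst z - snd z"], of "K z"]]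
      by (simp add: mult.assoc inner_commute)
  qed
  finally have eq: "complex_of_real (LINT \<xi>|lborel. (norm (fourier F \<xi>))\<^sup>2 * gaussian e \<xi>)
     = (LINT z|lborel. K z * complex_of_real (gaussian_hat e (fst z - snd z)))" .
  have "(\<integral>\<^sup>+\<xi>. ennreal ((norm (fourier F \<xi>))\<^sup>2 * gaussian e \<xi>) \<partial>lborel)
     = ennreal (LINT \<xi>|lborel. (norm (fourier F \<xi>))\<^sup>2 * gaussian e \<xi>)"
    by (rule nn_integral_eq_integral[OF int]) (auto simp: gaussian_nonneg)
  also have "\<dots> \<le> ennreal (norm (complex_of_real (LINT \<xi>|lborel. (norm (fourier F \<xi>))\<^sup>2 * gaussian e \<xi>)))"
    by (intro ennreal_leI) simp
  also have "\<dots> \<le> (\<integral>\<^sup>+z. ennreal (norm (K z * complex_of_real (gaussian_hat e (fst z - snd z)))) \<partial>lborel)"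
    unfolding eq
    \<comment> \<open>The Bochner integral of a non-integrable function is 0, so the estimate holds
      in either case.\<close>
    by (cases "integrable lborel (\<lambda>z. K z * complex_of_real (gaussian_hat e (fst z - snd z)))")
       (auto simp: integral_norm_bound_ennreal not_integrable_integral_eq)
  also have "\<dots> \<le> (\<integral>\<^sup>+z. ennreal ((norm (F (fst z)))\<^sup>2 / 2) * ennreal (gaussian_hat e (fst z - snd z))
        + ennreal ((norm (F (snd z)))\<^sup>2 / 2) * ennreal (gaussian_hat e (fst z - snd z)) \<partial>lborel)"
  proof (rule nn_integral_mono)
    fix z :: "'a \<times> 'a"
    \<comment> \<open>Schur's test: after 2 a b <= a^2 + b^2 each term carries \<open>F\<close> in
      one variable only, and the transformed Gaussian integrates to 1 in the other.\<close>
    have "norm (F (fst z)) * norm (F (snd z)) \<le> (norm (F (fst z)))\<^sup>2 / 2 + (norm (F (snd z)))\<^sup>2 / 2"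
      using sum_squares_bound[of "norm (F (fst z))" "norm (F (snd z))"] by simp
    then have "norm (F (fst z)) * norm (F (snd z)) * gaussian_hat e (fst z - snd z)
      \<le> ((norm (F (fst z)))\<^sup>2 / 2 + (norm (F (snd z)))\<^sup>2 / 2) * gaussian_hat e (fst z - snd z)"
      by (intro mult_right_mono gaussian_hat_nonneg e)
    then show "ennreal (norm (K z * complex_of_real (gaussian_hat e (fst z - snd z)))) \<le>
       ennreal ((norm (F (fst z)))\<^sup>2 / 2) * ennreal (gaussian_hat e (fst z - snd z))
        + ennreal ((norm (F (snd z)))\<^sup>2 / 2) * ennreal (gaussian_hat e (fst z - snd z))"
      using gaussian_hat_nonneg[OF e, of "fst z - snd z"]
      by (simp add: K_def norm_mult ennreal_mult''[symmetric] ennreal_plus[symmetric] distrib_right del: ennreal_plus)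
  qed
  also have "\<dots> = (\<integral>\<^sup>+x. ennreal ((norm (F x))\<^sup>2 / 2) \<partial>lborel) + (\<integral>\<^sup>+x. ennreal ((norm (F x))\<^sup>2 / 2) \<partial>lborel)"
  proof -
    have [measurable]: "(\<lambda>z::'a \<times> 'a. ennreal (gaussian_hat e (fst z - snd z))) \<in> borel_measurable borel"
      "(\<lambda>z::'a \<times> 'a. ennreal ((norm (F (fst z)))\<^sup>2 / 2)) \<in> borel_measurable borel"
      "(\<lambda>z::'a \<times> 'a. ennreal ((norm (F (snd z)))\<^sup>2 / 2)) \<in> borel_measurable borel"
      by measurable
    have t: "(\<integral>\<^sup>+y. ennreal (gaussian_hat e (y - x)) \<partial>lborel) = 1" for x :: 'a
      using nn_integral_lborel_translate[of "\<lambda>y. ennreal (gaussian_hat e y)" "- x"]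
      by (simp add: nn_integral_gaussian_hat[OF e])
    have r: "(\<integral>\<^sup>+y. ennreal (gaussian_hat e (x - y)) \<partial>lborel) = 1" for x :: 'a
      using nn_integral_lborel_reflect[of "\<lambda>y. ennreal (gaussian_hat e y)" x]
      by (simp add: nn_integral_gaussian_hat[OF e])
    have 1: "(\<integral>\<^sup>+z. ennreal ((norm (F (fst z)))\<^sup>2 / 2) * ennreal (gaussian_hat e (fst z - snd z)) \<partial>lborel)
       = (\<integral>\<^sup>+x. ennreal ((norm (F x))\<^sup>2 / 2) \<partial>lborel)"
      by (subst nn_integral_lborel_pair(1)) (auto simp: nn_integral_cmult r)
    have 2: "(\<integral>\<^sup>+z. ennreal ((norm (F (snd z)))\<^sup>2 / 2) * ennreal (gaussian_hat e (fst z - snd z)) \<partial>lborel)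
       = (\<integral>\<^sup>+x. ennreal ((norm (F x))\<^sup>2 / 2) \<partial>lborel)"
      by (subst nn_integral_lborel_pair(2)) (auto simp: nn_integral_cmult t)
    show ?thesis
      by (subst nn_integral_add) (auto simp: 1 2)
  qed
  also have "\<dots> = (\<integral>\<^sup>+x. ennreal ((norm (F x))\<^sup>2) \<partial>lborel)"
    by (subst nn_integral_add[symmetric]) (auto intro!: nn_integral_cong simp: ennreal_plus[symmetric] simp del: ennreal_plus)
  finally show ?thesis .
qed

text \<open>Fatou's lemma removes the damping, since \<open>gaussian e\<close> tends to 1 pointwise
  as \<open>e\<close> tends to 0.\<close>

lemma plancherel_le:
  fixes F :: "'a::euclidean_space \<Rightarrow> complex"
  assumes F: "integrable lborel F"
  shows "(\<integral>\<^sup>+\<xi>. ennreal ((norm (fourier F \<xi>))\<^sup>2) \<partial>lborel) \<le> (\<integral>\<^sup>+x. ennreal ((norm (F x))\<^sup>2) \<partial>lborel)"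
proof -
  have [measurable]: "F \<in> borel_measurable borel" using F by auto
  define e where "e k = inverse (real (Suc k))" for k
  have lim: "(\<lambda>k. gaussian (e k) \<xi>) \<longlonglongrightarrow> 1" for \<xi> :: 'a
  proof -
    have "(\<lambda>k. gaussian (e k) \<xi>) \<longlonglongrightarrow> (\<Prod>b\<in>(Basis::'a set). exp (-(0 * (\<xi> \<bullet> b))\<^sup>2 / 2))"
      unfolding gaussian_def e_def by (intro tendsto_intros LIMSEQ_inverse_real_of_nat) simp
    then show ?thesis by simp
  qed
  have "(\<integral>\<^sup>+\<xi>. ennreal ((norm (fourier F \<xi>))\<^sup>2) \<partial>lborel)
     = (\<integral>\<^sup>+\<xi>. liminf (\<lambda>k. ennreal ((norm (fourier F \<xi>))\<^sup>2 * gaussian (e k) \<xi>)) \<partial>lborel)"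
  proof (intro nn_integral_cong lim_imp_Liminf[symmetric])
    fix \<xi> :: 'a
    have "(\<lambda>k. (norm (fourier F \<xi>))\<^sup>2 * gaussian (e k) \<xi>) \<longlonglongrightarrow> (norm (fourier F \<xi>))\<^sup>2 * 1"
      by (intro tendsto_intros lim)
    then show "(\<lambda>k. ennreal ((norm (fourier F \<xi>))\<^sup>2 * gaussian (e k) \<xi>)) \<longlonglongrightarrow> ennreal ((norm (fourier F \<xi>))\<^sup>2)"
      by (simp add: tendsto_ennrealI)
  qed simp
  also have "\<dots> \<le> liminf (\<lambda>k. \<integral>\<^sup>+\<xi>. ennreal ((norm (fourier F \<xi>))\<^sup>2 * gaussian (e k) \<xi>) \<partial>lborel)"
    by (rule nn_integral_liminf) measurable
  also have "\<dots> \<le> liminf (\<lambda>k. \<integral>\<^sup>+x. ennreal ((norm (F x))\<^sup>2) \<partial>lborel)"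
    by (intro Liminf_mono always_eventually allI plancherel_damped F) (simp add: e_def)
  finally show ?thesis by (simp add: Liminf_const)
qed

section \<open>A band-limited kernel\<close>

lemma integral_cis_eq_sinc:
  "(LINT y:{-1..1}|lborel. cis (t * y)) = 2 * complex_of_real (sinc t)"
proof (cases "t = 0")
  case True
  then show ?thesis
    by (simp add: set_lebesgue_integral_def scaleR_conv_of_real)
next
  case False
  have "has_bochner_integral lborel (\<lambda>y. indicator {-1..1} y *\<^sub>R cis (t * y)) (cis (t * 1) / (\<i> * t) - cis (t * -1) / (\<i> * t))"
  proof (rule has_bochner_integral_FTC_Icc)
    fix y :: real
    show "((\<lambda>y. cis (t * y) / (\<i> * t)) has_vector_derivative cis (t * y)) (at y within {-1..1})"
    proof -
      have "((\<lambda>y. cis (t * y)) has_vector_derivative \<i> * t * cis (t * y)) (at y within {-1..1})"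
        unfolding has_vector_derivative_complex_iff by (auto intro!: derivative_eq_intros)
      from has_vector_derivative_divide[OF this, of "\<i> * t"] False show ?thesis by simp
    qed
  qed (auto simp: cis_conv_exp intro!: continuous_intros)
  then have "(LINT y:{-1..1}|lborel. cis (t * y)) = (cis t - cis (- t)) / (\<i> * t)"
    by (simp add: set_lebesgue_integral_def has_bochner_integral_iff diff_divide_distrib)
  also have "cis t - cis (- t) = 2 * \<i> * complex_of_real (sin t)"
    by (simp add: complex_eq_iff)
  also have "2 * \<i> * complex_of_real (sin t) / (\<i> * t) = 2 * complex_of_real (sinc t)"
    using False by simp
  finally show ?thesis .
qed

lemma abs_sinc_le_1: "\<bar>sinc t\<bar> \<le> 1"
  using abs_sin_x_le_abs_x[of t] by (auto simp: divide_simps)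

text \<open>The sum of |sinc t| <= 1 and |t sinc t| <= 1. Boundedness at 0 and decay at infinity are
  packed into one bound that can be raised to a power.\<close>

lemma abs_sinc_bound: "\<bar>sinc t\<bar> * (1 + \<bar>t\<bar>) \<le> 2"
  using abs_sin_x_le_abs_x[of t] mult_right_mono[OF abs_sin_le_one[of t], of "\<bar>t\<bar>"]
  by (auto simp: divide_simps distrib_left)

text \<open>For \<open>e > 0\<close> the Gaussian factor makes the integral converge absolutely for
  every \<open>N\<close>, including 0 and 1, so the induction on \<open>N\<close> can start at a
  pure Gaussian.\<close>

definition damped_sinc_hat :: "real \<Rightarrow> nat \<Rightarrow> real \<Rightarrow> complex" where
  "damped_sinc_hat e N a = (LINT t|lborel. cis (a * t) * complex_of_real (sinc t ^ N * exp (-(e * t)\<^sup>2 / 2)))"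

text \<open>Each factor sinc replaces the transform by its average over an interval of radius 1, so the frequency support grows by 1 in each step of the induction.\<close>

lemma damped_sinc_hat_bound:
  assumes e: "e > 0" and d: "d \<ge> 0" and a: "\<bar>a\<bar> \<ge> real N + d"
  shows "norm (damped_sinc_hat e N a) \<le> sqrt (2 * pi) / e * exp (-(d / e)\<^sup>2 / 2)"
  using a
proof (induction N arbitrary: a)
  case 0
  have "norm (damped_sinc_hat e 0 a) = sqrt (2 * pi) / e * exp (-(a / e)\<^sup>2 / 2)"
    using has_bochner_integral_integral_eq[OF wave_gaussian_integral[OF e, of a]] e
    by (simp add: damped_sinc_hat_def norm_mult norm_divide)
  also have "\<dots> \<le> sqrt (2 * pi) / e * exp (-(d / e)\<^sup>2 / 2)"
    using e d 0 power_mono[of d "\<bar>a\<bar>" 2]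
    by (intro mult_left_mono) (auto simp: power_divide divide_right_mono)
  finally show ?case .
next
  case (Suc N)
  let ?B = "sqrt (2 * pi) / e * exp (-(d / e)\<^sup>2 / 2)"
  define h where "h t = sinc t ^ N * exp (-(e * t)\<^sup>2 / 2)" for t :: real
  have [measurable]: "h \<in> borel_measurable borel" unfolding h_def by measurable
  have h_le: "\<bar>h t\<bar> \<le> exp (-(e * t)\<^sup>2 / 2)" for t
    using mult_right_mono[OF power_mono[OF abs_sinc_le_1[of t], of N], of "exp (-(e * t)\<^sup>2 / 2)"]
    by (simp add: h_def abs_mult power_abs)
  have g: "integrable lborel (\<lambda>t. exp (-(e * t)\<^sup>2 / 2))"
    using has_bochner_integral_bounded_linear[OF bounded_linear_Re wave_gaussian_integral[OF e, of 0]]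
    by (simp add: has_bochner_integral_iff)
  have h: "integrable lborel h"
    by (rule Bochner_Integration.integrable_bound[OF g]) (use h_le in auto)
  have pair: "integrable lborel (\<lambda>z. h (fst z) *\<^sub>R (indicator {-1..1} (snd z) *\<^sub>R cis ((a + snd z) * fst z)))"
  proof (rule Bochner_Integration.integrable_bound)
    show "integrable lborel (\<lambda>z. h (fst z) * indicator {-1..1::real} (snd z))"
      using has_bochner_integral_lborel_pair[OF h, of "indicator {-1..1::real}"]
      by (simp add: has_bochner_integral_iff integrable_indicator_iff emeasure_lborel_Icc_eq)
  qed (auto simp: cis_conv_exp split: split_indicator)
  \<comment> \<open>One factor \<open>sinc t\<close> is replaced by half the integral of
    \<open>cis (t * y)\<close> over |y| <= 1; then the order of integration is exchanged.\<close>
  have "damped_sinc_hat e (Suc N) a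
      = (LINT t|lborel. (LINT y|lborel. h t *\<^sub>R (indicator {-1..1} y *\<^sub>R cis ((a + y) * t)))) / 2"
  proof -
    have "(LINT y|lborel. h t *\<^sub>R (indicator {-1..1} y *\<^sub>R cis ((a + y) * t)))
        = 2 * (cis (a * t) * complex_of_real (sinc t ^ Suc N * exp (-(e * t)\<^sup>2 / 2)))" for t
    proof -
      have "(LINT y|lborel. h t *\<^sub>R (indicator {-1..1} y *\<^sub>R cis ((a + y) * t)))
         = (LINT y|lborel. (h t * cis (a * t)) * (indicator {-1..1} y *\<^sub>R cis (t * y)))"
        by (intro Bochner_Integration.integral_cong refl)
           (simp add: scaleR_conv_of_real cis_mult algebra_simps)
      also have "\<dots> = h t * cis (a * t) * (2 * complex_of_real (sinc t))"
        by (subst integral_mult_right_zero) (simp add: integral_cis_eq_sinc[unfolded set_lebesgue_integral_def])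
      finally show ?thesis by (simp add: h_def mult_ac)
    qed
    then show ?thesis by (simp add: damped_sinc_hat_def)
  qed
  also have "(LINT t|lborel. (LINT y|lborel. h t *\<^sub>R (indicator {-1..1} y *\<^sub>R cis ((a + y) * t))))
      = (LINT y|lborel. (LINT t|lborel. h t *\<^sub>R (indicator {-1..1} y *\<^sub>R cis ((a + y) * t))))"
    by (rule lborel_fubini[symmetric, OF pair])
  also have "\<dots> = (LINT y|lborel. indicator {-1..1} y *\<^sub>R damped_sinc_hat e N (a + y))"
  proof (intro Bochner_Integration.integral_cong refl)
    fix y :: real
    have "(LINT t|lborel. h t *\<^sub>R (indicator {-1..1} y *\<^sub>R cis ((a + y) * t)))
       = (LINT t|lborel. indicator {-1..1} y *\<^sub>R (cis ((a + y) * t) * complex_of_real (sinc t ^ N * exp (-(e * t)\<^sup>2 / 2))))"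
      by (intro Bochner_Integration.integral_cong refl) (simp add: h_def scaleR_conv_of_real mult_ac)
    then show "(LINT t|lborel. h t *\<^sub>R (indicator {-1..1} y *\<^sub>R cis ((a + y) * t))) = indicator {-1..1} y *\<^sub>R damped_sinc_hat e N (a + y)"
      by (simp add: damped_sinc_hat_def)
  qed
  finally have eq: "damped_sinc_hat e (Suc N) a = (LINT y|lborel. indicator {-1..1} y *\<^sub>R damped_sinc_hat e N (a + y)) / 2" .
  \<comment> \<open>The averaged frequencies satisfy |a + y| >= N + d, and the length 2 of the
    interval cancels the division by 2, so the bound is the same for every \<open>N\<close>.\<close>
  have "norm (LINT y|lborel. indicator {-1..1} y *\<^sub>R damped_sinc_hat e N (a + y))
      \<le> (LINT y|lborel. indicator {-1..1::real} y * ?B)"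
  proof (rule Bochner_Integration.integral_norm_bound_integral)
    show "integrable lborel (\<lambda>y. indicator {-1..1} y *\<^sub>R damped_sinc_hat e N (a + y))"
    proof (rule Bochner_Integration.integrable_bound)
      show "integrable lborel (\<lambda>y. indicator {-1..1::real} y * ?B)" by simp
      show "(\<lambda>y. indicator {- 1..1} y *\<^sub>R damped_sinc_hat e N (a + y)) \<in> borel_measurable lborel"
        unfolding damped_sinc_hat_def cis_conv_exp by measurable
      show "AE y in lborel. norm (indicator {-1..1} y *\<^sub>R damped_sinc_hat e N (a + y)) \<le> norm (indicator {-1..1} y * ?B)"
      proof (intro AE_I2)
        fix y :: real
        show "norm (indicator {-1..1} y *\<^sub>R damped_sinc_hat e N (a + y)) \<le> norm (indicator {-1..1} y * ?B)"
          using Suc.IH[of "a + y"] Suc.prems e by (auto split: split_indicator)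
      qed
    qed
    show "integrable lborel (\<lambda>y. indicator {-1..1::real} y * ?B)" by simp
    fix y :: real
    show "norm (indicator {-1..1} y *\<^sub>R damped_sinc_hat e N (a + y)) \<le> indicator {-1..1} y * ?B"
      using Suc.IH[of "a + y"] Suc.prems by (auto split: split_indicator)
  qed
  then show ?case by (simp add: eq norm_divide mult_ac)
qed

text \<open>The damped transform converges to this integral by dominated convergence. At distance d
  > 0 beyond the band, \<open>damped_sinc_hat_bound\<close> is a multiple of (1/e) exp(-d^2 / (2
  e^2)), which tends to 0 with \<open>e\<close>.\<close>

lemma integral_sinc_power_cis:
  assumes N: "N \<ge> 2" and a: "\<bar>a\<bar> > real N"
    and int: "integrable lborel (\<lambda>t. sinc t ^ N)"
  shows "(LINT t|lborel. cis (a * t) * complex_of_real (sinc t ^ N)) = 0"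
proof -
  define d where "d = \<bar>a\<bar> - real N"
  have d: "d > 0" using a by (simp add: d_def)
  define e where "e k = inverse (real (Suc k))" for k
  have e: "e k > 0" for k by (simp add: e_def)
  have "(\<lambda>k. damped_sinc_hat (e k) N a) \<longlonglongrightarrow> (LINT t|lborel. cis (a * t) * complex_of_real (sinc t ^ N))"
    unfolding damped_sinc_hat_def
  proof (rule integral_dominated_convergence)
    show "integrable lborel (\<lambda>t. norm (sinc t ^ N))" using int by simp
    show "AE t in lborel. (\<lambda>k. cis (a * t) * complex_of_real (sinc t ^ N * exp (-(e k * t)\<^sup>2 / 2)))
             \<longlonglongrightarrow> cis (a * t) * complex_of_real (sinc t ^ N)"
    proof (intro AE_I2)
      fix t :: real
      have "(\<lambda>k. cis (a * t) * complex_of_real (sinc t ^ N * exp (-(e k * t)\<^sup>2 / 2)))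
             \<longlonglongrightarrow> cis (a * t) * complex_of_real (sinc t ^ N * exp (-(0 * t)\<^sup>2 / 2))"
        unfolding e_def by (intro tendsto_intros LIMSEQ_inverse_real_of_nat) simp
      then show "(\<lambda>k. cis (a * t) * complex_of_real (sinc t ^ N * exp (-(e k * t)\<^sup>2 / 2)))
             \<longlonglongrightarrow> cis (a * t) * complex_of_real (sinc t ^ N)" by simp
    qed
    show "AE t in lborel. norm (cis (a * t) * complex_of_real (sinc t ^ N * exp (-(e k * t)\<^sup>2 / 2))) \<le> norm (sinc t ^ N)" for k
    proof (intro AE_I2)
      fix t :: real
      define s where "s = sinc t ^ N"
      have "norm (cis (a * t) * complex_of_real (s * exp (-(e k * t)\<^sup>2 / 2))) \<le> norm s"
        by (simp add: norm_mult abs_mult mult_left_le)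
      then show "norm (cis (a * t) * complex_of_real (sinc t ^ N * exp (-(e k * t)\<^sup>2 / 2))) \<le> norm (sinc t ^ N)"
        by (simp only: s_def)
    qed
  qed (simp_all add: cis_conv_exp)
  moreover have "(\<lambda>k. damped_sinc_hat (e k) N a) \<longlonglongrightarrow> 0"
  proof (rule Lim_null_comparison)
    show "\<forall>\<^sub>F k in sequentially. norm (damped_sinc_hat (e k) N a) \<le> sqrt (2 * pi) / e k * exp (-(d / e k)\<^sup>2 / 2)"
      using damped_sinc_hat_bound[OF e, of d N a] d by (simp add: d_def)
    show "(\<lambda>k. sqrt (2 * pi) / e k * exp (-(d / e k)\<^sup>2 / 2)) \<longlonglongrightarrow> 0"
      unfolding e_def using d by real_asymp
  qed
  ultimately show ?thesis by (rule LIMSEQ_unique)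
qed

text \<open>The kernel is a normalized and dilated even power of sinc: evenness of the exponent
  gives positivity, its size gives the moments, and the dilation brings the band to [-1, 1].\<close>

lemma band_limited_kernel_exists:
  "\<exists>v::real \<Rightarrow> real. (\<forall>t. v t \<ge> 0) \<and> integrable lborel (\<lambda>t. v t * (1 + \<bar>t\<bar>) ^ M) \<and> integrable lborel v \<and>
     (LINT t|lborel. v t) = 1 \<and>
     (\<forall>u. \<bar>u\<bar> > 1 \<longrightarrow> (LINT t|lborel. cis (2 * pi * u * t) * complex_of_real (v t)) = 0)"
proof -
  \<comment> \<open>Even for positivity, and at least \<open>M + 2\<close>, so that the decay of
    t^(-2) is left after multiplication by (1 + |t|)^M.\<close>
  define N where "N = 2 * (M + 1)"
  have N2: "N \<ge> 2" "N > 0" by (auto simp: N_def)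
  have int_M: "integrable lborel (\<lambda>t. sinc t ^ N * (1 + \<bar>t\<bar>) ^ k)" if "k \<le> M" for k
  proof (rule Bochner_Integration.integrable_bound)
    have "integrable lborel (\<lambda>t::real. inverse (1 + t\<^sup>2))"
      using integrable_inverse_1_plus_square by (simp add: set_integrable_def)
    then show "integrable lborel (\<lambda>t::real. 2 ^ N * inverse (1 + t\<^sup>2))" by simp
    show "AE t in lborel. norm (sinc t ^ N * (1 + \<bar>t\<bar>) ^ k) \<le> norm (2 ^ N * inverse (1 + t\<^sup>2))"
    proof (intro AE_I2)
      fix t :: real
      define s where "s = \<bar>sinc t\<bar>"
      have s: "s \<ge> 0" "s * (1 + \<bar>t\<bar>) \<le> 2" using abs_sinc_bound[of t] by (auto simp only: s_def abs_ge_zero)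
      have "s ^ N * (1 + \<bar>t\<bar>) ^ k * (1 + t\<^sup>2) \<le> s ^ N * (1 + \<bar>t\<bar>) ^ k * (1 + \<bar>t\<bar>) ^ 2"
        using s by (intro mult_left_mono) (auto simp: power2_sum)
      also have "\<dots> = s ^ N * (1 + \<bar>t\<bar>) ^ (k + 2)"
        by (simp add: power_add power2_eq_square mult.assoc)
      also have "\<dots> \<le> s ^ N * (1 + \<bar>t\<bar>) ^ N"
        using that s by (intro mult_left_mono power_increasing) (auto simp: N_def)
      also have "\<dots> \<le> 2 ^ N"
        using power_mono[OF s(2), of N] s by (simp add: power_mult_distrib)
      finally have "s ^ N * (1 + \<bar>t\<bar>) ^ k \<le> 2 ^ N / (1 + t\<^sup>2)"
        by (subst pos_le_divide_eq) (auto simp: add_pos_nonneg)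
      then have "\<bar>sinc t\<bar> ^ N * (1 + \<bar>t\<bar>) ^ k \<le> 2 ^ N / (1 + t\<^sup>2)"
        by (simp only: s_def)
      then show "norm (sinc t ^ N * (1 + \<bar>t\<bar>) ^ k) \<le> norm (2 ^ N * inverse (1 + t\<^sup>2))"
        by (simp add: abs_mult power_abs divide_inverse)
    qed
  qed measurable
  have int: "integrable lborel (\<lambda>t. sinc t ^ N)" using int_M[of 0] by simp
  define Z where "Z = (LINT t|lborel. sinc t ^ N)"
  have even: "sinc t ^ N \<ge> 0" for t unfolding N_def by (rule zero_le_even_power) simp
  \<comment> \<open>A vanishing integral of a nonnegative function would force sin t = 0 for almost
    every t in (0, 1).\<close>
  have "Z \<noteq> 0"
  proof
    assume "Z = 0"
    then have "AE t in lborel. sinc t ^ N = 0"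
      using integral_nonneg_eq_0_iff_AE[OF int] even by (simp add: Z_def)
    then have "AE t in lborel. t \<notin> {0<..<1::real}"
    proof eventually_elim
      case (elim t)
      then have "sin t = 0" if "t > 0" using N2 that by auto
      then show ?case using sin_gt_zero[of t] pi_gt3 by auto
    qed
    then have "emeasure lborel {0<..<1::real} = 0"
      by (subst (asm) AE_iff_measurable[of "{0<..<1::real}"]) auto
    then show False by simp
  qed
  moreover have "Z \<ge> 0" unfolding Z_def by (intro Bochner_Integration.integral_nonneg even)
  ultimately have Z: "Z > 0" by simp
  define v where "v t = sinc t ^ N / Z" for t
  \<comment> \<open>The transform of sinc^N vanishes beyond angular frequency \<open>N\<close>;
    after dilation by \<open>c\<close> the angular frequency 2 pi u corresponds to N u, so the
    threshold becomes |u| > 1.\<close>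
  define c where "c = 2 * pi / real N"
  have c: "c > 0" using N2 by (simp add: c_def)
  define v where "v t = c / Z * sinc (c * t) ^ N" for t
  have v_nonneg: "v t \<ge> 0" for t
    unfolding v_def using c Z by (intro mult_nonneg_nonneg even) auto
  have v_int: "has_bochner_integral lborel v 1"
  proof -
    have "has_bochner_integral lborel (\<lambda>t. c / Z * (sinc (0 + c * t) ^ N)) (c / Z * (Z /\<^sub>R \<bar>c\<bar>))"
      using int c by (intro has_bochner_integral_mult_right lborel_has_bochner_integral_real_affine_iff[THEN iffD1])
         (simp_all only: has_bochner_integral_iff Z_def simp_thms)
    moreover have "c / Z * (Z /\<^sub>R \<bar>c\<bar>) = 1" using c Z by simp
    ultimately show ?thesis unfolding v_def[abs_def] by (simp only: add_0)
  qed
  have v_M: "integrable lborel (\<lambda>t. v t * (1 + \<bar>t\<bar>) ^ M)"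
  proof (rule Bochner_Integration.integrable_bound)
    define D where "D = 1 + 1 / c"
    have "integrable lborel (\<lambda>t. sinc (0 + c * t) ^ N * (1 + \<bar>0 + c * t\<bar>) ^ M)"
      using c by (intro lborel_integrable_real_affine int_M) auto
    then show "integrable lborel (\<lambda>t. c / Z * D ^ M * (sinc (0 + c * t) ^ N * (1 + \<bar>0 + c * t\<bar>) ^ M))"
      by (rule integrable_mult_right)
    show "(\<lambda>t. v t * (1 + \<bar>t\<bar>) ^ M) \<in> borel_measurable lborel"
      using v_int by (auto simp: has_bochner_integral_iff)
    show "AE t in lborel. norm (v t * (1 + \<bar>t\<bar>) ^ M) \<le> norm (c / Z * D ^ M * (sinc (0 + c * t) ^ N * (1 + \<bar>0 + c * t\<bar>) ^ M))"
    proof (intro AE_I2)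
      fix t :: real
      define s where "s = sinc (c * t) ^ N"
      have s: "s \<ge> 0" using even by (simp only: s_def)
      have "1 + \<bar>t\<bar> \<le> D * (1 + \<bar>c * t\<bar>)"
        using c by (simp add: D_def field_simps abs_mult)
      then have "(1 + \<bar>t\<bar>) ^ M \<le> D ^ M * (1 + \<bar>c * t\<bar>) ^ M"
        by (subst power_mult_distrib[symmetric]) (intro power_mono, auto)
      then have "c / Z * s * (1 + \<bar>t\<bar>) ^ M \<le> c / Z * s * (D ^ M * (1 + \<bar>c * t\<bar>) ^ M)"
        using c Z s by (intro mult_left_mono) auto
      also have "\<dots> = c / Z * D ^ M * (s * (1 + \<bar>0 + c * t\<bar>) ^ M)"
        by (simp add: mult_ac)
      also have "\<dots> \<le> norm (c / Z * D ^ M * (s * (1 + \<bar>0 + c * t\<bar>) ^ M))"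
        unfolding real_norm_def by (rule abs_ge_self)
      finally have "norm (c / Z * s * (1 + \<bar>t\<bar>) ^ M) \<le> norm (c / Z * D ^ M * (s * (1 + \<bar>0 + c * t\<bar>) ^ M))"
        using c Z s by (simp add: abs_mult)
      then show "norm (v t * (1 + \<bar>t\<bar>) ^ M) \<le> norm (c / Z * D ^ M * (sinc (0 + c * t) ^ N * (1 + \<bar>0 + c * t\<bar>) ^ M))"
        by (simp only: v_def s_def add_0)
    qed
  qed
  have v_hat: "(LINT t|lborel. cis (2 * pi * u * t) * complex_of_real (v t)) = 0" if "\<bar>u\<bar> > 1" for u
  proof -
    have "(LINT t|lborel. cis (real N * u * t) * complex_of_real (sinc t ^ N)) = 0"
      using that N2 by (intro integral_sinc_power_cis int) (auto simp: abs_mult)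
    then have "(LINT t|lborel. cis (real N * u * (0 + c * t)) * complex_of_real (sinc (0 + c * t) ^ N)) = 0"
      using lborel_integral_real_affine[of c "\<lambda>t. cis (real N * u * t) * complex_of_real (sinc t ^ N)" 0] c
      by (simp only: scaleR_eq_0_iff) auto
    then have "(LINT t|lborel. cis (real N * u * (c * t)) * complex_of_real (sinc (c * t) ^ N)) = 0"
      by (simp only: add_0)
    then have "(LINT t|lborel. complex_of_real (c / Z) * (cis (2 * pi * u * t) * complex_of_real (sinc (c * t) ^ N))) = 0"
      using N2 by (subst integral_mult_right_zero) (simp add: c_def mult_ac)
    then show ?thesis
      by (simp only: v_def of_real_mult mult_ac)
  qed
  show ?thesis
    using v_nonneg v_M v_int v_hat by (intro exI[of _ v]) (auto simp: has_bochner_integral_iff)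
qed

section \<open>The trilinear Cauchy-Schwarz inequality\<close>

text \<open>Any two of the first coordinate, the second coordinate and their sum are
  measure-preserving coordinates on the product space; hence this formula and the two variants with
  the sum.\<close>

lemma nn_integral_pair_mult:
  fixes f :: "'a::euclidean_space \<Rightarrow> ennreal" and g :: "'b::euclidean_space \<Rightarrow> ennreal"
  assumes [measurable]: "f \<in> borel_measurable borel" "g \<in> borel_measurable borel"
  shows "(\<integral>\<^sup>+z. f (fst z) * g (snd z) \<partial>lborel) = integral\<^sup>N lborel f * integral\<^sup>N lborel g"
  by (subst nn_integral_lborel_pair(1)) (auto simp: nn_integral_cmult nn_integral_multc)

lemma borel_measurable_fst_add_snd [measurable]:
  "(\<lambda>z. fst z + snd z) \<in> borel_measurable (borel :: ('a::euclidean_space \<times> 'a) measure)"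
  by measurable

lemma nn_integral_fst_mult_add:
  fixes f g :: "'a::euclidean_space \<Rightarrow> ennreal"
  assumes [measurable]: "f \<in> borel_measurable borel" "g \<in> borel_measurable borel"
  shows "(\<integral>\<^sup>+z. f (fst z) * g (fst z + snd z) \<partial>lborel) = integral\<^sup>N lborel f * integral\<^sup>N lborel g"
  by (subst nn_integral_lborel_pair(1)) (auto simp: nn_integral_cmult nn_integral_multc nn_integral_lborel_translate)

lemma nn_integral_snd_mult_add:
  fixes f g :: "'a::euclidean_space \<Rightarrow> ennreal"
  assumes [measurable]: "f \<in> borel_measurable borel" "g \<in> borel_measurable borel"
  shows "(\<integral>\<^sup>+z. f (snd z) * g (fst z + snd z) \<partial>lborel) = integral\<^sup>N lborel f * integral\<^sup>N lborel g"
proof -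
  have "(\<integral>\<^sup>+x. g (x + y) \<partial>lborel) = integral\<^sup>N lborel g" for y
    using nn_integral_lborel_translate[of g y] by (simp add: add.commute)
  then show ?thesis
    by (subst nn_integral_lborel_pair(2)) (auto simp: nn_integral_cmult nn_integral_multc)
qed

definition sq_integral :: "('a::euclidean_space \<Rightarrow> complex) \<Rightarrow> ennreal" where
  "sq_integral f = (\<integral>\<^sup>+x. ennreal ((norm (f x))\<^sup>2) \<partial>lborel)"

text \<open>The integrand is a product of the four \<open>L^4\<close> functions \<open>m\<close>, \<open>(uv)^(1/2)\<close>, \<open>(vw)^(1/2)\<close>, \<open>(uw)^(1/2)\<close>.\<close>

lemma trilinear_cauchy_schwarz:
  fixes m :: "'a::euclidean_space \<times> 'a \<Rightarrow> complex"
  assumes [measurable]: "m \<in> borel_measurable borel" "u \<in> borel_measurable borel"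
    "v \<in> borel_measurable borel" "w \<in> borel_measurable borel"
  shows "(\<integral>\<^sup>+z. ennreal (norm (m z * u (fst z) * v (snd z) * w (fst z + snd z))) \<partial>lborel) ^ 4
    \<le> (\<integral>\<^sup>+z. ennreal (norm (m z) ^ 4) \<partial>lborel) * (sq_integral u * sq_integral v * sq_integral w)\<^sup>2"
    (is "?X ^ 4 \<le> ?M * _")
proof -
  \<comment> \<open>The root of |u| |v| goes to both sides of the first Cauchy-Schwarz step. A
    second application to each side then leaves the quartic integral of \<open>m\<close> and
    integrals of products of two squares.\<close>
  let ?s = "\<lambda>z. sqrt (norm (u (fst z)) * norm (v (snd z)))"
  let ?w = "\<lambda>z. norm (w (fst z + snd z))"
  have "?X = (\<integral>\<^sup>+z. ennreal (norm (m z) * ?s z) * ennreal (?s z * ?w z) \<partial>lborel)"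
    by (intro nn_integral_cong) (simp add: norm_mult ennreal_mult'[symmetric] mult_ac)
  then have "?X\<^sup>2 \<le> (\<integral>\<^sup>+z. ennreal (norm (m z) * ?s z) ^ 2 \<partial>lborel) * (\<integral>\<^sup>+z. ennreal (?s z * ?w z) ^ 2 \<partial>lborel)"
    (is "_ \<le> ?A * ?B")
    by (simp only:) (rule Cauchy_Schwarz_nn_integral; measurable)
  then have "(?X\<^sup>2)\<^sup>2 \<le> (?A * ?B)\<^sup>2"
    by (rule power_mono) simp
  then have X: "?X ^ 4 \<le> ?A\<^sup>2 * ?B\<^sup>2"
    by (simp add: power_mult_distrib flip: power_mult)
  have "?A = (\<integral>\<^sup>+z. ennreal ((norm (m z))\<^sup>2) * ennreal (norm (u (fst z)) * norm (v (snd z))) \<partial>lborel)"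
    by (intro nn_integral_cong) (simp add: ennreal_mult'[symmetric] ennreal_power power_mult_distrib)
  then have "?A\<^sup>2 \<le> (\<integral>\<^sup>+z. ennreal ((norm (m z))\<^sup>2) ^ 2 \<partial>lborel) * (\<integral>\<^sup>+z. ennreal (norm (u (fst z)) * norm (v (snd z))) ^ 2 \<partial>lborel)"
    by (simp only:) (rule Cauchy_Schwarz_nn_integral; measurable)
  also have "(\<integral>\<^sup>+z. ennreal ((norm (m z))\<^sup>2) ^ 2 \<partial>lborel) = ?M"
    by (intro nn_integral_cong) (simp add: ennreal_power flip: power_mult)
  also have "(\<integral>\<^sup>+z. ennreal (norm (u (fst z)) * norm (v (snd z))) ^ 2 \<partial>lborel)
     = (\<integral>\<^sup>+z. ennreal ((norm (u (fst z)))\<^sup>2) * ennreal ((norm (v (snd z)))\<^sup>2) \<partial>lborel)"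
    by (intro nn_integral_cong) (simp add: ennreal_power power_mult_distrib ennreal_mult')
  also have "\<dots> = sq_integral u * sq_integral v"
    unfolding sq_integral_def by (rule nn_integral_pair_mult) measurable
  finally have A: "?A\<^sup>2 \<le> ?M * (sq_integral u * sq_integral v)" .
  have "?B = (\<integral>\<^sup>+z. ennreal (norm (u (fst z)) * ?w z) * ennreal (norm (v (snd z)) * ?w z) \<partial>lborel)"
    by (intro nn_integral_cong) (simp add: ennreal_mult'[symmetric] ennreal_power power_mult_distrib, simp add: power2_eq_square mult_ac)
  then have "?B\<^sup>2 \<le> (\<integral>\<^sup>+z. ennreal (norm (u (fst z)) * ?w z) ^ 2 \<partial>lborel) * (\<integral>\<^sup>+z. ennreal (norm (v (snd z)) * ?w z) ^ 2 \<partial>lborel)"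
    by (simp only:) (rule Cauchy_Schwarz_nn_integral; measurable)
  also have "(\<integral>\<^sup>+z. ennreal (norm (u (fst z)) * ?w z) ^ 2 \<partial>lborel)
     = (\<integral>\<^sup>+z. ennreal ((norm (u (fst z)))\<^sup>2) * ennreal ((?w z)\<^sup>2) \<partial>lborel)"
    by (intro nn_integral_cong) (simp add: ennreal_power power_mult_distrib ennreal_mult')
  also have "\<dots> = sq_integral u * sq_integral w"
    unfolding sq_integral_def by (rule nn_integral_fst_mult_add) measurable
  also have "(\<integral>\<^sup>+z. ennreal (norm (v (snd z)) * ?w z) ^ 2 \<partial>lborel)
     = (\<integral>\<^sup>+z. ennreal ((norm (v (snd z)))\<^sup>2) * ennreal ((?w z)\<^sup>2) \<partial>lborel)"
    by (intro nn_integral_cong) (simp add: ennreal_power power_mult_distrib ennreal_mult')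
  also have "\<dots> = sq_integral v * sq_integral w"
    unfolding sq_integral_def by (rule nn_integral_snd_mult_add) measurable
  finally have B: "?B\<^sup>2 \<le> sq_integral u * sq_integral w * (sq_integral v * sq_integral w)" .
  from X have "?X ^ 4 \<le> (?M * (sq_integral u * sq_integral v)) * (sq_integral u * sq_integral w * (sq_integral v * sq_integral w))"
    by (rule order_trans) (intro mult_mono A B; simp)
  then show ?thesis
    by (simp add: power2_eq_square mult_ac)
qed

section \<open>Finite differences\<close>

text \<open>The first increment is taken inside the recursion, so that inductions can generalize
  over the function; \<open>fdiff_Suc'\<close> recovers the outer increment.\<close>

primrec fdiff :: "nat \<Rightarrow> 'a::euclidean_space \<Rightarrow> ('a \<Rightarrow> complex) \<Rightarrow> 'a \<Rightarrow> complex" where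
  "fdiff 0 y f = f"
| "fdiff (Suc k) y f = fdiff k y (\<lambda>x. f (x + y) - f x)"

lemma fdiff_add: "fdiff k y (\<lambda>x. f x + g x) x = fdiff k y f x + fdiff k y g x"
proof (induction k arbitrary: f g)
  case (Suc k)
  have "(\<lambda>x. f (x + y) + g (x + y) - (f x + g x)) = (\<lambda>x. (f (x + y) - f x) + (g (x + y) - g x))"
    by (simp add: fun_eq_iff)
  then show ?case by (simp add: Suc.IH)
qed simp

lemma fdiff_diff: "fdiff k y (\<lambda>x. f x - g x) x = fdiff k y f x - fdiff k y g x"
  using fdiff_add[of k y "\<lambda>x. f x - g x" g x] by simp

lemma fdiff_translate: "fdiff k y (\<lambda>x. f (x + a)) x = fdiff k y f (x + a)"
proof (induction k arbitrary: f)
  case (Suc k)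
  show ?case using Suc.IH[of "\<lambda>x. f (x + y) - f x"] by (simp add: add_ac)
qed simp

lemma fdiff_Suc': "fdiff (Suc k) y f x = fdiff k y f (x + y) - fdiff k y f x"
  by (simp add: fdiff_diff fdiff_translate)

lemma fdiff_binomial:
  "fdiff k y f x = (\<Sum>i\<le>k. (-1) ^ (k + i) * of_nat (k choose i) * f (x + real i *\<^sub>R y))"
proof (induction k arbitrary: x)
  case (Suc k)
  have 1: "fdiff k y f (x + y) = (\<Sum>i\<le>k. (-1) ^ (k + i) * of_nat (k choose i) * f (x + real (Suc i) *\<^sub>R y))"
    unfolding Suc.IH by (intro sum.cong refl) (simp add: algebra_simps)
  \<comment> \<open>The added term \<open>i = Suc k\<close> has binomial coefficient 0, so the two
    sums have ranges that combine by Pascal's rule.\<close>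
  have 2: "- fdiff k y f x = (\<Sum>i\<le>Suc k. (-1) ^ (Suc k + i) * of_nat (k choose i) * f (x + real i *\<^sub>R y))"
    unfolding Suc.IH by (simp add: sum_negf[symmetric])
  have "fdiff (Suc k) y f x = fdiff k y f (x + y) + - fdiff k y f x"
    by (simp only: fdiff_Suc') simp
  also have "\<dots> = (\<Sum>i\<le>Suc k. (-1) ^ (Suc k + i) * of_nat (Suc k choose i) * f (x + real i *\<^sub>R y))"
    unfolding 1 2 by (simp only: sum.atMost_Suc_shift)
      (simp add: sum.distrib[symmetric] algebra_simps)
  finally show ?case .
qed simp

text \<open>\<open>partial_deriv\<close> rests on the total function
  \<open>vector_derivative\<close>, which respects differences only where the derivatives exist;
  this existence is what \<open>C_class k\<close> supplies.\<close>

lemma iter_partial_translate_diff: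
  assumes f: "f \<in> C_class k" and "multiindex \<alpha>" "length \<alpha> \<le> k"
  shows "iter_partial \<alpha> (\<lambda>x. f (x + p) - f (x + q)) = (\<lambda>x. iter_partial \<alpha> f (x + p) - iter_partial \<alpha> f (x + q))"
  using assms(2,3)
proof (induction \<alpha>)
  case (Cons b \<alpha>)
  then have \<alpha>: "multiindex \<alpha>" "length \<alpha> < k" "b \<in> Basis" by (auto simp: multiindex_def)
  have d: "(\<lambda>t::real. iter_partial \<alpha> f (x + t *\<^sub>R b)) differentiable (at 0)" for x
    using f \<alpha> by (auto simp: C_class_def)
  have eq: "(\<lambda>t. iter_partial \<alpha> f (x + t *\<^sub>R b + p) - iter_partial \<alpha> f (x + t *\<^sub>R b + q))
     = (\<lambda>t. iter_partial \<alpha> f ((x + p) + t *\<^sub>R b) - iter_partial \<alpha> f ((x + q) + t *\<^sub>R b))" for x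
    by (simp add: add_ac)
  show ?case
    using Cons.IH \<alpha> by (auto simp: partial_deriv_def fun_eq_iff eq vector_derivative_diff_at[OF d d])
qed simp

lemma C_class_translate_diff:
  assumes f: "f \<in> C_class k"
  shows "(\<lambda>x. f (x + p) - f (x + q)) \<in> C_class k"
proof -
  have "(\<lambda>t::real. iter_partial \<alpha> (\<lambda>x. f (x + p) - f (x + q)) (x + t *\<^sub>R b)) differentiable (at 0)"
    if "multiindex \<alpha>" "length \<alpha> < k" "b \<in> Basis" for \<alpha> b x
  proof -
    have d: "(\<lambda>t::real. iter_partial \<alpha> f ((x + a) + t *\<^sub>R b)) differentiable (at 0)" for a
      using f that unfolding C_class_def by blast
    show ?thesis
      using differentiable_diff[OF d[of p] d[of q]] that
      by (simp add: iter_partial_translate_diff[OF f] add_ac)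
  qed
  moreover have "continuous_on UNIV (iter_partial \<alpha> (\<lambda>x. f (x + p) - f (x + q)))"
    if "multiindex \<alpha>" "length \<alpha> \<le> k" for \<alpha>
  proof -
    have c: "continuous_on UNIV (iter_partial \<alpha> f)" using f that by (auto simp: C_class_def)
    show ?thesis
      unfolding iter_partial_translate_diff[OF f that]
      by (intro continuous_intros continuous_on_compose2[OF c]) auto
  qed
  ultimately show ?thesis by (auto simp: C_class_def)
qed

lemma C_class_mono: "f \<in> C_class k \<Longrightarrow> l \<le> k \<Longrightarrow> f \<in> C_class l"
  by (auto simp: C_class_def)

text \<open>\<open>C_class\<close> speaks of derivatives at parameter 0 only, but for every base
  point; moving the base point along \<open>b\<close> gives the derivative at each
  \<open>s\<close>.\<close>

lemma iter_partial_has_vector_derivative: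
  assumes f: "f \<in> C_class k" and \<alpha>: "multiindex \<alpha>" "length \<alpha> < k" "b \<in> Basis"
  shows "((\<lambda>t. iter_partial \<alpha> f (x + t *\<^sub>R b)) has_vector_derivative iter_partial (b # \<alpha>) f (x + s *\<^sub>R b)) (at s within S)"
proof -
  have "(\<lambda>t::real. iter_partial \<alpha> f ((x + s *\<^sub>R b) + t *\<^sub>R b)) differentiable (at 0)"
    using f \<alpha> unfolding C_class_def by blast
  then have "((\<lambda>t. iter_partial \<alpha> f ((x + s *\<^sub>R b) + t *\<^sub>R b)) has_vector_derivative iter_partial (b # \<alpha>) f (x + s *\<^sub>R b)) (at (s - s))"
    by (simp add: vector_derivative_works partial_deriv_def)
  moreover have "((\<lambda>t. t - s) has_vector_derivative 1) (at s)"
    by (auto intro!: derivative_eq_intros)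
  ultimately have "((\<lambda>t. iter_partial \<alpha> f ((x + s *\<^sub>R b) + t *\<^sub>R b)) \<circ> (\<lambda>t. t - s) has_vector_derivative 1 *\<^sub>R iter_partial (b # \<alpha>) f (x + s *\<^sub>R b)) (at s)"
    by (intro vector_diff_chain_at) auto
  then show ?thesis
    by (auto simp: o_def algebra_simps intro: has_vector_derivative_at_within)
qed

lemma norm_iter_partial_increment_le:
  assumes f: "f \<in> C_class k" and \<alpha>: "multiindex \<alpha>" "length \<alpha> < k" "b \<in> Basis"
    and C: "\<And>x. norm (iter_partial (b # \<alpha>) f x) \<le> C"
  shows "norm (iter_partial \<alpha> f (x + s *\<^sub>R b) - iter_partial \<alpha> f x) \<le> \<bar>s\<bar> * C"
proof -
  have "norm (iter_partial \<alpha> f (x + s *\<^sub>R b) - iter_partial \<alpha> f (x + 0 *\<^sub>R b)) \<le> C * norm (s - 0)"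
  proof (rule differentiable_bound[where S = UNIV and f = "\<lambda>t. iter_partial \<alpha> f (x + t *\<^sub>R b)"
        and f' = "\<lambda>t h. h *\<^sub>R iter_partial (b # \<alpha>) f (x + t *\<^sub>R b)"])
    show "((\<lambda>t. iter_partial \<alpha> f (x + t *\<^sub>R b)) has_derivative (\<lambda>h. h *\<^sub>R iter_partial (b # \<alpha>) f (x + t *\<^sub>R b))) (at t within UNIV)" for t
      using iter_partial_has_vector_derivative[OF f \<alpha>] by (simp only: has_vector_derivative_def)
    show "onorm (\<lambda>h. h *\<^sub>R iter_partial (b # \<alpha>) f (x + t *\<^sub>R b)) \<le> C" for t
      by (rule onorm_le) (metis C mult.commute mult_left_mono norm_ge_zero norm_scaleR real_norm_def)
  qed auto
  then show ?thesis by (simp add: mult.commute)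
qed

text \<open>Telescoping the increment along the coordinate directions avoids a chain rule for directional derivatives.\<close>

lemma norm_fdiff_le:
  assumes "f \<in> C_class k"
    and "\<And>\<alpha> x. multiindex \<alpha> \<Longrightarrow> length \<alpha> = k \<Longrightarrow> norm (iter_partial \<alpha> f x) \<le> C"
  shows "norm (fdiff k y f x) \<le> (\<Sum>b\<in>Basis. \<bar>y \<bullet> b\<bar>) ^ k * C"
  using assms
proof (induction k arbitrary: f x C)
  case 0
  then show ?case by (simp add: multiindex_def)
next
  case (Suc k)
  let ?S = "(\<Sum>b\<in>Basis. \<bar>y \<bullet> b\<bar>)"
  have fk: "f \<in> C_class k" using Suc.prems(1) C_class_mono by (metis Suc_n_not_le_n nat_le_linear)
  have "norm (fdiff k y (\<lambda>x. f (x + (\<Sum>b\<in>B. (y \<bullet> b) *\<^sub>R b)) - f x) x) \<le> (\<Sum>b\<in>B. \<bar>y \<bullet> b\<bar>) * (?S ^ k * C)"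
    if "B \<subseteq> Basis" for B x
    using finite_subset[OF that finite_Basis] that
  proof (induction B)
    case empty
    have "fdiff k y (\<lambda>x. 0) x = 0" by (induction k) auto
    then show ?case by simp
  next
    case (insert b B)
    let ?P = "\<Sum>b\<in>B. (y \<bullet> b) *\<^sub>R b"
    have eq: "(\<lambda>x. f (x + (\<Sum>b\<in>insert b B. (y \<bullet> b) *\<^sub>R b)) - f x)
        = (\<lambda>x. (f (x + (?P + (y \<bullet> b) *\<^sub>R b)) - f (x + ?P)) + (f (x + ?P) - f x))"
      using insert by (simp add: add_ac)
    \<comment> \<open>The mean value inequality bounds the derivatives of order \<open>k\<close> of
      this increment by \<open>\<bar>y \<bullet> b\<bar> * C\<close>, so the induction hypothesis
      applies to it with that constant.\<close>
    have "norm (fdiff k y (\<lambda>x. f (x + (?P + (y \<bullet> b) *\<^sub>R b)) - f (x + ?P)) x) \<le> ?S ^ k * (\<bar>y \<bullet> b\<bar> * C)"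
    proof (rule Suc.IH)
      show "(\<lambda>x. f (x + (?P + (y \<bullet> b) *\<^sub>R b)) - f (x + ?P)) \<in> C_class k"
        by (rule C_class_translate_diff[OF fk])
      fix \<alpha> :: "'a list" and x assume \<alpha>: "multiindex \<alpha>" "length \<alpha> = k"
      have "norm (iter_partial \<alpha> f ((x + ?P) + (y \<bullet> b) *\<^sub>R b) - iter_partial \<alpha> f (x + ?P)) \<le> \<bar>y \<bullet> b\<bar> * C"
        using insert.prems \<alpha> Suc.prems(2)[of "b # \<alpha>"]
        by (intro norm_iter_partial_increment_le[OF Suc.prems(1)]) (auto simp: multiindex_def)
      then show "norm (iter_partial \<alpha> (\<lambda>x. f (x + (?P + (y \<bullet> b) *\<^sub>R b)) - f (x + ?P)) x) \<le> \<bar>y \<bullet> b\<bar> * C"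
        using \<alpha> by (simp add: iter_partial_translate_diff[OF fk] add_ac)
    qed
    moreover have "norm (fdiff k y (\<lambda>x. f (x + ?P) - f x) x) \<le> (\<Sum>b\<in>B. \<bar>y \<bullet> b\<bar>) * (?S ^ k * C)"
      using insert by auto
    ultimately have "norm (fdiff k y (\<lambda>x. f (x + (?P + (y \<bullet> b) *\<^sub>R b)) - f (x + ?P)) x + fdiff k y (\<lambda>x. f (x + ?P) - f x) x)
       \<le> ?S ^ k * (\<bar>y \<bullet> b\<bar> * C) + (\<Sum>b\<in>B. \<bar>y \<bullet> b\<bar>) * (?S ^ k * C)"
      by (intro order_trans[OF norm_triangle_ineq] add_mono)
    then show ?case
      unfolding eq fdiff_add using insert by (simp add: algebra_simps)
  qed
  from this[of Basis x] show ?case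
    by (simp add: euclidean_representation mult_ac)
qed

section \<open>Schwartz functions\<close>

text \<open>A product of one-variable weights: its reciprocal is integrable coordinate by
  coordinate, and it expands into monomials, which the Schwartz seminorms control.\<close>

definition decay_weight :: "'a::euclidean_space \<Rightarrow> real" where
  "decay_weight x = (\<Prod>b\<in>Basis. 1 + (x \<bullet> b)\<^sup>2)"

lemma decay_weight_ge_1: "1 \<le> decay_weight x"
  unfolding decay_weight_def by (rule prod_ge_1) auto

lemma decay_weight_pos: "0 < decay_weight x"
  using decay_weight_ge_1[of x] by linarith

lemma borel_measurable_decay_weight [measurable]: "decay_weight \<in> borel_measurable borel"
  unfolding decay_weight_def by measurable

lemma integrable_inverse_decay_weight: "integrable lborel (\<lambda>x::'a::euclidean_space. inverse (decay_weight x))"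
proof -
  have "integrable lborel (\<lambda>t::real. inverse (1 + t\<^sup>2))"
    using integrable_inverse_1_plus_square by (simp add: set_integrable_def)
  then have "has_bochner_integral lborel (\<lambda>x::'a. \<Prod>b\<in>Basis. inverse (1 + (x \<bullet> b)\<^sup>2))
      (\<Prod>b\<in>(Basis::'a set). integral\<^sup>L lborel (\<lambda>t::real. inverse (1 + t\<^sup>2)))"
    by (intro has_bochner_integral_lborel_prod)
  then show ?thesis
    by (simp add: has_bochner_integral_iff decay_weight_def prod_inversef[symmetric] o_def)
qed

lemma integrable_decay:
  fixes g :: "'a::euclidean_space \<Rightarrow> complex"
  assumes [measurable]: "g \<in> borel_measurable borel" and g: "\<And>x. norm (g x) * decay_weight x \<le> C"
  shows "integrable lborel g"
proof (rule Bochner_Integration.integrable_bound)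
  show "integrable lborel (\<lambda>x::'a. C * inverse (decay_weight x))"
    by (intro integrable_mult_right integrable_inverse_decay_weight)
  show "AE x in lborel. norm (g x) \<le> norm (C * inverse (decay_weight x))"
  proof (intro AE_I2)
    fix x :: 'a
    have "norm (g x) \<le> C * inverse (decay_weight x)"
      using g[of x] decay_weight_pos[of x] by (simp add: field_simps)
    then show "norm (g x) \<le> norm (C * inverse (decay_weight x))"
      by simp
  qed
qed simp

text \<open>The weight is expanded one coordinate at a time: a factor
  \<open>1 + (x \<bullet> b)\<^sup>2\<close> splits the bound into the same monomial and the one
  whose exponent at \<open>b\<close> is raised from 0 to 2. Hence the induction runs over all
  exponents \<open>\<beta>\<close> that vanish on \<open>B\<close>.\<close>

lemma schwartz_decay:
  fixes f :: "'a::euclidean_space \<Rightarrow> complex"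
  assumes f: "f \<in> schwartz" and \<alpha>: "multiindex \<alpha>"
  obtains C where "\<And>x. norm (iter_partial \<alpha> f x) * decay_weight x \<le> C"
proof -
  have "\<forall>\<beta>. (\<forall>b\<in>B. \<beta> b = 0) \<longrightarrow> (\<exists>C. \<forall>x. norm ((\<Prod>b\<in>Basis. (x \<bullet> b) ^ \<beta> b) *\<^sub>R iter_partial \<alpha> f x) * (\<Prod>b\<in>B. 1 + (x \<bullet> b)\<^sup>2) \<le> C)"
    if "B \<subseteq> Basis" for B
    using finite_subset[OF that finite_Basis] that
  proof (induction B)
    case empty
    then show ?case using f \<alpha> by (auto simp: schwartz_def bounded_iff)
  next
    case (insert b B)
    show ?case
    proof (intro allI impI)
      fix \<beta> :: "'a \<Rightarrow> nat" assume \<beta>: "\<forall>b\<in>insert b B. \<beta> b = 0"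
      obtain C1 where C1: "\<And>x. norm ((\<Prod>b\<in>Basis. (x \<bullet> b) ^ \<beta> b) *\<^sub>R iter_partial \<alpha> f x) * (\<Prod>b\<in>B. 1 + (x \<bullet> b)\<^sup>2) \<le> C1"
        using insert \<beta> by fastforce
      have "\<forall>c\<in>B. (\<beta>(b := 2)) c = 0" using \<beta> insert by auto
      then obtain C2 where C2: "\<And>x. norm ((\<Prod>c\<in>Basis. (x \<bullet> c) ^ (\<beta>(b := 2)) c) *\<^sub>R iter_partial \<alpha> f x) * (\<Prod>b\<in>B. 1 + (x \<bullet> b)\<^sup>2) \<le> C2"
        using insert by blast
      have "norm ((\<Prod>b\<in>Basis. (x \<bullet> b) ^ \<beta> b) *\<^sub>R iter_partial \<alpha> f x) * (\<Prod>b\<in>insert b B. 1 + (x \<bullet> b)\<^sup>2) \<le> C1 + C2" for x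
      proof -
        have "(\<Prod>c\<in>Basis. (x \<bullet> c) ^ (\<beta>(b := 2)) c) = (x \<bullet> b)\<^sup>2 * (\<Prod>c\<in>Basis. (x \<bullet> c) ^ \<beta> c)"
          using insert.prems \<beta> by (simp add: prod.remove[of Basis b])
        then have "norm ((\<Prod>b\<in>Basis. (x \<bullet> b) ^ \<beta> b) *\<^sub>R iter_partial \<alpha> f x) * (\<Prod>b\<in>insert b B. 1 + (x \<bullet> b)\<^sup>2)
          = norm ((\<Prod>b\<in>Basis. (x \<bullet> b) ^ \<beta> b) *\<^sub>R iter_partial \<alpha> f x) * (\<Prod>b\<in>B. 1 + (x \<bullet> b)\<^sup>2)
            + norm ((\<Prod>c\<in>Basis. (x \<bullet> c) ^ (\<beta>(b := 2)) c) *\<^sub>R iter_partial \<alpha> f x) * (\<Prod>b\<in>B. 1 + (x \<bullet> b)\<^sup>2)"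
          using insert.hyps by (simp add: abs_mult algebra_simps)
        also have "\<dots> \<le> C1 + C2" by (intro add_mono C1 C2)
        finally show ?thesis .
      qed
      then show "\<exists>C. \<forall>x. norm ((\<Prod>b\<in>Basis. (x \<bullet> b) ^ \<beta> b) *\<^sub>R iter_partial \<alpha> f x) * (\<Prod>b\<in>insert b B. 1 + (x \<bullet> b)\<^sup>2) \<le> C"
        by blast
    qed
  qed
  from this[of Basis] obtain C where "\<And>x. norm (iter_partial \<alpha> f x) * decay_weight x \<le> C"
    by (auto simp: decay_weight_def dest!: spec[of _ "\<lambda>_. 0"])
  then show thesis by (rule that)
qed

lemma schwartz_measurable:
  assumes "f \<in> schwartz" "multiindex \<alpha>"
  shows "iter_partial \<alpha> f \<in> borel_measurable borel"
proof -
  have "f \<in> C_class (length \<alpha>)" using assms by (simp add: schwartz_def)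
  then have "continuous_on UNIV (iter_partial \<alpha> f)" using assms by (simp add: C_class_def)
  then show ?thesis by (rule borel_measurable_continuous_onI)
qed

lemma schwartz_integrable:
  assumes "f \<in> schwartz" "multiindex \<alpha>"
  shows "integrable lborel (iter_partial \<alpha> f)"
  using schwartz_decay[OF assms] integrable_decay[OF schwartz_measurable[OF assms]] by metis

text \<open>Supplies the dominating function in \<open>fourier_derivative\<close>: decay at
  \<open>x + s *\<^sub>R b\<close> becomes decay at \<open>x\<close> at the price of a
  constant.\<close>

lemma decay_weight_shift:
  assumes "b \<in> Basis" "\<bar>s\<bar> \<le> 1"
  shows "decay_weight x \<le> 3 * decay_weight (x + s *\<^sub>R b)"
proof -
  define t where "t = x \<bullet> b"
  have s2: "s\<^sup>2 \<le> 1" using assms(2) by (simp add: abs_square_le_1)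
  \<comment> \<open>The square comes from 3 (1 + (t + s)^2) - (1 + t^2) = (2 t + 3 s)^2 / 2 + 2 - 3
    s^2 / 2.\<close>
  have "0 \<le> (2 * t + 3 * s)\<^sup>2" by simp
  then have *: "1 + t\<^sup>2 \<le> 3 * (1 + (t + s)\<^sup>2)"
    using s2 by (simp add: power2_sum power_mult_distrib)
  have "(\<Prod>c\<in>Basis - {b}. 1 + (x \<bullet> c)\<^sup>2) = (\<Prod>c\<in>Basis - {b}. 1 + ((x + s *\<^sub>R b) \<bullet> c)\<^sup>2)"
    using assms(1) by (intro prod.cong refl) (auto simp: inner_add_left inner_Basis)
  then show ?thesis
    using assms(1) mult_right_mono[OF * prod_nonneg[of "Basis - {b}" "\<lambda>c. 1 + ((x + s *\<^sub>R b) \<bullet> c)\<^sup>2"]]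
    by (simp add: decay_weight_def prod.remove[of Basis b] inner_add_left t_def distrib_right mult_ac)
qed

section \<open>Fourier transforms of translates and derivatives\<close>

lemma integral_lborel_translate:
  fixes f :: "'a::euclidean_space \<Rightarrow> 'b::{banach, second_countable_topology}"
  assumes [measurable]: "f \<in> borel_measurable borel"
  shows "(LINT x|lborel. f (x + t)) = integral\<^sup>L lborel f"
  using lborel_distr_plus[of t] integral_distr[of "(+) t" lborel borel f] by (simp add: add.commute)

lemma integrable_lborel_translate:
  fixes f :: "'a::euclidean_space \<Rightarrow> 'b::{banach, second_countable_topology}"
  assumes "integrable lborel f"
  shows "integrable lborel (\<lambda>x. f (x + t))"
  using lborel_distr_plus[of t] integrable_distr_eq[of "(+) t" lborel borel f] assms by (auto simp: add.commute)

lemma fourier_translate: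
  assumes [measurable]: "g \<in> borel_measurable borel"
  shows "fourier (\<lambda>x. g (x + p)) \<xi> = cis (2 * pi * (p \<bullet> \<xi>)) * fourier g \<xi>"
proof -
  have "fourier (\<lambda>x. g (x + p)) \<xi> = (LINT x|lborel. cis (2 * pi * (p \<bullet> \<xi>)) * (g (x + p) * cis (- (2 * pi) * ((x + p) \<bullet> \<xi>))))"
    unfolding fourier_cis
    by (intro Bochner_Integration.integral_cong refl) (simp add: cis_mult inner_add_left algebra_simps)
  also have "\<dots> = cis (2 * pi * (p \<bullet> \<xi>)) * (LINT x|lborel. g (x + p) * cis (- (2 * pi) * ((x + p) \<bullet> \<xi>)))"
    by simp
  also have "(LINT x|lborel. g (x + p) * cis (- (2 * pi) * ((x + p) \<bullet> \<xi>))) = fourier g \<xi>"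
    unfolding fourier_cis
    by (rule integral_lborel_translate[of "\<lambda>x. g x * cis (- (2 * pi) * (x \<bullet> \<xi>))"]) (simp add: cis_conv_exp)
  finally show ?thesis .
qed

lemma has_vector_derivative_quotient:
  fixes f :: "real \<Rightarrow> 'b::real_normed_vector"
  assumes "(f has_vector_derivative d) (at 0)"
  shows "((\<lambda>t. (f t - f 0) /\<^sub>R t) \<longlongrightarrow> d) (at 0)"
proof -
  have lim: "((\<lambda>t. norm (f t - f 0 - t *\<^sub>R d) / norm t) \<longlongrightarrow> 0) (at 0)"
    using assms by (simp add: has_vector_derivative_def has_derivative_iff_norm)
  have eq: "norm (f t - f 0 - t *\<^sub>R d) / norm t = norm ((f t - f 0) /\<^sub>R t - d)" if "t \<noteq> 0" for t
  proof -
    have "(f t - f 0) /\<^sub>R t - d = (f t - f 0 - t *\<^sub>R d) /\<^sub>R t"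
      using that by (simp add: algebra_simps)
    then show ?thesis by (simp add: divide_inverse)
  qed
  have "((\<lambda>t. norm ((f t - f 0) /\<^sub>R t - d)) \<longlongrightarrow> 0) (at 0)"
    by (rule Lim_transform_eventually[OF lim]) (auto simp: eventually_at_filter eq[unfolded real_norm_def] intro!: always_eventually)
  then show ?thesis by (rule LIM_zero_cancel[OF tendsto_norm_zero_cancel])
qed

text \<open>A difference quotient of \<open>g\<close> transforms into a difference quotient of
  characters times the transform of \<open>g\<close>. Letting the step tend to 0 under dominated
  convergence takes the place of integration by parts.\<close>

lemma fourier_derivative:
  fixes g g' :: "'a::euclidean_space \<Rightarrow> complex"
  assumes b: "b \<in> Basis" and g: "integrable lborel g" and [measurable]: "g' \<in> borel_measurable borel"
    and deriv: "\<And>x t. ((\<lambda>t. g (x + t *\<^sub>R b)) has_vector_derivative g' (x + t *\<^sub>R b)) (at t)"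
    and bound: "\<And>x. norm (g' x) * decay_weight x \<le> C"
  shows "fourier g' \<xi> = 2 * pi * \<i> * (\<xi> \<bullet> b) * fourier g \<xi>"
proof -
  have [measurable]: "g \<in> borel_measurable borel" using g by auto
  define h where "h k = inverse (real (Suc k))" for k
  have h: "h \<longlonglongrightarrow> 0" "h k > 0" "h k \<le> 1" for k
    unfolding h_def using LIMSEQ_inverse_real_of_nat by (auto simp: field_simps)
  have h_at: "filterlim h (at 0) sequentially"
    using h(1) h(2)[THEN less_imp_neq, symmetric] by (auto simp: filterlim_at)
  define D where "D k x = (g (x + h k *\<^sub>R b) - g x) / h k" for k and x :: 'a
  have fD: "fourier (D k) \<xi> = (cis (2 * pi * (\<xi> \<bullet> b) * h k) - cis 0) / h k * fourier g \<xi>" for k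
  proof -
    have "fourier (D k) \<xi> = (fourier (\<lambda>x. g (x + h k *\<^sub>R b)) \<xi> - fourier g \<xi>) / h k"
      unfolding fourier_cis D_def using g integrable_lborel_translate[OF g, of "h k *\<^sub>R b"]
      by (simp add: diff_divide_distrib left_diff_distrib)
    then show ?thesis
      by (simp add: fourier_translate inner_commute field_simps)
  qed
  have "(\<lambda>k. fourier (D k) \<xi>) \<longlonglongrightarrow> fourier g' \<xi>"
    unfolding fourier_cis
  proof (rule integral_dominated_convergence)
    show "integrable lborel (\<lambda>x::'a. 3 * C * inverse (decay_weight x))"
      by (intro integrable_mult_right integrable_inverse_decay_weight)
    show "AE x in lborel. (\<lambda>k. D k x * cis (- (2 * pi) * (x \<bullet> \<xi>))) \<longlonglongrightarrow> g' x * cis (- (2 * pi) * (x \<bullet> \<xi>))"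
    proof (intro AE_I2 tendsto_intros)
      fix x :: 'a
      have "((\<lambda>t. (g (x + (0 + t) *\<^sub>R b) - g (x + 0 *\<^sub>R b)) /\<^sub>R t) \<longlongrightarrow> g' (x + 0 *\<^sub>R b)) (at 0)"
        using has_vector_derivative_quotient[OF deriv[of x 0]] by simp
      from filterlim_compose[OF this h_at]
      show "(\<lambda>k. D k x) \<longlonglongrightarrow> g' x" by (simp add: D_def divide_inverse scaleR_conv_of_real mult.commute)
    qed
    show "AE x in lborel. norm (D k x * cis (- (2 * pi) * (x \<bullet> \<xi>))) \<le> 3 * C * inverse (decay_weight x)" for k
    proof (intro AE_I2)
      fix x :: 'a
      let ?B = "3 * C * inverse (decay_weight x)"
      have "norm (g (x + h k *\<^sub>R b) - g (x + 0 *\<^sub>R b)) \<le> ?B * norm (h k - 0)"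
      proof (rule differentiable_bound[where S = "{0..h k}" and f = "\<lambda>t. g (x + t *\<^sub>R b)"
          and f' = "\<lambda>t h. h *\<^sub>R g' (x + t *\<^sub>R b)"])
        show "((\<lambda>t. g (x + t *\<^sub>R b)) has_derivative (\<lambda>h. h *\<^sub>R g' (x + t *\<^sub>R b))) (at t within {0..h k})" for t
          using deriv[of x t] unfolding has_vector_derivative_def by (rule has_derivative_at_withinI)
        fix t assume t: "t \<in> {0..h k}"
        have "norm (g' (x + t *\<^sub>R b)) * decay_weight x \<le> norm (g' (x + t *\<^sub>R b)) * (3 * decay_weight (x + t *\<^sub>R b))"
          using t h(3)[of k] by (intro mult_left_mono decay_weight_shift b) auto
        also have "\<dots> \<le> 3 * C" using bound[of "x + t *\<^sub>R b"] by simp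
        finally have "norm (g' (x + t *\<^sub>R b)) \<le> ?B"
          using decay_weight_pos[of x] by (simp add: field_simps)
        then show "onorm (\<lambda>h. h *\<^sub>R g' (x + t *\<^sub>R b)) \<le> ?B"
          by (intro onorm_le) (metis mult.commute mult_left_mono norm_ge_zero norm_scaleR real_norm_def)
      qed (use h(2)[of k] in auto)
      then have "norm (D k x) \<le> ?B"
        using h(2)[of k] by (simp add: D_def norm_divide field_simps)
      then show "norm (D k x * cis (- (2 * pi) * (x \<bullet> \<xi>))) \<le> ?B" by (simp add: norm_mult)
    qed
  qed (auto simp: D_def cis_conv_exp)
  moreover have "(\<lambda>k. fourier (D k) \<xi>) \<longlonglongrightarrow> 2 * pi * \<i> * (\<xi> \<bullet> b) * fourier g \<xi>"
  proof -
    have "((\<lambda>t. cis (2 * pi * (\<xi> \<bullet> b) * t)) has_vector_derivative (\<i> * (2 * pi * (\<xi> \<bullet> b)) * cis (2 * pi * (\<xi> \<bullet> b) * 0))) (at 0)"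
      unfolding has_vector_derivative_complex_iff by (auto intro!: derivative_eq_intros)
    then have "((\<lambda>t. (cis (2 * pi * (\<xi> \<bullet> b) * t) - cis 0) /\<^sub>R t) \<longlongrightarrow> (\<i> * (2 * pi * (\<xi> \<bullet> b)))) (at 0)"
      by (auto dest!: has_vector_derivative_quotient)
    from filterlim_compose[OF this h_at]
    have "(\<lambda>k. (cis (2 * pi * (\<xi> \<bullet> b) * h k) - cis 0) / h k) \<longlonglongrightarrow> \<i> * (2 * pi * (\<xi> \<bullet> b))"
      by (simp add: divide_inverse scaleR_conv_of_real mult.commute)
    from tendsto_mult_right[OF this, of "fourier g \<xi>"] show ?thesis
      unfolding fD by (simp add: mult_ac)
  qed
  ultimately show ?thesis by (rule LIMSEQ_unique)
qed

lemma fourier_iter_partial: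
  assumes f: "f \<in> schwartz" and \<alpha>: "multiindex \<alpha>" and b: "b \<in> Basis"
  shows "fourier (iter_partial (b # \<alpha>) f) \<xi> = 2 * pi * \<i> * (\<xi> \<bullet> b) * fourier (iter_partial \<alpha> f) \<xi>"
proof -
  have b\<alpha>: "multiindex (b # \<alpha>)" using b \<alpha> by (auto simp: multiindex_def)
  obtain C where C: "\<And>x. norm (iter_partial (b # \<alpha>) f x) * decay_weight x \<le> C"
    using schwartz_decay[OF f b\<alpha>] by metis
  have "f \<in> C_class (Suc (length \<alpha>))" using f by (simp add: schwartz_def)
  then show ?thesis
    using schwartz_integrable[OF f \<alpha>] schwartz_measurable[OF f b\<alpha>] C
    by (intro fourier_derivative[OF b] iter_partial_has_vector_derivative) (use \<alpha> b in auto)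
qed

text \<open>A factor \<open>(\<xi> \<bullet> b)\<^sup>2\<close> is absorbed by two derivatives in
  direction \<open>b\<close>, because (2 pi)^2 >= 1. Induction over the coordinates builds up
  \<open>decay_weight\<close>, whose reciprocal is integrable.\<close>

lemma schwartz_fourier_integrable:
  fixes f :: "'a::euclidean_space \<Rightarrow> complex"
  assumes f: "f \<in> schwartz"
  shows "integrable lborel (fourier f)"
proof -
  have "\<forall>\<alpha>. multiindex \<alpha> \<longrightarrow> (\<exists>C. \<forall>\<xi>. norm (fourier (iter_partial \<alpha> f) \<xi>) * (\<Prod>b\<in>B. 1 + (\<xi> \<bullet> b)\<^sup>2) \<le> C)"
    if "B \<subseteq> Basis" for B
    using finite_subset[OF that finite_Basis] that
  proof (induction B)
    case empty
    then show ?case by (auto intro: norm_fourier_le)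
  next
    case (insert b B)
    show ?case
    proof (intro allI impI)
      fix \<alpha> :: "'a list" assume \<alpha>: "multiindex \<alpha>"
      then have \<alpha>': "multiindex (b # \<alpha>)" "multiindex (b # b # \<alpha>)" using insert by (auto simp: multiindex_def)
      obtain C1 where C1: "\<And>\<xi>. norm (fourier (iter_partial \<alpha> f) \<xi>) * (\<Prod>b\<in>B. 1 + (\<xi> \<bullet> b)\<^sup>2) \<le> C1"
        using insert \<alpha> by fastforce
      obtain C2 where C2: "\<And>\<xi>. norm (fourier (iter_partial (b # b # \<alpha>) f) \<xi>) * (\<Prod>b\<in>B. 1 + (\<xi> \<bullet> b)\<^sup>2) \<le> C2"
        using insert \<alpha>'(2) by blast
      have "norm (fourier (iter_partial \<alpha> f) \<xi>) * (\<Prod>b\<in>insert b B. 1 + (\<xi> \<bullet> b)\<^sup>2) \<le> C1 + C2" for \<xi>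
      proof -
        let ?N = "norm (fourier (iter_partial \<alpha> f) \<xi>)" and ?P = "\<Prod>b\<in>B. 1 + (\<xi> \<bullet> b)\<^sup>2"
        have P: "?P \<ge> 0" by (intro prod_nonneg) auto
        have "norm (fourier (iter_partial (b # b # \<alpha>) f) \<xi>) = (2 * pi)\<^sup>2 * (\<xi> \<bullet> b)\<^sup>2 * ?N"
          using insert.prems fourier_iter_partial[OF f \<alpha>'(1), of b \<xi>] fourier_iter_partial[OF f \<alpha>, of b \<xi>]
          by (simp add: norm_mult power2_eq_square del: iter_partial.simps)
        moreover have "1 * ((\<xi> \<bullet> b)\<^sup>2 * ?N) \<le> (2 * pi)\<^sup>2 * ((\<xi> \<bullet> b)\<^sup>2 * ?N)"
          using pi_gt3 one_le_power[of "2 * pi" 2] by (intro mult_right_mono) auto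
        ultimately have "(\<xi> \<bullet> b)\<^sup>2 * ?N * ?P \<le> norm (fourier (iter_partial (b # b # \<alpha>) f) \<xi>) * ?P"
          by (intro mult_right_mono P) (simp add: mult_ac)
        then show ?thesis
          using insert.hyps C1[of \<xi>] C2[of \<xi>] by (simp add: algebra_simps)
      qed
      then show "\<exists>C. \<forall>\<xi>. norm (fourier (iter_partial \<alpha> f) \<xi>) * (\<Prod>b\<in>insert b B. 1 + (\<xi> \<bullet> b)\<^sup>2) \<le> C"
        by blast
    qed
  qed
  from this[of Basis] obtain C where "\<And>\<xi>. norm (fourier f \<xi>) * decay_weight \<xi> \<le> C"
    by (auto simp: decay_weight_def multiindex_def dest!: spec[of _ "[]"]) metis
  moreover have "f \<in> borel_measurable borel"
    using schwartz_measurable[OF f, of "[]"] by (simp add: multiindex_def)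
  ultimately show ?thesis by (intro integrable_decay) measurable
qed

section \<open>The trilinear form and its localization\<close>

definition trilinear :: "('a::euclidean_space \<times> 'a \<Rightarrow> complex) \<Rightarrow> ('a \<Rightarrow> complex) \<Rightarrow> ('a \<Rightarrow> complex) \<Rightarrow> ('a \<Rightarrow> complex) \<Rightarrow> complex" where
  "trilinear m u v w = (LINT z|lborel. m z * u (fst z) * v (snd z) * w (fst z + snd z))"

text \<open>Real-valued, with value 0 when the square integral is infinite; it is the L^2 norm on
  \<open>L1_L2\<close>.\<close>

definition l2norm :: "('a::euclidean_space \<Rightarrow> complex) \<Rightarrow> real" where
  "l2norm F = sqrt (enn2real (sq_integral F))"

text \<open>Integrability makes the Fourier transform an honest integral, square integrability makes
  the Plancherel bound finite.\<close>

definition L1_L2 :: "('a::euclidean_space \<Rightarrow> complex) set" where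
  "L1_L2 = {F. integrable lborel F \<and> sq_integral F < \<infinity>}"

definition quartic_integral :: "('a::euclidean_space \<Rightarrow> complex) \<Rightarrow> ennreal" where
  "quartic_integral m = (\<integral>\<^sup>+z. ennreal (norm (m z) ^ 4) \<partial>lborel)"

lemma l2norm_nonneg [simp]: "0 \<le> l2norm F"
  by (simp add: l2norm_def)

lemma sq_integral_eq_l2norm: "F \<in> L1_L2 \<Longrightarrow> sq_integral F = ennreal ((l2norm F)\<^sup>2)"
  by (simp add: L1_L2_def l2norm_def ennreal_enn2real less_top)

lemma L1_L2_integrable: "F \<in> L1_L2 \<Longrightarrow> integrable lborel F"
  by (simp add: L1_L2_def)

lemma L1_L2_measurable: "F \<in> L1_L2 \<Longrightarrow> F \<in> borel_measurable borel"
  using L1_L2_integrable by fastforce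

lemma sq_integral_fourier_le:
  assumes "F \<in> L1_L2"
  shows "sq_integral (fourier F) \<le> ennreal ((l2norm F)\<^sup>2)"
  unfolding sq_integral_eq_l2norm[OF assms, symmetric]
  using plancherel_le[OF L1_L2_integrable[OF assms]] by (simp add: sq_integral_def)

lemma sq_integral_fourier_reflect_le:
  assumes "F \<in> L1_L2"
  shows "sq_integral (\<lambda>\<xi>. fourier F (- \<xi>)) \<le> ennreal ((l2norm F)\<^sup>2)"
proof -
  have [measurable]: "F \<in> borel_measurable borel" using assms by (rule L1_L2_measurable)
  have "sq_integral (\<lambda>\<xi>. fourier F (- \<xi>)) = sq_integral (fourier F)"
    using nn_integral_lborel_reflect[of "\<lambda>\<xi>. ennreal ((norm (fourier F \<xi>))\<^sup>2)" 0] by (simp add: sq_integral_def)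
  then show ?thesis using sq_integral_fourier_le[OF assms] by simp
qed

lemma nn_integral_trilinear_le:
  fixes m :: "'a::euclidean_space \<times> 'a \<Rightarrow> complex"
  assumes [measurable]: "m \<in> borel_measurable borel" "u \<in> borel_measurable borel"
      "v \<in> borel_measurable borel" "w \<in> borel_measurable borel"
    and Q: "quartic_integral m \<le> ennreal (Q ^ 4)" "Q \<ge> 0"
    and U: "sq_integral u \<le> ennreal (U\<^sup>2)" "U \<ge> 0"
    and V: "sq_integral v \<le> ennreal (V\<^sup>2)" "V \<ge> 0"
    and W: "sq_integral w \<le> ennreal (W\<^sup>2)" "W \<ge> 0"
  shows "(\<integral>\<^sup>+z. ennreal (norm (m z * u (fst z) * v (snd z) * w (fst z + snd z))) \<partial>lborel) \<le> ennreal (Q * (U * V * W))"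
    (is "?X \<le> _")
proof -
  have "?X ^ 4 \<le> quartic_integral m * (sq_integral u * sq_integral v * sq_integral w)\<^sup>2"
    unfolding quartic_integral_def by (rule trilinear_cauchy_schwarz) fact+
  also have "\<dots> \<le> ennreal (Q ^ 4) * (ennreal (U\<^sup>2) * ennreal (V\<^sup>2) * ennreal (W\<^sup>2))\<^sup>2"
    by (intro mult_mono power_mono Q U V W) auto
  also have "\<dots> = ennreal ((Q * (U * V * W)) ^ 4)"
    using Q U V W by (simp add: ennreal_mult[symmetric] ennreal_power power_mult_distrib flip: power_mult)
  finally have le: "?X ^ 4 \<le> ennreal ((Q * (U * V * W)) ^ 4)" .
  \<comment> \<open>The fourth power shows that the integral is finite, after which fourth roots can
    be taken in the reals.\<close>
  then have "?X \<noteq> \<infinity>" by (auto simp: power_eq_top_ennreal top_unique)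
  then obtain x where x: "?X = ennreal x" "x \<ge> 0" by (cases ?X) auto
  have "x ^ 4 \<le> (Q * (U * V * W)) ^ 4"
    using le Q U V W unfolding x(1) by (simp add: x(2) ennreal_power)
  then have "x \<le> Q * (U * V * W)"
    by (rule power_le_imp_le_base[of _ 3, simplified]) (use Q U V W in auto)
  then show ?thesis unfolding x(1) by (rule ennreal_leI)
qed

lemma
  fixes m :: "'a::euclidean_space \<times> 'a \<Rightarrow> complex"
  assumes m[measurable]: "m \<in> borel_measurable borel" and Q: "quartic_integral m \<le> ennreal (Q ^ 4)" "Q \<ge> 0"
    and F: "F \<in> L1_L2" and G: "G \<in> L1_L2" and H: "H \<in> L1_L2"
  shows nn_integral_trilinear_fourier_le:
      "(\<integral>\<^sup>+z. ennreal (norm (m z * fourier F (fst z) * fourier G (snd z) * fourier H (- (fst z + snd z)))) \<partial>lborel)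
        \<le> ennreal (Q * (l2norm F * l2norm G * l2norm H))"
    and integrable_trilinear_fourier:
      "integrable lborel (\<lambda>z. m z * fourier F (fst z) * fourier G (snd z) * fourier H (- (fst z + snd z)))"
    and norm_trilinear_fourier_le:
      "norm (trilinear m (fourier F) (fourier G) (\<lambda>\<zeta>. fourier H (- \<zeta>))) \<le> Q * (l2norm F * l2norm G * l2norm H)"
proof -
  have [measurable]: "F \<in> borel_measurable borel" "G \<in> borel_measurable borel" "H \<in> borel_measurable borel"
    using F G H by (auto intro: L1_L2_measurable)
  show le: "(\<integral>\<^sup>+z. ennreal (norm (m z * fourier F (fst z) * fourier G (snd z) * fourier H (- (fst z + snd z)))) \<partial>lborel)
        \<le> ennreal (Q * (l2norm F * l2norm G * l2norm H))"
    by (intro nn_integral_trilinear_le[where w = "\<lambda>\<zeta>. fourier H (- \<zeta>)"] Q sq_integral_fourier_le sq_integral_fourier_reflect_le F G H l2norm_nonneg)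
      measurable
  show int: "integrable lborel (\<lambda>z. m z * fourier F (fst z) * fourier G (snd z) * fourier H (- (fst z + snd z)))"
  proof (rule integrableI_bounded)
    show "(\<lambda>z. m z * fourier F (fst z) * fourier G (snd z) * fourier H (- (fst z + snd z))) \<in> borel_measurable lborel"
      by measurable
  qed (rule le_less_trans[OF le], simp)
  have "ennreal (norm (trilinear m (fourier F) (fourier G) (\<lambda>\<zeta>. fourier H (- \<zeta>)))) \<le> ennreal (Q * (l2norm F * l2norm G * l2norm H))"
    unfolding trilinear_def by (rule order_trans[OF integral_norm_bound_ennreal[OF int] le])
  then show "norm (trilinear m (fourier F) (fourier G) (\<lambda>\<zeta>. fourier H (- \<zeta>))) \<le> Q * (l2norm F * l2norm G * l2norm H)"
    using Q by simp
qed

text \<open>The reflected transform of \<open>H\<close> makes the form at \<open>a = 0\<close> the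
  pairing of the bilinear operator with \<open>H\<close>, without conjugation; see
  \<open>bilinear_multiplier_pairing\<close>.\<close>

definition shifted_form :: "('a::euclidean_space \<times> 'a \<Rightarrow> complex) \<Rightarrow> ('a \<Rightarrow> complex) \<Rightarrow> ('a \<Rightarrow> complex) \<Rightarrow> ('a \<Rightarrow> complex) \<Rightarrow> 'a \<times> 'a \<Rightarrow> complex" where
  "shifted_form m F G H a = trilinear (\<lambda>z. m (z + a)) (fourier F) (fourier G) (\<lambda>\<zeta>. fourier H (- \<zeta>))"

definition tensor :: "(real \<Rightarrow> real) \<Rightarrow> 'a::euclidean_space \<Rightarrow> real" where
  "tensor v x = (\<Prod>b\<in>Basis. v (x \<bullet> b))"

text \<open>For \<open>s > 0\<close> this is the sup-norm ball of radius \<open>1 / s\<close> about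
  \<open>x\<close>, the shape dictated by a tensor kernel that is band limited in each
  coordinate.\<close>

definition near :: "real \<Rightarrow> 'a::euclidean_space \<Rightarrow> 'a \<Rightarrow> bool" where
  "near s x y \<longleftrightarrow> (\<forall>b\<in>Basis. \<bar>s * ((y - x) \<bullet> b)\<bar> \<le> 1)"

locale band_limited_kernel =
  fixes v :: "real \<Rightarrow> real" and M :: nat
  assumes v_nonneg: "0 \<le> v t"
    and v_moment: "integrable lborel (\<lambda>t. v t * (1 + \<bar>t\<bar>) ^ M)"
    and v_integrable: "integrable lborel v"
    and v_integral: "(LINT t|lborel. v t) = 1"
    and v_band: "\<bar>u\<bar> > 1 \<Longrightarrow> (LINT t|lborel. cis (2 * pi * u * t) * complex_of_real (v t)) = 0"
begin

lemma v_measurable [measurable]: "v \<in> borel_measurable borel"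
  using v_integrable by auto

lemma tensor_measurable [measurable]: "tensor v \<in> borel_measurable borel"
  unfolding tensor_def by measurable

lemma tensor_nonneg: "0 \<le> tensor v x"
  unfolding tensor_def by (intro prod_nonneg ballI v_nonneg)

lemma tensor_has_integral: "has_bochner_integral lborel (tensor v :: 'a::euclidean_space \<Rightarrow> real) 1"
  using has_bochner_integral_lborel_prod[of "\<lambda>_. v"] v_integrable
  by (simp add: v_integral tensor_def[abs_def])

lemma tensor_band:
  assumes "b \<in> Basis" "\<bar>u \<bullet> b\<bar> > 1"
  shows "(LINT a|lborel. complex_of_real (tensor v a) * cis (2 * pi * (a \<bullet> u))) = 0"
proof -
  have "has_bochner_integral lborel (\<lambda>a. \<Prod>b\<in>Basis. cis (2 * pi * (u \<bullet> b) * (a \<bullet> b)) * complex_of_real (v (a \<bullet> b)))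
     (\<Prod>b\<in>Basis. LINT t|lborel. cis (2 * pi * (u \<bullet> b) * t) * complex_of_real (v t))"
    using v_integrable
    by (intro has_bochner_integral_lborel_prod[of "\<lambda>b t. cis (2 * pi * (u \<bullet> b) * t) * complex_of_real (v t)"]) auto
  moreover have "(\<Prod>b\<in>Basis. LINT t|lborel. cis (2 * pi * (u \<bullet> b) * t) * complex_of_real (v t)) = 0"
    using assms v_band by (intro prod_zero) auto
  moreover have "(\<Prod>b\<in>Basis. cis (2 * pi * (u \<bullet> b) * (a \<bullet> b)) * complex_of_real (v (a \<bullet> b)))
      = complex_of_real (tensor v a) * cis (2 * pi * (a \<bullet> u))" for a
    by (subst cis_inner_prod) (simp add: tensor_def prod.distrib)
  ultimately show ?thesis by (simp add: has_bochner_integral_iff)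
qed

text \<open>The Fourier transform of \<open>F\<close> smoothed at scale \<open>s\<close> and modulated so that it only sees \<open>F\<close> within distance \<open>1/s\<close> of \<open>x\<close>.\<close>

definition local_fourier :: "real \<Rightarrow> ('a::euclidean_space \<Rightarrow> complex) \<Rightarrow> 'a \<Rightarrow> 'a \<Rightarrow> complex" where
  "local_fourier s F x \<xi> = (LINT a|lborel. complex_of_real (tensor v a) * (fourier F (\<xi> - s *\<^sub>R a) * cis (- (2 * pi) * (s * (x \<bullet> a)))))"

text \<open>Fubini turns smoothing and modulation on the frequency side into multiplication of
  \<open>F\<close> by the transform of the kernel at \<open>s *\<^sub>R (w - x)\<close>. By
  \<open>tensor_band\<close> this factor vanishes unless \<open>near s x w\<close>.\<close>

lemma local_fourier_eq:
  fixes F :: "'a::euclidean_space \<Rightarrow> complex"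
  assumes F: "integrable lborel F"
  shows "local_fourier s F x \<xi> = (LINT w|lborel. F w * cis (- (2 * pi) * (w \<bullet> \<xi>)) *
      (LINT a|lborel. complex_of_real (tensor v a) * cis (2 * pi * (a \<bullet> (s *\<^sub>R (w - x))))))"
proof -
  have [measurable]: "F \<in> borel_measurable borel" using F by auto
  let ?g = "\<lambda>w a. (F w * cis (- (2 * pi) * (w \<bullet> \<xi>))) * (complex_of_real (tensor v a) * cis (2 * pi * (a \<bullet> (s *\<^sub>R (w - x)))))"
  have int: "integrable lborel (\<lambda>z::'a \<times> 'a. ?g (fst z) (snd z))"
  proof (rule Bochner_Integration.integrable_bound)
    show "integrable lborel (\<lambda>z::'a \<times> 'a. norm (F (fst z)) * tensor v (snd z))"
      using has_bochner_integral_lborel_pair[of "\<lambda>w. norm (F w)" "tensor v"] F tensor_has_integral[where 'a='a]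
      by (auto simp: has_bochner_integral_iff)
    show "(\<lambda>z::'a \<times> 'a. ?g (fst z) (snd z)) \<in> borel_measurable lborel"
      unfolding cis_conv_exp by measurable
  qed (auto simp: norm_mult tensor_nonneg)
  have "local_fourier s F x \<xi> = (LINT a|lborel. LINT w|lborel. ?g w a)"
    unfolding local_fourier_def
  proof (intro Bochner_Integration.integral_cong refl)
    fix a :: 'a
    have "(LINT w|lborel. ?g w a) = (LINT w|lborel. (complex_of_real (tensor v a) * cis (- (2 * pi) * (s * (x \<bullet> a)))) * (F w * cis (- (2 * pi) * (w \<bullet> (\<xi> - s *\<^sub>R a)))))"
      by (intro Bochner_Integration.integral_cong refl)
         (simp add: cis_mult inner_commute algebra_simps inner_diff_right inner_diff_left)
    then show "complex_of_real (tensor v a) * (fourier F (\<xi> - s *\<^sub>R a) * cis (- (2 * pi) * (s * (x \<bullet> a)))) = (LINT w|lborel. ?g w a)"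
      by (simp add: fourier_cis)
  qed
  also have "\<dots> = (LINT w|lborel. LINT a|lborel. ?g w a)"
    by (rule lborel_fubini[OF int])
  finally show ?thesis by simp
qed

lemma local_fourier_cong:
  assumes F: "integrable lborel F" "integrable lborel F'"
    and eq: "\<And>y. near s x y \<Longrightarrow> F y = F' y"
  shows "local_fourier s F x \<xi> = local_fourier s F' x \<xi>"
  unfolding local_fourier_eq[OF F(1)] local_fourier_eq[OF F(2)]
proof (intro Bochner_Integration.integral_cong refl)
  fix w
  show "F w * cis (- (2 * pi) * (w \<bullet> \<xi>)) * (LINT a|lborel. complex_of_real (tensor v a) * cis (2 * pi * (a \<bullet> (s *\<^sub>R (w - x)))))
     = F' w * cis (- (2 * pi) * (w \<bullet> \<xi>)) * (LINT a|lborel. complex_of_real (tensor v a) * cis (2 * pi * (a \<bullet> (s *\<^sub>R (w - x)))))"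
  proof (cases "near s x w")
    case True
    then show ?thesis by (simp add: eq)
  next
    case False
    then obtain b where "b \<in> Basis" "\<bar>(s *\<^sub>R (w - x)) \<bullet> b\<bar> > 1" by (auto simp: near_def)
    then show ?thesis by (simp only: tensor_band mult_zero_right)
  qed
qed

end

text \<open>Moves the translation from \<open>m\<close> onto the three transforms, where the average
  over \<open>a\<close> can act on it.\<close>

lemma shifted_form_translate:
  assumes [measurable]: "m \<in> borel_measurable borel" and F: "F \<in> L1_L2" and G: "G \<in> L1_L2" and H: "H \<in> L1_L2"
  shows "shifted_form m F G H a = (LINT z|lborel. m z * fourier F (fst z - fst a) * fourier G (snd z - snd a) *
     fourier H (- (fst z + snd z - (fst a + snd a))))"
proof -
  have [measurable]: "F \<in> borel_measurable borel" "G \<in> borel_measurable borel" "H \<in> borel_measurable borel"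
    using F G H by (auto intro: L1_L2_measurable)
  have "(\<lambda>z. m z * fourier F (fst z - fst a) * fourier G (snd z - snd a) *
     fourier H (- (fst z + snd z - (fst a + snd a)))) \<in> borel_measurable borel"
    by measurable
  from integral_lborel_translate[OF this, of a] show ?thesis
    by (simp add: shifted_form_def trilinear_def algebra_simps)
qed

lemma quartic_integral_translate:
  assumes [measurable]: "m \<in> borel_measurable borel"
  shows "quartic_integral (\<lambda>z. m (z + a)) = quartic_integral m"
  using nn_integral_lborel_translate[of "\<lambda>z. ennreal (norm (m z) ^ 4)" a] by (simp add: quartic_integral_def add.commute)

lemma norm_shifted_form_le:
  assumes [measurable]: "m \<in> borel_measurable borel" and Q: "quartic_integral m \<le> ennreal (Q ^ 4)" "Q \<ge> 0"
    and "F \<in> L1_L2" "G \<in> L1_L2" "H \<in> L1_L2"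
  shows "norm (shifted_form m F G H a) \<le> Q * (l2norm F * l2norm G * l2norm H)"
  unfolding shifted_form_def
  by (rule norm_trilinear_fourier_le) (use assms in \<open>simp_all add: quartic_integral_translate\<close>)

context band_limited_kernel
begin

definition tensor2 :: "'a::euclidean_space \<times> 'a \<Rightarrow> real" where
  "tensor2 y = tensor v (fst y) * tensor v (snd y)"

lemma tensor2_measurable [measurable]: "tensor2 \<in> borel_measurable borel"
  unfolding tensor2_def by measurable

lemma tensor2_nonneg: "0 \<le> tensor2 y"
  by (simp add: tensor2_def tensor_nonneg)

lemma tensor2_has_integral: "has_bochner_integral lborel (tensor2 :: 'a::euclidean_space \<times> 'a \<Rightarrow> real) 1"
  using has_bochner_integral_lborel_pair[of "tensor v :: 'a \<Rightarrow> real" "tensor v :: 'a \<Rightarrow> real"] tensor_has_integral[where 'a='a]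
  by (simp add: has_bochner_integral_iff tensor2_def[abs_def])

text \<open>Formally the form whose multiplier is the average of the translates of \<open>m\<close>
  by \<open>s *\<^sub>R y\<close>; at \<open>s = 0\<close> it is the original form, the kernel
  having mass 1.\<close>

definition averaged_form :: "real \<Rightarrow> ('a::euclidean_space \<times> 'a \<Rightarrow> complex) \<Rightarrow> ('a \<Rightarrow> complex) \<Rightarrow> ('a \<Rightarrow> complex) \<Rightarrow> ('a \<Rightarrow> complex) \<Rightarrow> complex" where
  "averaged_form s m F G H = (LINT y|lborel. complex_of_real (tensor2 y) * shifted_form m F G H (s *\<^sub>R y))"

lemma integrable_averaged_form:
  fixes m :: "'a::euclidean_space \<times> 'a \<Rightarrow> complex"
  assumes [measurable]: "m \<in> borel_measurable borel" and Q: "quartic_integral m \<le> ennreal (Q ^ 4)" "Q \<ge> 0"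
    and F: "F \<in> L1_L2" and G: "G \<in> L1_L2" and H: "H \<in> L1_L2"
  shows "integrable lborel (\<lambda>y. complex_of_real (tensor2 y) * shifted_form m F G H (s *\<^sub>R y))"
proof (rule Bochner_Integration.integrable_bound)
  have [measurable]: "F \<in> borel_measurable borel" "G \<in> borel_measurable borel" "H \<in> borel_measurable borel"
    using F G H by (auto intro: L1_L2_measurable)
  show "integrable lborel (\<lambda>y::'a \<times> 'a. tensor2 y * (Q * (l2norm F * l2norm G * l2norm H)))"
    using tensor2_has_integral by (auto simp: has_bochner_integral_iff)
  show "(\<lambda>y. complex_of_real (tensor2 y) * shifted_form m F G H (s *\<^sub>R y)) \<in> borel_measurable lborel"
    unfolding shifted_form_def trilinear_def by measurable
  show "AE y in lborel. norm (complex_of_real (tensor2 y) * shifted_form m F G H (s *\<^sub>R y))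
     \<le> norm (tensor2 y * (Q * (l2norm F * l2norm G * l2norm H)))"
  proof (intro AE_I2)
    fix y :: "'a \<times> 'a"
    have "norm (complex_of_real (tensor2 y) * shifted_form m F G H (s *\<^sub>R y)) = tensor2 y * norm (shifted_form m F G H (s *\<^sub>R y))"
      by (simp add: norm_mult tensor2_nonneg)
    also have "\<dots> \<le> tensor2 y * (Q * (l2norm F * l2norm G * l2norm H))"
      by (intro mult_left_mono norm_shifted_form_le tensor2_nonneg) fact+
    also have "\<dots> \<le> norm \<dots>" unfolding real_norm_def by (rule abs_ge_self)
    finally show "norm (complex_of_real (tensor2 y) * shifted_form m F G H (s *\<^sub>R y))
     \<le> norm (tensor2 y * (Q * (l2norm F * l2norm G * l2norm H)))" .
  qed
qed

text \<open>The transform of \<open>H\<close> is written as an integral over a position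
  \<open>x\<close>. Its phase splits into one factor per kernel variable, and these are exactly the
  modulations in \<open>local_fourier\<close>. Thus the smoothed versions of \<open>F\<close> and
  \<open>G\<close> are centred at the same \<open>x\<close>, which is the source of
  locality.\<close>

lemma averaged_form_inner:
  fixes F G H :: "'a::euclidean_space \<Rightarrow> complex"
  assumes F: "F \<in> L1_L2" and G: "G \<in> L1_L2" and H: "H \<in> L1_L2"
  shows "(LINT y|lborel. complex_of_real (tensor2 y) * (fourier F (\<xi> - s *\<^sub>R fst y) * fourier G (\<eta> - s *\<^sub>R snd y) *
       fourier H (- (\<xi> + \<eta> - s *\<^sub>R (fst y + snd y)))))
    = (LINT x|lborel. H x * cis (2 * pi * (x \<bullet> (\<xi> + \<eta>))) * (local_fourier s F x \<xi> * local_fourier s G x \<eta>))"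
proof -
  have [measurable]: "F \<in> borel_measurable borel" "G \<in> borel_measurable borel" "H \<in> borel_measurable borel"
    using F G H by (auto intro: L1_L2_measurable)
  let ?h = "\<lambda>y x. (complex_of_real (tensor2 y) * fourier F (\<xi> - s *\<^sub>R fst y) * fourier G (\<eta> - s *\<^sub>R snd y)) *
        (H x * cis (2 * pi * (x \<bullet> (\<xi> + \<eta> - s *\<^sub>R (fst y + snd y)))))"
  let ?A = "LINT x|lborel. norm (F x)" and ?B = "LINT x|lborel. norm (G x)"
  have int: "integrable lborel (\<lambda>z::('a \<times> 'a) \<times> 'a. ?h (fst z) (snd z))"
  proof (rule Bochner_Integration.integrable_bound)
    show "integrable lborel (\<lambda>z::('a \<times> 'a) \<times> 'a. (?A * ?B) * (tensor2 (fst z) * norm (H (snd z))))"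
      using has_bochner_integral_lborel_pair[of "tensor2 :: 'a \<times> 'a \<Rightarrow> real" "\<lambda>w. norm (H w)"] L1_L2_integrable[OF H] tensor2_has_integral[where 'a='a]
      by (intro integrable_mult_right) (auto simp: has_bochner_integral_iff)
    show "(\<lambda>z::('a \<times> 'a) \<times> 'a. ?h (fst z) (snd z)) \<in> borel_measurable lborel"
      unfolding cis_conv_exp by measurable
    show "AE z in lborel. norm (?h (fst z) (snd z)) \<le> norm ((?A * ?B) * (tensor2 (fst z) * norm (H (snd z))))"
    proof (intro AE_I2)
      fix z :: "('a \<times> 'a) \<times> 'a"
      have "norm (fourier F (\<xi> - s *\<^sub>R fst (fst z))) * norm (fourier G (\<eta> - s *\<^sub>R snd (fst z))) \<le> ?A * ?B"
        by (intro mult_mono norm_fourier_le) auto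
      then have "norm (fourier F (\<xi> - s *\<^sub>R fst (fst z))) * norm (fourier G (\<eta> - s *\<^sub>R snd (fst z))) * (tensor2 (fst z) * norm (H (snd z)))
        \<le> (?A * ?B) * (tensor2 (fst z) * norm (H (snd z)))"
        by (intro mult_right_mono) (auto simp: tensor2_nonneg)
      then show "norm (?h (fst z) (snd z)) \<le> norm ((?A * ?B) * (tensor2 (fst z) * norm (H (snd z))))"
        by (simp add: norm_mult abs_mult tensor2_nonneg mult_ac)
    qed
  qed
  have "(LINT y|lborel. complex_of_real (tensor2 y) * (fourier F (\<xi> - s *\<^sub>R fst y) * fourier G (\<eta> - s *\<^sub>R snd y) *
       fourier H (- (\<xi> + \<eta> - s *\<^sub>R (fst y + snd y))))) = (LINT y|lborel. LINT x|lborel. ?h y x)"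
  proof (intro Bochner_Integration.integral_cong refl)
    fix y :: "'a \<times> 'a"
    have "fourier H (- (\<xi> + \<eta> - s *\<^sub>R (fst y + snd y))) = (LINT x|lborel. H x * cis (2 * pi * (x \<bullet> (\<xi> + \<eta> - s *\<^sub>R (fst y + snd y)))))"
      unfolding fourier_cis by (simp only: inner_minus_right mult_minus_left mult_minus_right minus_minus)
    moreover have "(LINT x|lborel. ?h y x) = (complex_of_real (tensor2 y) * fourier F (\<xi> - s *\<^sub>R fst y) * fourier G (\<eta> - s *\<^sub>R snd y)) *
        (LINT x|lborel. H x * cis (2 * pi * (x \<bullet> (\<xi> + \<eta> - s *\<^sub>R (fst y + snd y)))))"
      by (rule integral_mult_right_zero)
    ultimately show "complex_of_real (tensor2 y) * (fourier F (\<xi> - s *\<^sub>R fst y) * fourier G (\<eta> - s *\<^sub>R snd y) *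
       fourier H (- (\<xi> + \<eta> - s *\<^sub>R (fst y + snd y)))) = (LINT x|lborel. ?h y x)"
      by (simp only: mult.assoc)
  qed
  also have "\<dots> = (LINT x|lborel. LINT y|lborel. ?h y x)"
    by (rule lborel_fubini[symmetric, OF int])
  also have "\<dots> = (LINT x|lborel. H x * cis (2 * pi * (x \<bullet> (\<xi> + \<eta>))) * (local_fourier s F x \<xi> * local_fourier s G x \<eta>))"
  proof (intro Bochner_Integration.integral_cong refl)
    fix x :: 'a
    let ?p = "\<lambda>F \<xi> a. complex_of_real (tensor v a) * (fourier F (\<xi> - s *\<^sub>R a) * cis (- (2 * pi) * (s * (x \<bullet> a))))"
    have p: "integrable lborel (?p F \<xi>)" if [measurable]: "F \<in> borel_measurable borel" for F :: "'a \<Rightarrow> complex" and \<xi>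
    proof (rule Bochner_Integration.integrable_bound)
      show "integrable lborel (\<lambda>a::'a. (LINT x|lborel. norm (F x)) * tensor v a)"
        using tensor_has_integral by (auto simp: has_bochner_integral_iff)
      show "AE a in lborel. norm (?p F \<xi> a) \<le> norm ((LINT x|lborel. norm (F x)) * tensor v a)"
        using norm_fourier_le[of F]
        by (intro AE_I2) (auto simp: norm_mult tensor_nonneg abs_mult mult.commute intro!: mult_left_mono)
    qed (unfold cis_conv_exp, measurable)
    have "(LINT y|lborel. ?h y x) = (LINT y|lborel. (H x * cis (2 * pi * (x \<bullet> (\<xi> + \<eta>)))) * (?p F \<xi> (fst y) * ?p G \<eta> (snd y)))"
    proof (intro Bochner_Integration.integral_cong refl)
      fix y :: "'a \<times> 'a"
      have "cis (2 * pi * (x \<bullet> (\<xi> + \<eta> - s *\<^sub>R (fst y + snd y)))) =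
          cis (2 * pi * (x \<bullet> (\<xi> + \<eta>))) * (cis (- (2 * pi) * (s * (x \<bullet> fst y))) * cis (- (2 * pi) * (s * (x \<bullet> snd y))))"
        by (simp add: cis_mult inner_diff_right inner_add_right algebra_simps)
      then show "?h y x = (H x * cis (2 * pi * (x \<bullet> (\<xi> + \<eta>)))) * (?p F \<xi> (fst y) * ?p G \<eta> (snd y))"
        by (simp add: tensor2_def mult_ac)
    qed
    also have "\<dots> = (H x * cis (2 * pi * (x \<bullet> (\<xi> + \<eta>)))) * (LINT y|lborel. ?p F \<xi> (fst y) * ?p G \<eta> (snd y))"
      by (rule integral_mult_right_zero)
    also have "(LINT y|lborel. ?p F \<xi> (fst y) * ?p G \<eta> (snd y)) = local_fourier s F x \<xi> * local_fourier s G x \<eta>"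
      unfolding local_fourier_def
      by (intro has_bochner_integral_integral_eq has_bochner_integral_lborel_pair p) measurable
    finally show "(LINT y|lborel. ?h y x) = H x * cis (2 * pi * (x \<bullet> (\<xi> + \<eta>))) * (local_fourier s F x \<xi> * local_fourier s G x \<eta>)" .
  qed
  finally show ?thesis .
qed

text \<open>The trilinear bound is the same for all translates of \<open>m\<close>, and the kernel
  has mass 1; together they give the absolute convergence that Fubini requires. The inner average is
  then \<open>averaged_form_inner\<close>.\<close>

lemma averaged_form_eq:
  fixes m :: "'a::euclidean_space \<times> 'a \<Rightarrow> complex"
  assumes [measurable]: "m \<in> borel_measurable borel" and Q: "quartic_integral m \<le> ennreal (Q ^ 4)" "Q \<ge> 0"
    and F: "F \<in> L1_L2" and G: "G \<in> L1_L2" and H: "H \<in> L1_L2"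
  shows "averaged_form s m F G H = (LINT z|lborel. m z *
     (LINT x|lborel. H x * cis (2 * pi * (x \<bullet> (fst z + snd z))) * (local_fourier s F x (fst z) * local_fourier s G x (snd z))))"
proof -
  have [measurable]: "F \<in> borel_measurable borel" "G \<in> borel_measurable borel" "H \<in> borel_measurable borel"
    using F G H by (auto intro: L1_L2_measurable)
  let ?g = "\<lambda>a z. m z * fourier F (fst z - fst a) * fourier G (snd z - snd a) * fourier H (- (fst z + snd z - (fst a + snd a)))"
  let ?k = "\<lambda>y z. complex_of_real (tensor2 y) * ?g (s *\<^sub>R y) z"
  let ?N = "Q * (l2norm F * l2norm G * l2norm H)"
  have int: "integrable lborel (\<lambda>w. ?k (fst w) (snd w))"
  proof (rule integrableI_bounded)
    show meas: "(\<lambda>w. ?k (fst w) (snd w)) \<in> borel_measurable lborel" by measurable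
    have "(\<integral>\<^sup>+w. ennreal (norm (?k (fst w) (snd w))) \<partial>lborel) = (\<integral>\<^sup>+y. \<integral>\<^sup>+z. ennreal (norm (?k y z)) \<partial>lborel \<partial>lborel)"
      using meas by (subst nn_integral_lborel_pair(1)) auto
    also have "\<dots> \<le> (\<integral>\<^sup>+y. ennreal (tensor2 y) * ennreal ?N \<partial>(lborel :: ('a \<times> 'a) measure))"
    proof (intro nn_integral_mono)
      fix y :: "'a \<times> 'a"
      have [measurable]: "?g (s *\<^sub>R y) \<in> borel_measurable borel" by measurable
      have "(\<integral>\<^sup>+z. ennreal (norm (?k y z)) \<partial>lborel) = ennreal (tensor2 y) * (\<integral>\<^sup>+z. ennreal (norm (?g (s *\<^sub>R y) z)) \<partial>lborel)"
        by (simp add: norm_mult[of "complex_of_real _"] tensor2_nonneg ennreal_mult' nn_integral_cmult)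
      also have "(\<integral>\<^sup>+z. ennreal (norm (?g (s *\<^sub>R y) z)) \<partial>lborel)
          = (\<integral>\<^sup>+z. ennreal (norm (?g (s *\<^sub>R y) (s *\<^sub>R y + z))) \<partial>lborel)"
        by (rule nn_integral_lborel_translate[symmetric]) measurable
      also have "\<dots> = (\<integral>\<^sup>+z. ennreal (norm (m (z + s *\<^sub>R y) * fourier F (fst z) * fourier G (snd z) * fourier H (- (fst z + snd z)))) \<partial>lborel)"
        by (intro nn_integral_cong) (simp add: algebra_simps)
      also have "\<dots> \<le> ennreal ?N"
        by (rule nn_integral_trilinear_fourier_le) (use assms in \<open>simp_all add: quartic_integral_translate\<close>)
      finally show "(\<integral>\<^sup>+z. ennreal (norm (?k y z)) \<partial>lborel) \<le> ennreal (tensor2 y) * ennreal ?N"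
        by (simp add: mult_left_mono)
    qed
    also have "\<dots> = ennreal ?N"
      using tensor2_has_integral[where 'a='a]
      by (simp add: nn_integral_multc nn_integral_eq_integral has_bochner_integral_iff tensor2_nonneg)
    finally show "(\<integral>\<^sup>+w. ennreal (norm (?k (fst w) (snd w))) \<partial>lborel) < \<infinity>"
      by (rule le_less_trans) simp
  qed
  have "averaged_form s m F G H = (LINT y|lborel. LINT z|lborel. ?k y z)"
    unfolding averaged_form_def
    by (intro Bochner_Integration.integral_cong refl)
       (simp add: shifted_form_translate[OF _ F G H])
  also have "\<dots> = (LINT z|lborel. LINT y|lborel. ?k y z)"
    by (rule lborel_fubini[symmetric, OF int])
  also have "\<dots> = (LINT z|lborel. m z *
     (LINT x|lborel. H x * cis (2 * pi * (x \<bullet> (fst z + snd z))) * (local_fourier s F x (fst z) * local_fourier s G x (snd z))))"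
  proof (intro Bochner_Integration.integral_cong refl)
    fix z :: "'a \<times> 'a"
    have "(LINT y|lborel. ?k y z) = (LINT y|lborel. m z * (complex_of_real (tensor2 y) * (fourier F (fst z - s *\<^sub>R fst y) * fourier G (snd z - s *\<^sub>R snd y) *
       fourier H (- (fst z + snd z - s *\<^sub>R (fst y + snd y))))))"
      by (intro Bochner_Integration.integral_cong refl) (simp add: scaleR_add_right mult_ac)
    then show "(LINT y|lborel. ?k y z) = m z *
     (LINT x|lborel. H x * cis (2 * pi * (x \<bullet> (fst z + snd z))) * (local_fourier s F x (fst z) * local_fourier s G x (snd z)))"
      by (simp only: integral_mult_right_zero averaged_form_inner[OF F G H])
  qed
  finally show ?thesis .
qed

text \<open>In \<open>averaged_form_eq\<close> only positions \<open>x\<close> with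
  \<open>H x \<noteq> 0\<close> contribute, and there \<open>local_fourier\<close> sees
  \<open>F\<close> and \<open>G\<close> only near \<open>x\<close>.\<close>

lemma averaged_form_local:
  fixes m :: "'a::euclidean_space \<times> 'a \<Rightarrow> complex"
  assumes m: "m \<in> borel_measurable borel" and Q: "quartic_integral m \<le> ennreal (Q ^ 4)" "Q \<ge> 0"
    and F: "F \<in> L1_L2" "F' \<in> L1_L2" and G: "G \<in> L1_L2" "G' \<in> L1_L2" and H: "H \<in> L1_L2"
    and eq: "\<And>x y. H x \<noteq> 0 \<Longrightarrow> near s x y \<Longrightarrow> F y = F' y" "\<And>x y. H x \<noteq> 0 \<Longrightarrow> near s x y \<Longrightarrow> G y = G' y"
  shows "averaged_form s m F G H = averaged_form s m F' G' H"
proof -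
  have "local_fourier s F x \<xi> = local_fourier s F' x \<xi>" "local_fourier s G x \<xi> = local_fourier s G' x \<xi>"
    if "H x \<noteq> 0" for x \<xi>
    using F G eq[OF that] by (auto intro!: local_fourier_cong L1_L2_integrable)
  then have *: "H x * c * (local_fourier s F x \<xi> * local_fourier s G x \<eta>) = H x * c * (local_fourier s F' x \<xi> * local_fourier s G' x \<eta>)" for x c \<xi> \<eta>
    by (cases "H x = 0") auto
  then show ?thesis
    unfolding averaged_form_eq[OF m Q F(1) G(1) H] averaged_form_eq[OF m Q F(2) G(2) H] by (simp only: *)
qed

end

section \<open>Approximation by local forms\<close>

text \<open>The length of \<open>y\<close> that telescoping along the coordinate directions produces
  in \<open>norm_fdiff_le\<close>.\<close>

definition l1_norm :: "'a::euclidean_space \<Rightarrow> real" where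
  "l1_norm y = (\<Sum>b\<in>Basis. \<bar>y \<bullet> b\<bar>)"

lemma l1_norm_nonneg [simp]: "0 \<le> l1_norm y"
  by (simp add: l1_norm_def sum_nonneg)

lemma l1_norm_measurable [measurable]: "l1_norm \<in> borel_measurable borel"
  unfolding l1_norm_def by measurable

lemma l1_norm_scaleR: "s \<ge> 0 \<Longrightarrow> l1_norm (s *\<^sub>R y) = s * l1_norm y"
  by (simp add: l1_norm_def sum_distrib_left abs_mult)

lemma l1_norm_Pair: "l1_norm y = l1_norm (fst y) + l1_norm (snd y)"
  unfolding l1_norm_def Basis_prod_def
  by (subst sum.union_disjoint) (auto simp: sum.reindex inj_on_def inner_prod_def)

lemma one_plus_sum_le_prod:
  fixes f :: "'b \<Rightarrow> real"
  assumes "finite A" "\<And>x. x \<in> A \<Longrightarrow> 0 \<le> f x"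
  shows "1 + sum f A \<le> (\<Prod>x\<in>A. 1 + f x)"
  using assms
proof (induction A)
  case (insert x A)
  have "1 + sum f (insert x A) \<le> (1 + f x) * (1 + sum f A)"
    using insert by (simp add: algebra_simps sum_nonneg)
  also have "\<dots> \<le> (1 + f x) * (\<Prod>x\<in>A. 1 + f x)"
    using insert by (intro mult_left_mono) auto
  finally show ?case using insert by simp
qed simp

lemma fdiff_measurable:
  assumes [measurable]: "m \<in> borel_measurable borel"
  shows "fdiff k y m \<in> borel_measurable borel"
  unfolding fdiff_binomial[abs_def] by measurable

lemma near_mono: "near s x y \<Longrightarrow> \<bar>r\<bar> \<le> \<bar>s\<bar> \<Longrightarrow> near r x y"
  unfolding near_def abs_mult by (blast intro: order_trans mult_right_mono abs_ge_zero)

context band_limited_kernel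
begin

text \<open>By \<open>one_plus_sum_le_prod\<close> the weight is at most a product over all
  coordinates, which reduces the claim to the one-dimensional moment
  \<open>v_moment\<close>.\<close>

lemma tensor2_moment: "integrable lborel (\<lambda>y::'a::euclidean_space \<times> 'a. tensor2 y * (1 + l1_norm y) ^ M)"
proof (rule Bochner_Integration.integrable_bound)
  let ?W = "tensor (\<lambda>t. v t * (1 + \<bar>t\<bar>) ^ M) :: 'a \<Rightarrow> real"
  have "integrable lborel ?W"
    using has_bochner_integral_lborel_prod[of "\<lambda>_ t. v t * (1 + \<bar>t\<bar>) ^ M"] v_moment
    by (auto simp: tensor_def[abs_def] has_bochner_integral_iff)
  then show "integrable lborel (\<lambda>y::'a \<times> 'a. ?W (fst y) * ?W (snd y))"
    using has_bochner_integral_lborel_pair[of ?W ?W] by (auto simp: has_bochner_integral_iff)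
  show "AE y in lborel. norm (tensor2 y * (1 + l1_norm y) ^ M) \<le> norm (?W (fst y) * ?W (snd y))"
  proof (intro AE_I2)
    fix y :: "'a \<times> 'a"
    let ?P = "\<lambda>x::'a. \<Prod>b\<in>Basis. 1 + \<bar>x \<bullet> b\<bar>"
    have P: "1 + l1_norm x \<le> ?P x" for x :: 'a
      unfolding l1_norm_def by (rule one_plus_sum_le_prod) auto
    have W: "?W x = tensor v x * ?P x ^ M" for x
      by (simp add: tensor_def prod.distrib prod_power_distrib)
    have "1 + l1_norm y \<le> (1 + l1_norm (fst y)) * (1 + l1_norm (snd y))"
      unfolding l1_norm_Pair[of y] by (simp add: algebra_simps)
    also have "\<dots> \<le> ?P (fst y) * ?P (snd y)"
      using P[of "fst y"] P[of "snd y"] by (intro mult_mono P) (auto intro!: prod_nonneg add_nonneg_nonneg)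
    finally have "(1 + l1_norm y) ^ M \<le> (?P (fst y) * ?P (snd y)) ^ M"
      by (intro power_mono) auto
    then have "tensor2 y * (1 + l1_norm y) ^ M \<le> tensor2 y * (?P (fst y) * ?P (snd y)) ^ M"
      by (intro mult_left_mono tensor2_nonneg)
    also have "\<dots> = ?W (fst y) * ?W (snd y)"
      by (simp add: W tensor2_def power_mult_distrib)
    also have "\<dots> \<le> norm (?W (fst y) * ?W (snd y))"
      unfolding real_norm_def by (rule abs_ge_self)
    finally show "norm (tensor2 y * (1 + l1_norm y) ^ M) \<le> norm (?W (fst y) * ?W (snd y))"
      by (simp add: abs_mult tensor2_nonneg)
  qed
qed measurable

text \<open>The \<open>itself\<close> argument carries the dimension, on which this constant
  depends.\<close>

definition moment :: "'a::euclidean_space itself \<Rightarrow> real" where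
  "moment _ = (LINT y|(lborel :: ('a \<times> 'a) measure). tensor2 y * (1 + l1_norm y) ^ M)"

lemma moment_nonneg: "0 \<le> moment TYPE('a::euclidean_space)"
  unfolding moment_def by (intro Bochner_Integration.integral_nonneg) (simp add: tensor2_nonneg)

text \<open>Up to the sign \<open>(-1)^M\<close> these are the coefficients of the terms \<open>i > 0\<close> of the \<open>M\<close>-th difference, so that the error is an average of \<open>M\<close>-th differences of \<open>m\<close>.\<close>

definition approx_form :: "real \<Rightarrow> ('a::euclidean_space \<times> 'a \<Rightarrow> complex) \<Rightarrow> ('a \<Rightarrow> complex) \<Rightarrow> ('a \<Rightarrow> complex) \<Rightarrow> ('a \<Rightarrow> complex) \<Rightarrow> complex" where
  "approx_form s m F G H = (\<Sum>i=1..M. (-1) ^ (i + 1) * of_nat (M choose i) * averaged_form (real i * s) m F G H)"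

text \<open>Since the kernel has mass 1, the error is up to sign the average of the forms with
  multiplier \<open>fdiff M (s *\<^sub>R y) m\<close>. Their growth like
  \<open>l1_norm y powr \<delta>\<close> is paid for by the \<open>M\<close>-th moment of the
  kernel, as \<open>\<delta>\<close> is at most \<open>M\<close>.\<close>

lemma approx_form_error:
  fixes m :: "'a::euclidean_space \<times> 'a \<Rightarrow> complex"
  assumes m[measurable]: "m \<in> borel_measurable borel" and Q: "quartic_integral m \<le> ennreal (Q ^ 4)" "Q \<ge> 0"
    and F: "F \<in> L1_L2" and G: "G \<in> L1_L2" and H: "H \<in> L1_L2"
    and K: "K \<ge> 0" and \<delta>: "0 \<le> \<delta>" "\<delta> \<le> real M" and s: "s > 0"
    and diff: "\<And>y. quartic_integral (fdiff M y m) \<le> ennreal ((K * l1_norm y powr \<delta>) ^ 4)"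
  shows "norm (shifted_form m F G H 0 - approx_form s m F G H)
     \<le> K * moment TYPE('a) * s powr \<delta> * (l2norm F * l2norm G * l2norm H)"
proof -
  let ?N = "l2norm F * l2norm G * l2norm H"
  define T where "T y = trilinear (fdiff M (s *\<^sub>R y) m) (fourier F) (fourier G) (\<lambda>\<zeta>. fourier H (- \<zeta>))" for y
  have T: "T y = (\<Sum>i\<le>M. (-1) ^ (M + i) * of_nat (M choose i) * shifted_form m F G H ((real i * s) *\<^sub>R y))" for y
  proof -
    have int: "integrable lborel (\<lambda>z. m (z + a) * fourier F (fst z) * fourier G (snd z) * fourier H (- (fst z + snd z)))" for a
      by (rule integrable_trilinear_fourier[OF _ _ Q(2) F G H]) (use Q in \<open>simp_all add: quartic_integral_translate\<close>)
    have "T y = (LINT z|lborel. (\<Sum>i\<le>M. (-1) ^ (M + i) * of_nat (M choose i) *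
        (m (z + (real i * s) *\<^sub>R y) * fourier F (fst z) * fourier G (snd z) * fourier H (- (fst z + snd z)))))"
      unfolding T_def trilinear_def fdiff_binomial by (simp add: sum_distrib_right mult.assoc)
    also have "\<dots> = (\<Sum>i\<le>M. (-1) ^ (M + i) * of_nat (M choose i) * shifted_form m F G H ((real i * s) *\<^sub>R y))"
      unfolding shifted_form_def trilinear_def
      by (subst Bochner_Integration.integral_sum) (rule integrable_mult_right, rule int, simp only: integral_mult_right_zero)
    finally show ?thesis .
  qed
  have int: "integrable lborel (\<lambda>y. complex_of_real (tensor2 y) * shifted_form m F G H (r *\<^sub>R y))" for r
    by (rule integrable_averaged_form[OF m Q F G H])
  have intT: "integrable lborel (\<lambda>y. complex_of_real (tensor2 y) * T y)"
  proof -
    have "(\<lambda>y. complex_of_real (tensor2 y) * T y) = (\<lambda>y. \<Sum>i\<le>M. (-1) ^ (M + i) * of_nat (M choose i) *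
      (complex_of_real (tensor2 y) * shifted_form m F G H ((real i * s) *\<^sub>R y)))"
      unfolding T by (simp add: sum_distrib_left mult_ac)
    then show ?thesis by (simp only:) (intro Bochner_Integration.integrable_sum integrable_mult_right int)
  qed
  have "(LINT y|lborel. complex_of_real (tensor2 y) * T y)
     = (LINT y|lborel. (\<Sum>i\<le>M. (-1) ^ (M + i) * of_nat (M choose i) *
      (complex_of_real (tensor2 y) * shifted_form m F G H ((real i * s) *\<^sub>R y))))"
    unfolding T by (simp add: sum_distrib_left mult_ac)
  also have "\<dots> = (\<Sum>i\<le>M. (-1) ^ (M + i) * of_nat (M choose i) * averaged_form (real i * s) m F G H)"
    unfolding averaged_form_def by (subst Bochner_Integration.integral_sum) (auto intro!: integrable_mult_right int)
  also have "\<dots> = (-1) ^ M * (\<Sum>i\<in>{0..M}. (-1) ^ i * of_nat (M choose i) * averaged_form (real i * s) m F G H)"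
    by (simp add: sum_distrib_left power_add mult.assoc atMost_atLeast0)
  \<comment> \<open>The term \<open>i = 0\<close> is the average at scale 0; the sign
    \<open>(-1) ^ (i + 1)\<close> in \<open>approx_form\<close> makes the other terms its
    negative.\<close>
  also have "(\<Sum>i\<in>{0..M}. (-1) ^ i * of_nat (M choose i) * averaged_form (real i * s) m F G H)
     = averaged_form 0 m F G H - approx_form s m F G H"
    unfolding approx_form_def by (subst sum.atLeast_Suc_atMost) (simp_all add: sum_negf[symmetric])
  also have "averaged_form 0 m F G H = shifted_form m F G H 0"
  proof -
    have "has_bochner_integral lborel (\<lambda>y::'a \<times> 'a. complex_of_real (tensor2 y)) (complex_of_real 1)"
      by (rule has_bochner_integral_of_real[OF tensor2_has_integral])
    then show ?thesis
      by (simp add: averaged_form_def has_bochner_integral_iff)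
  qed
  finally have "norm (shifted_form m F G H 0 - approx_form s m F G H) = norm (LINT y|lborel. complex_of_real (tensor2 y) * T y)"
    by (simp add: norm_mult norm_power)
  also have "\<dots> \<le> (LINT y|(lborel :: ('a \<times> 'a) measure). (K * s powr \<delta> * ?N) * (tensor2 y * (1 + l1_norm y) ^ M))"
  proof (rule Bochner_Integration.integral_norm_bound_integral)
    show "integrable lborel (\<lambda>y. complex_of_real (tensor2 y) * T y)" by (rule intT)
    show "integrable lborel (\<lambda>y::'a \<times> 'a. (K * s powr \<delta> * ?N) * (tensor2 y * (1 + l1_norm y) ^ M))"
      by (rule integrable_mult_right[OF tensor2_moment])
    fix y :: "'a \<times> 'a"
    have "norm (T y) \<le> (K * l1_norm (s *\<^sub>R y) powr \<delta>) * ?N"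
      unfolding T_def using K by (intro norm_trilinear_fourier_le fdiff_measurable m diff F G H) auto
    also have "l1_norm (s *\<^sub>R y) powr \<delta> = s powr \<delta> * l1_norm y powr \<delta>"
      using s by (simp add: l1_norm_scaleR powr_mult)
    also have "K * (s powr \<delta> * l1_norm y powr \<delta>) * ?N \<le> K * (s powr \<delta> * (1 + l1_norm y) ^ M) * ?N"
    proof -
      have "l1_norm y powr \<delta> \<le> (1 + l1_norm y) powr \<delta>"
        using \<delta> by (intro powr_mono2) auto
      also have "\<dots> \<le> (1 + l1_norm y) powr real M"
        using \<delta> l1_norm_nonneg[of y] by (intro powr_mono) auto
      also have "\<dots> = (1 + l1_norm y) ^ M"
        using l1_norm_nonneg[of y] by (intro powr_realpow) linarith
      finally show ?thesis using K by (intro mult_left_mono mult_right_mono) auto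
    qed
    finally have "tensor2 y * norm (T y) \<le> tensor2 y * (K * (s powr \<delta> * (1 + l1_norm y) ^ M) * ?N)"
      by (intro mult_left_mono tensor2_nonneg)
    then show "norm (complex_of_real (tensor2 y) * T y) \<le> (K * s powr \<delta> * ?N) * (tensor2 y * (1 + l1_norm y) ^ M)"
      by (simp add: norm_mult tensor2_nonneg mult_ac)
  qed
  also have "\<dots> = K * moment TYPE('a) * s powr \<delta> * ?N"
    by (simp add: moment_def)
  finally show ?thesis .
qed

lemma approx_form_local:
  fixes m :: "'a::euclidean_space \<times> 'a \<Rightarrow> complex"
  assumes m: "m \<in> borel_measurable borel" and Q: "quartic_integral m \<le> ennreal (Q ^ 4)" "Q \<ge> 0"
    and F: "F \<in> L1_L2" "F' \<in> L1_L2" and G: "G \<in> L1_L2" "G' \<in> L1_L2" and H: "H \<in> L1_L2"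
    and eq: "\<And>x y. H x \<noteq> 0 \<Longrightarrow> near s x y \<Longrightarrow> F y = F' y" "\<And>x y. H x \<noteq> 0 \<Longrightarrow> near s x y \<Longrightarrow> G y = G' y"
  shows "approx_form s m F G H = approx_form s m F' G' H"
  unfolding approx_form_def
proof (intro sum.cong refl arg_cong2[where f = "(*)"])
  fix i assume i: "i \<in> {1..M}"
  \<comment> \<open>Here \<open>1 \<le> i\<close> matters: passing from \<open>s\<close> to
    \<open>i * s\<close> never enlarges the neighborhood, so all terms are local at
    \<open>s\<close>.\<close>
  have near: "near s x y" if "near (real i * s) x y" for x y :: 'a
    using that i by (elim near_mono) (simp add: abs_mult mult_le_cancel_right1)
  show "averaged_form (real i * s) m F G H = averaged_form (real i * s) m F' G' H"
    by (rule averaged_form_local[OF m Q F G H]) (auto intro: eq near)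
qed

lemma fourier_sum:
  assumes "\<And>k. k \<in> K \<Longrightarrow> integrable lborel (H k)"
  shows "fourier (\<lambda>x. \<Sum>k\<in>K. H k x) \<xi> = (\<Sum>k\<in>K. fourier (H k) \<xi>)"
  unfolding fourier_cis sum_distrib_right
  using assms by (intro Bochner_Integration.integral_sum integrable_mult_cis) auto

text \<open>Additivity in the third function is used to cut \<open>H\<close> into cubes;
  \<open>F\<close> and \<open>G\<close> are then cut by locality.\<close>

lemma approx_form_sum:
  fixes m :: "'a::euclidean_space \<times> 'a \<Rightarrow> complex"
  assumes m: "m \<in> borel_measurable borel" and Q: "quartic_integral m \<le> ennreal (Q ^ 4)" "Q \<ge> 0"
    and F: "F \<in> L1_L2" and G: "G \<in> L1_L2" and H: "\<And>k. k \<in> I \<Longrightarrow> H k \<in> L1_L2"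
  shows "approx_form s m F G (\<lambda>x. \<Sum>k\<in>I. H k x) = (\<Sum>k\<in>I. approx_form s m F G (H k))"
proof -
  have shift: "shifted_form m F G (\<lambda>x. \<Sum>k\<in>I. H k x) a = (\<Sum>k\<in>I. shifted_form m F G (H k) a)" for a
  proof -
    have int: "integrable lborel (\<lambda>z. m (z + a) * fourier F (fst z) * fourier G (snd z) * fourier (H k) (- (fst z + snd z)))" if "k \<in> I" for k
      by (rule integrable_trilinear_fourier[OF _ _ Q(2) F G H[OF that]])
         (use m Q in \<open>simp_all add: quartic_integral_translate\<close>)
    have f: "fourier (\<lambda>x. \<Sum>k\<in>I. H k x) \<xi> = (\<Sum>k\<in>I. fourier (H k) \<xi>)" for \<xi>
      by (rule fourier_sum) (use H L1_L2_integrable in blast)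
    show ?thesis
      unfolding shifted_form_def trilinear_def f sum_distrib_left
      by (rule Bochner_Integration.integral_sum[OF int])
  qed
  have avg: "averaged_form r m F G (\<lambda>x. \<Sum>k\<in>I. H k x) = (\<Sum>k\<in>I. averaged_form r m F G (H k))" for r
    unfolding averaged_form_def shift sum_distrib_left
    by (rule Bochner_Integration.integral_sum[OF integrable_averaged_form[OF m Q F G H]])
  show ?thesis
    unfolding approx_form_def avg sum_distrib_left by (rule sum.swap)
qed

end

section \<open>Hoelder's inequality on cubes\<close>

lemma weighted_am_gm3:
  fixes a b c :: real
  assumes pos: "a > 0" "b > 0" "c > 0" and e: "\<alpha> \<ge> 0" "\<beta> \<ge> 0" "\<gamma> \<ge> 0" "\<alpha> + \<beta> + \<gamma> = 1"
  shows "a powr \<alpha> * b powr \<beta> * c powr \<gamma> \<le> \<alpha> * a + \<beta> * b + \<gamma> * c"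
proof -
  define A where "A = \<alpha> * a + \<beta> * b + \<gamma> * c"
  have "\<alpha> > 0 \<or> \<beta> > 0 \<or> \<gamma> > 0" using e by linarith
  then have "\<alpha> * a > 0 \<or> \<beta> * b > 0 \<or> \<gamma> * c > 0" using pos by (auto intro: mult_pos_pos)
  moreover have "\<alpha> * a \<ge> 0" "\<beta> * b \<ge> 0" "\<gamma> * c \<ge> 0" using pos e by simp_all
  ultimately have A: "A > 0" unfolding A_def by linarith
  have ln: "t * ln x \<le> t * ln A + (t * x / A - t)" if "x > 0" "t \<ge> 0" for x t
  proof -
    have "ln (x / A) \<le> x / A - 1" using that A by (intro ln_le_minus_one) auto
    then have "t * ln (x / A) \<le> t * (x / A - 1)" using that by (intro mult_left_mono) auto
    then show ?thesis using that A by (simp add: ln_div algebra_simps)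
  qed
  have "\<alpha> * ln a + \<beta> * ln b + \<gamma> * ln c \<le> (\<alpha> + \<beta> + \<gamma>) * ln A + (A / A - (\<alpha> + \<beta> + \<gamma>))"
  proof -
    have "A / A = \<alpha> * a / A + \<beta> * b / A + \<gamma> * c / A"
      by (simp only: A_def add_divide_distrib)
    moreover have "(\<alpha> + \<beta> + \<gamma>) * ln A = \<alpha> * ln A + \<beta> * ln A + \<gamma> * ln A"
      by (simp only: distrib_right)
    ultimately show ?thesis
      using ln[of a \<alpha>] ln[of b \<beta>] ln[of c \<gamma>] pos e by linarith
  qed
  also have "\<dots> = ln A" using A e by simp
  finally have "exp (\<alpha> * ln a + \<beta> * ln b + \<gamma> * ln c) \<le> A"
    using A by (metis exp_le_cancel_iff exp_ln)
  then show ?thesis using pos by (simp add: A_def powr_def exp_add mult_ac)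
qed

text \<open>Weighted AM-GM with weights 2/p and 1 - 2/p. The powers of the free threshold
  \<open>\<tau>\<close> are chosen to cancel in the geometric mean.\<close>

lemma young_square:
  fixes t \<tau> p :: real
  assumes "t \<ge> 0" "\<tau> > 0" "p \<ge> 2"
  shows "t\<^sup>2 \<le> 2 / p * \<tau> powr (2 - p) * t powr p + (1 - 2 / p) * \<tau>\<^sup>2"
proof (cases "t = 0")
  case True
  then show ?thesis using assms by simp
next
  case False
  then have t: "t > 0" using assms by simp
  \<comment> \<open>The third slot of the inequality is filled by the number 1 with weight
    0.\<close>
  have "(\<tau> powr (2 - p) * t powr p) powr (2 / p) * (\<tau>\<^sup>2) powr (1 - 2 / p) * 1 powr 0
      \<le> 2 / p * (\<tau> powr (2 - p) * t powr p) + (1 - 2 / p) * \<tau>\<^sup>2 + 0 * 1"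
    using assms t by (intro weighted_am_gm3) auto
  moreover have "(\<tau> powr (2 - p) * t powr p) powr (2 / p) * (\<tau>\<^sup>2) powr (1 - 2 / p) = t\<^sup>2"
  proof -
    have z: "(2 - p) * (2 / p) + 2 * (1 - 2 / p) = 0" using assms by (simp add: field_simps)
    have "\<tau>\<^sup>2 = \<tau> powr 2" using assms by simp
    then have 1: "(\<tau>\<^sup>2) powr (1 - 2 / p) = \<tau> powr (2 * (1 - 2 / p))"
      by (simp only: powr_powr)
    have 2: "(\<tau> powr (2 - p) * t powr p) powr (2 / p) = \<tau> powr ((2 - p) * (2 / p)) * t powr 2"
      using assms t by (simp add: powr_mult powr_powr)
    have "(\<tau> powr (2 - p) * t powr p) powr (2 / p) * (\<tau>\<^sup>2) powr (1 - 2 / p)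
       = \<tau> powr ((2 - p) * (2 / p) + 2 * (1 - 2 / p)) * t powr 2"
      unfolding 1 2 powr_add by (simp only: mult_ac)
    also have "\<dots> = t\<^sup>2"
      unfolding z using assms t by simp
    finally show ?thesis .
  qed
  ultimately show ?thesis by (simp add: mult.assoc)
qed

lemma ennreal_mult_add: "a \<ge> 0 \<Longrightarrow> b \<ge> 0 \<Longrightarrow> c \<ge> 0 \<Longrightarrow> ennreal (a * b + c) = ennreal a * ennreal b + ennreal c"
  by (simp add: ennreal_mult)

lemma ennreal_mult_add_mult:
  "a \<ge> 0 \<Longrightarrow> b \<ge> 0 \<Longrightarrow> c \<ge> 0 \<Longrightarrow> d \<ge> 0 \<Longrightarrow> ennreal (a * b + c * d) = ennreal a * ennreal b + ennreal c * ennreal d"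
  by (simp add: ennreal_mult)

text \<open>Hoelder between L^2 and L^p on a set of measure at most \<open>V\<close>, obtained by
  integrating \<open>young_square\<close> with a well chosen threshold.\<close>

lemma sq_integral_indicator_le:
  fixes F :: "'a::euclidean_space \<Rightarrow> complex"
  assumes [measurable]: "F \<in> borel_measurable borel" "A \<in> sets borel"
    and V: "emeasure lborel A \<le> ennreal V" "V > 0" and p: "p \<ge> 2"
    and X: "(\<integral>\<^sup>+x. indicator A x * ennreal (norm (F x) powr p) \<partial>lborel) \<le> ennreal X" "X > 0"
  shows "sq_integral (\<lambda>x. indicator A x *\<^sub>R F x) \<le> ennreal ((V powr (1 / 2 - 1 / p) * X powr (1 / p))\<^sup>2)"
proof -
  \<comment> \<open>The threshold with \<open>\<tau> powr p * V = X\<close>: the two terms of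
    Young's inequality become multiples of \<open>\<tau>\<^sup>2 * V\<close>, and their weights 2/p
    and 1 - 2/p add up to 1.\<close>
  define \<tau> where "\<tau> = (X / V) powr (1 / p)"
  have \<tau>: "\<tau> > 0" using V X by (simp add: \<tau>_def)
  have "sq_integral (\<lambda>x. indicator A x *\<^sub>R F x)
     \<le> (\<integral>\<^sup>+x. ennreal (2 / p * \<tau> powr (2 - p)) * (indicator A x * ennreal (norm (F x) powr p)) + ennreal ((1 - 2 / p) * \<tau>\<^sup>2) * indicator A x \<partial>lborel)"
    unfolding sq_integral_def
  proof (intro nn_integral_mono)
    fix x
    have "ennreal ((norm (F x))\<^sup>2) \<le> ennreal (2 / p * \<tau> powr (2 - p) * norm (F x) powr p + (1 - 2 / p) * \<tau>\<^sup>2)"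
      using young_square[of "norm (F x)" \<tau> p] \<tau> p by (intro ennreal_leI) auto
    also have "\<dots> = ennreal (2 / p * \<tau> powr (2 - p)) * ennreal (norm (F x) powr p) + ennreal ((1 - 2 / p) * \<tau>\<^sup>2)"
      using p by (intro ennreal_mult_add) auto
    finally show "ennreal ((norm (indicator A x *\<^sub>R F x))\<^sup>2) \<le>
       ennreal (2 / p * \<tau> powr (2 - p)) * (indicator A x * ennreal (norm (F x) powr p)) + ennreal ((1 - 2 / p) * \<tau>\<^sup>2) * indicator A x"
      by (auto split: split_indicator)
  qed
  also have "\<dots> = ennreal (2 / p * \<tau> powr (2 - p)) * (\<integral>\<^sup>+x. indicator A x * ennreal (norm (F x) powr p) \<partial>lborel) + ennreal ((1 - 2 / p) * \<tau>\<^sup>2) * emeasure lborel A"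
    by (simp add: nn_integral_add nn_integral_cmult nn_integral_indicator)
  also have "\<dots> \<le> ennreal (2 / p * \<tau> powr (2 - p)) * ennreal X + ennreal ((1 - 2 / p) * \<tau>\<^sup>2) * ennreal V"
    by (intro add_mono mult_left_mono X V) auto
  also have "\<dots> = ennreal (2 / p * \<tau> powr (2 - p) * X + (1 - 2 / p) * \<tau>\<^sup>2 * V)"
    by (rule ennreal_mult_add_mult[symmetric]) (use p X V in auto)
  also have "2 / p * \<tau> powr (2 - p) * X + (1 - 2 / p) * \<tau>\<^sup>2 * V = \<tau>\<^sup>2 * V"
  proof -
    have "\<tau> powr p = X / V" using p X V by (simp add: \<tau>_def powr_powr)
    then have "\<tau> powr (2 - p) * X = \<tau>\<^sup>2 * V"
      using \<tau> X V by (simp add: powr_diff)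
    then show ?thesis by (simp add: algebra_simps)
  qed
  also have "\<tau>\<^sup>2 * V = (V powr (1 / 2 - 1 / p) * X powr (1 / p))\<^sup>2"
  proof -
    have "(V powr (1 / 2))\<^sup>2 = V" using V by (simp add: powr_half_sqrt)
    then have "\<tau>\<^sup>2 * V = (\<tau> * V powr (1 / 2))\<^sup>2" by (simp add: power_mult_distrib)
    also have "\<tau> * V powr (1 / 2) = V powr (1 / 2 - 1 / p) * X powr (1 / p)"
      using V X by (simp add: \<tau>_def powr_divide powr_diff)
    finally show ?thesis .
  qed
  finally show ?thesis .
qed

lemma l2norm_le:
  assumes "sq_integral F \<le> ennreal (c\<^sup>2)" "c \<ge> 0"
  shows "l2norm F \<le> c"
proof -
  have "enn2real (sq_integral F) \<le> c\<^sup>2" using assms by (simp add: enn2real_leI)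
  then have "l2norm F \<le> sqrt (c\<^sup>2)" unfolding l2norm_def by (rule real_sqrt_le_mono)
  then show ?thesis using assms(2) by simp
qed

lemma l2norm_mono:
  assumes "\<And>x. norm (F x) \<le> norm (G x)" "sq_integral G < \<infinity>"
  shows "l2norm F \<le> l2norm G"
proof -
  have "sq_integral F \<le> sq_integral G"
    unfolding sq_integral_def by (intro nn_integral_mono ennreal_leI power_mono assms) auto
  then show ?thesis unfolding l2norm_def using assms(2) by (auto intro!: enn2real_mono)
qed

text \<open>The cubes have side \<open>1/s\<close> and are indexed by the corner rescaled to the integer lattice.\<close>

definition lattice_point :: "real \<Rightarrow> 'a::euclidean_space \<Rightarrow> 'a" where
  "lattice_point s x = (\<Sum>b\<in>Basis. real_of_int \<lfloor>s * (x \<bullet> b)\<rfloor> *\<^sub>R b)"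

text \<open>For a lattice label \<open>k\<close> this is the cube labelled \<open>k\<close> together
  with its neighbours, 3^n cubes in all.\<close>

definition cell_neighborhood :: "real \<Rightarrow> 'a::euclidean_space \<Rightarrow> 'a set" where
  "cell_neighborhood s k = {y. \<forall>b\<in>Basis. \<bar>lattice_point s y \<bullet> b - k \<bullet> b\<bar> \<le> 1}"

lemma lattice_point_inner: "b \<in> Basis \<Longrightarrow> lattice_point s x \<bullet> b = real_of_int \<lfloor>s * (x \<bullet> b)\<rfloor>"
  by (simp add: lattice_point_def inner_sum_left inner_Basis if_distrib cong: if_cong)

lemma lattice_point_measurable [measurable]: "lattice_point s \<in> borel_measurable borel"
  unfolding lattice_point_def by measurable

lemma cell_neighborhood_sets [measurable]: "cell_neighborhood s k \<in> sets borel"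
proof -
  have "{y \<in> space borel. \<forall>b\<in>Basis. \<bar>lattice_point s y \<bullet> b - k \<bullet> b\<bar> \<le> 1} \<in> sets borel"
    by measurable
  then show ?thesis by (simp add: cell_neighborhood_def)
qed

lemma emeasure_cell_neighborhood:
  fixes k :: "'a::euclidean_space"
  assumes s: "s > 0"
  shows "emeasure lborel (cell_neighborhood s k) \<le> ennreal ((3 / s) ^ DIM('a))"
proof -
  let ?l = "(1 / s) *\<^sub>R (k - One)" and ?u = "(1 / s) *\<^sub>R (k + 2 *\<^sub>R One)"
  have "cell_neighborhood s k \<subseteq> cbox ?l ?u"
  proof
    fix y assume y: "y \<in> cell_neighborhood s k"
    have "?l \<bullet> b \<le> y \<bullet> b \<and> y \<bullet> b \<le> ?u \<bullet> b" if b: "b \<in> Basis" for b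
    proof -
      have "\<bar>real_of_int \<lfloor>s * (y \<bullet> b)\<rfloor> - k \<bullet> b\<bar> \<le> 1"
        using y b by (auto simp: cell_neighborhood_def lattice_point_inner)
      then have "k \<bullet> b - 1 \<le> s * (y \<bullet> b)" "s * (y \<bullet> b) \<le> k \<bullet> b + 2" by linarith+
      then show ?thesis using s b by (simp add: inner_diff_left inner_add_left field_simps)
    qed
    then show "y \<in> cbox ?l ?u" by (simp add: mem_box)
  qed
  then have "emeasure lborel (cell_neighborhood s k) \<le> emeasure lborel (cbox ?l ?u)"
    by (intro emeasure_mono) auto
  also have "\<dots> = ennreal (\<Prod>b\<in>Basis. (?u - ?l) \<bullet> b)"
    using s by (intro emeasure_lborel_cbox) (auto simp: inner_diff_left inner_add_left divide_right_mono)
  also have "(\<Prod>b\<in>Basis. (?u - ?l) \<bullet> b) = (\<Prod>b\<in>(Basis::'a set). 3 / s)"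
    using s by (intro prod.cong refl) (simp add: inner_diff_left inner_add_left field_simps)
  finally show ?thesis by simp
qed

text \<open>Numbers at distance at most 1 have integer parts that differ by at most 1.\<close>

lemma near_imp_cell_neighborhood:
  assumes "near s x y"
  shows "y \<in> cell_neighborhood s (lattice_point s x)"
  unfolding cell_neighborhood_def mem_Collect_eq
proof
  fix b :: 'a assume b: "b \<in> Basis"
  then have "\<bar>s * (y \<bullet> b) - s * (x \<bullet> b)\<bar> \<le> 1" using assms by (simp add: near_def inner_diff_left right_diff_distrib)
  then have "\<bar>\<lfloor>s * (y \<bullet> b)\<rfloor> - \<lfloor>s * (x \<bullet> b)\<rfloor>\<bar> \<le> 1" by linarith
  then show "\<bar>lattice_point s y \<bullet> b - lattice_point s x \<bullet> b\<bar> \<le> 1"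
    using b by (simp add: lattice_point_inner)
qed

lemma lattice_point_self: "x \<in> cell_neighborhood s (lattice_point s x)"
  by (simp add: cell_neighborhood_def)

text \<open>Encodes labels as integer vectors, so that they can be counted in finite products of
  integer intervals. The coordinates of \<open>c - k\<close> are integers already, so the floor
  changes only the type.\<close>

lemma inj_on_lattice_difference:
  fixes c :: "'a::euclidean_space"
  assumes "c \<in> range (lattice_point s)"
  shows "inj_on (\<lambda>k. \<lambda>b\<in>Basis. \<lfloor>c \<bullet> b - k \<bullet> b\<rfloor>) (range (lattice_point s))"
proof (rule inj_onI)
  fix k l assume kl: "k \<in> range (lattice_point s)" "l \<in> range (lattice_point s)"
    and eq: "(\<lambda>b\<in>Basis. \<lfloor>c \<bullet> b - k \<bullet> b\<rfloor>) = (\<lambda>b\<in>Basis. \<lfloor>c \<bullet> b - l \<bullet> b\<rfloor>)"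
  show "k = l"
  proof (rule euclidean_eqI)
    fix b :: 'a assume b: "b \<in> Basis"
    then have "\<lfloor>c \<bullet> b - k \<bullet> b\<rfloor> = \<lfloor>c \<bullet> b - l \<bullet> b\<rfloor>" using fun_cong[OF eq, of b] by simp
    moreover obtain i j h :: int where "k \<bullet> b = i" "l \<bullet> b = j" "c \<bullet> b = h"
      using kl assms b by (auto simp: lattice_point_inner)
    ultimately show "k \<bullet> b = l \<bullet> b" by (simp flip: of_int_diff)
  qed
qed

text \<open>Bounded overlap: if \<open>y\<close> lies in the neighborhood of \<open>k\<close>, then
  \<open>k\<close> differs from the label of \<open>y\<close> by -1, 0 or 1 in each
  coordinate.\<close>

lemma sum_indicator_cell_neighborhood:
  fixes y :: "'a::euclidean_space"
  assumes K: "finite K" "K \<subseteq> range (lattice_point s)"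
  shows "(\<Sum>k\<in>K. indicator (cell_neighborhood s k) y) \<le> (3 ^ DIM('a) :: ennreal)"
proof -
  let ?S = "{k \<in> K. y \<in> cell_neighborhood s k}"
  let ?f = "\<lambda>k. \<lambda>b\<in>Basis. \<lfloor>lattice_point s y \<bullet> b - k \<bullet> b\<rfloor>"
  have "?f k \<in> (\<Pi>\<^sub>E b\<in>(Basis::'a set). {-1..1})" if "k \<in> ?S" for k
  proof (subst restrict_PiE_iff, rule)
    fix b :: 'a assume b: "b \<in> Basis"
    then have "\<bar>lattice_point s y \<bullet> b - k \<bullet> b\<bar> \<le> 1"
      using that by (auto simp: cell_neighborhood_def)
    then show "\<lfloor>lattice_point s y \<bullet> b - k \<bullet> b\<rfloor> \<in> {-1..1}"
      by (auto simp: le_floor_iff floor_le_iff)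
  qed
  then have "?f ` ?S \<subseteq> (\<Pi>\<^sub>E b\<in>(Basis::'a set). {-1..1})" by blast
  moreover have "inj_on ?f ?S"
    by (rule inj_on_subset[OF inj_on_lattice_difference]) (use K in auto)
  ultimately have "card ?S \<le> card (\<Pi>\<^sub>E b\<in>(Basis::'a set). {-1..1::int})"
    by (intro card_inj_on_le[of ?f] finite_PiE) auto
  also have "\<dots> = 3 ^ DIM('a)" by (simp add: card_PiE)
  finally have card: "card ?S \<le> 3 ^ DIM('a)" .
  have "(\<Sum>k\<in>K. indicator (cell_neighborhood s k) y) = (of_nat (card ?S) :: ennreal)"
    using K by (simp add: indicator_def sum.If_cases Int_def)
  also have "\<dots> \<le> of_nat (3 ^ DIM('a))" using card by (rule of_nat_mono)
  finally show ?thesis by simp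
qed

lemma finite_lattice_points:
  fixes S :: "'a::euclidean_space set"
  assumes "bounded S"
  shows "finite (lattice_point s ` S)"
proof -
  obtain r where r: "\<And>x. x \<in> S \<Longrightarrow> norm x \<le> r" using assms by (auto simp: bounded_iff)
  let ?f = "\<lambda>k. \<lambda>b\<in>Basis. \<lfloor>lattice_point s 0 \<bullet> b - k \<bullet> b\<rfloor>"
  let ?T = "\<Pi>\<^sub>E b\<in>(Basis::'a set). {- \<lceil>\<bar>s\<bar> * r\<rceil> - 1..\<lceil>\<bar>s\<bar> * r\<rceil> + 1}"
  have "?f (lattice_point s x) \<in> ?T" if x: "x \<in> S" for x
  proof (subst restrict_PiE_iff, rule)
    fix b :: 'a assume b: "b \<in> Basis"
    have "\<bar>s * (x \<bullet> b)\<bar> \<le> \<bar>s\<bar> * r"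
      using Basis_le_norm[OF b, of x] r[OF x] by (simp add: abs_mult mult_left_mono)
    then have "- \<lfloor>s * (x \<bullet> b)\<rfloor> \<in> {- \<lceil>\<bar>s\<bar> * r\<rceil> - 1..\<lceil>\<bar>s\<bar> * r\<rceil> + 1}"
      unfolding atLeastAtMost_iff by linarith
    moreover have "lattice_point s 0 \<bullet> b - lattice_point s x \<bullet> b = real_of_int (- \<lfloor>s * (x \<bullet> b)\<rfloor>)"
      using b by (simp add: lattice_point_inner)
    ultimately show "\<lfloor>lattice_point s 0 \<bullet> b - lattice_point s x \<bullet> b\<rfloor> \<in> {- \<lceil>\<bar>s\<bar> * r\<rceil> - 1..\<lceil>\<bar>s\<bar> * r\<rceil> + 1}"
      by (simp only: floor_of_int)
  qed
  then have "?f ` (lattice_point s ` S) \<subseteq> ?T" by blast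
  then have "finite (?f ` (lattice_point s ` S))"
    by (rule finite_subset) (intro finite_PiE finite_Basis finite_atLeastAtMost_int)
  moreover have "inj_on ?f (lattice_point s ` S)"
    by (rule inj_on_subset[OF inj_on_lattice_difference[of _ s]]) auto
  ultimately show ?thesis by (rule finite_imageD)
qed

text \<open>Here \<open>e\<close> is the reciprocal of the exponent, and \<open>e = 0\<close> stands for \<open>L^\<infinity>\<close>.\<close>

definition Lp_bounded :: "real \<Rightarrow> real \<Rightarrow> ('a::euclidean_space \<Rightarrow> complex) \<Rightarrow> bool" where
  "Lp_bounded e \<nu> F \<longleftrightarrow> (if e = 0 then AE x in lborel. norm (F x) \<le> \<nu>
     else (\<integral>\<^sup>+x. ennreal (norm (F x) powr (1 / e)) \<partial>lborel) \<le> ennreal (\<nu> powr (1 / e)))"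

definition cell_cut :: "real \<Rightarrow> 'a::euclidean_space \<Rightarrow> ('a \<Rightarrow> complex) \<Rightarrow> 'a \<Rightarrow> complex" where
  "cell_cut s k F x = indicator (cell_neighborhood s k) x *\<^sub>R F x"

text \<open>Adding \<open>\<nu>^p / card K\<close> to the mass of each cell keeps all weights positive, which the weighted AM-GM inequality needs.\<close>

lemma cell_profile:
  fixes F :: "'a::euclidean_space \<Rightarrow> complex"
  assumes F[measurable]: "F \<in> borel_measurable borel" and e: "0 \<le> e" "e \<le> 1 / 2" and \<nu>: "\<nu> > 0"
    and bd: "Lp_bounded e \<nu> F" and s: "s > 0" and K: "finite K" "K \<subseteq> range (lattice_point s)"
  shows "\<exists>\<beta>. (\<forall>k\<in>K. 0 < \<beta> k \<and> l2norm (cell_cut s k F) \<le> ((3 / s) ^ DIM('a)) powr (1 / 2 - e) * \<nu> * \<beta> k) \<and>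
     (if e = 0 then \<forall>k\<in>K. \<beta> k \<le> 1 else (\<Sum>k\<in>K. \<beta> k powr (1 / e)) \<le> 3 ^ DIM('a) + 1)"
proof -
  let ?V = "(3 / s) ^ DIM('a)"
  have V: "?V > 0" using s by simp
  show ?thesis
  proof (cases "e = 0")
    case True
    have "l2norm (cell_cut s k F) \<le> ?V powr (1 / 2) * \<nu>" for k
    proof (rule l2norm_le)
      have "sq_integral (cell_cut s k F) \<le> (\<integral>\<^sup>+x. ennreal (\<nu>\<^sup>2) * indicator (cell_neighborhood s k) x \<partial>lborel)"
        unfolding sq_integral_def cell_cut_def
      proof (rule nn_integral_mono_AE)
        have "AE x in lborel. norm (F x) \<le> \<nu>" using bd True by (simp add: Lp_bounded_def)
        then show "AE x in lborel. ennreal ((norm (indicator (cell_neighborhood s k) x *\<^sub>R F x))\<^sup>2)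
            \<le> ennreal (\<nu>\<^sup>2) * indicator (cell_neighborhood s k) x"
          by eventually_elim (auto split: split_indicator intro!: ennreal_leI power_mono)
      qed
      also have "\<dots> = ennreal (\<nu>\<^sup>2) * emeasure lborel (cell_neighborhood s k)"
        by (simp add: nn_integral_cmult)
      also have "\<dots> \<le> ennreal (\<nu>\<^sup>2) * ennreal ?V"
        by (intro mult_left_mono emeasure_cell_neighborhood s) auto
      also have "\<dots> = ennreal ((?V powr (1 / 2) * \<nu>)\<^sup>2)"
        using V by (simp add: ennreal_mult[symmetric] power_mult_distrib powr_half_sqrt mult.commute)
      finally show "sq_integral (cell_cut s k F) \<le> ennreal ((?V powr (1 / 2) * \<nu>)\<^sup>2)" .
    qed (use \<nu> in auto)
    \<comment> \<open>In the case of L^infinity one bound serves all cubes, hence the constant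
      profile 1 without summability.\<close>
    then show ?thesis using True by (intro exI[of _ "\<lambda>_. 1"]) simp
  next
    case False
    then have e0: "e > 0" using e by simp
    define p where "p = 1 / e"
    have p: "p \<ge> 2" "1 / p = e" using e e0 by (auto simp: p_def field_simps)
    let ?A = "\<lambda>k. \<integral>\<^sup>+x. indicator (cell_neighborhood s k) x * ennreal (norm (F x) powr p) \<partial>lborel"
    have int: "(\<integral>\<^sup>+x. ennreal (norm (F x) powr p) \<partial>lborel) \<le> ennreal (\<nu> powr p)"
      using bd False by (simp add: Lp_bounded_def p_def)
    have A_le: "?A k \<le> ennreal (\<nu> powr p)" for k
      by (rule order_trans[OF nn_integral_mono int]) (auto split: split_indicator)
    then have A_fin: "?A k < \<infinity>" for k
      by (rule le_less_trans) simp
    have "(\<Sum>k\<in>K. ?A k) = (\<integral>\<^sup>+x. (\<Sum>k\<in>K. indicator (cell_neighborhood s k) x) * ennreal (norm (F x) powr p) \<partial>lborel)"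
      by (subst nn_integral_sum[symmetric]) (auto simp: sum_distrib_right)
    also have "\<dots> \<le> (\<integral>\<^sup>+x. 3 ^ DIM('a) * ennreal (norm (F x) powr p) \<partial>lborel)"
      by (intro nn_integral_mono mult_right_mono sum_indicator_cell_neighborhood K) auto
    also have "\<dots> = 3 ^ DIM('a) * (\<integral>\<^sup>+x. ennreal (norm (F x) powr p) \<partial>lborel)"
      by (simp add: nn_integral_cmult)
    also have "\<dots> \<le> 3 ^ DIM('a) * ennreal (\<nu> powr p)"
      by (intro mult_left_mono int) auto
    also have "\<dots> = ennreal (3 ^ DIM('a) * \<nu> powr p)"
      by (simp add: ennreal_mult ennreal_power[symmetric])
    finally have sumA: "(\<Sum>k\<in>K. ?A k) \<le> ennreal (3 ^ DIM('a) * \<nu> powr p)" .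
    have "(\<Sum>k\<in>K. ?A k) = ennreal (\<Sum>k\<in>K. enn2real (?A k))"
      using A_fin by (subst sum_ennreal[symmetric]) (auto simp: less_top)
    with sumA have sumA': "(\<Sum>k\<in>K. enn2real (?A k)) \<le> 3 ^ DIM('a) * \<nu> powr p" by simp
    define X where "X k = enn2real (?A k) + \<nu> powr p / real (card K)" for k
    \<comment> \<open>Normalized by \<open>\<nu>\<close>, so that the powers of exponent p sum to at
      most 3^n + 1: the overlap of the neighborhoods gives 3^n, the added masses give 1.\<close>
    define \<beta> where "\<beta> k = X k powr e / \<nu>" for k
    have X: "X k > 0" if "k \<in> K" for k
    proof -
      have "card K > 0" using that K by (auto simp: card_gt_0_iff)
      then show ?thesis unfolding X_def using \<nu> by (intro add_nonneg_pos divide_pos_pos) auto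
    qed
    have "0 < \<beta> k \<and> l2norm (cell_cut s k F) \<le> ?V powr (1 / 2 - e) * \<nu> * \<beta> k" if k: "k \<in> K" for k
    proof
      show "0 < \<beta> k" using X[OF k] \<nu> by (simp add: \<beta>_def)
      have "?A k = ennreal (enn2real (?A k))" using A_fin[of k] by (simp add: less_top)
      also have "\<dots> \<le> ennreal (X k)" by (intro ennreal_leI) (simp add: X_def)
      finally have AX: "?A k \<le> ennreal (X k)" .
      have "sq_integral (cell_cut s k F) \<le> ennreal ((?V powr (1 / 2 - 1 / p) * X k powr (1 / p))\<^sup>2)"
        unfolding cell_cut_def[abs_def]
        by (intro sq_integral_indicator_le emeasure_cell_neighborhood s V p AX X[OF k]) measurable
      then have "l2norm (cell_cut s k F) \<le> ?V powr (1 / 2 - 1 / p) * X k powr (1 / p)"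
        by (rule l2norm_le) simp
      then show "l2norm (cell_cut s k F) \<le> ?V powr (1 / 2 - e) * \<nu> * \<beta> k"
        using \<nu> by (simp add: p \<beta>_def)
    qed
    moreover have "(\<Sum>k\<in>K. \<beta> k powr (1 / e)) \<le> 3 ^ DIM('a) + 1"
    proof -
      have "\<beta> k powr (1 / e) = X k / \<nu> powr p" if "k \<in> K" for k
        using X[OF that] \<nu> e0 by (simp add: \<beta>_def powr_divide powr_powr p_def)
      then have "(\<Sum>k\<in>K. \<beta> k powr (1 / e)) = (\<Sum>k\<in>K. X k) / \<nu> powr p"
        by (simp add: sum_divide_distrib)
      also have "\<dots> \<le> (3 ^ DIM('a) * \<nu> powr p + \<nu> powr p) / \<nu> powr p"
      proof (rule divide_right_mono)
        show "(\<Sum>k\<in>K. X k) \<le> 3 ^ DIM('a) * \<nu> powr p + \<nu> powr p"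
          unfolding X_def sum.distrib using sumA' \<nu> by (intro add_mono) (auto simp: card_gt_0_iff)
      qed simp
      also have "\<dots> = 3 ^ DIM('a) + 1" using \<nu> by (simp add: add_divide_distrib)
      finally show ?thesis .
    qed
    ultimately show ?thesis using False by auto
  qed
qed

text \<open>Hoelder for three sequences, from weighted AM-GM term by term.\<close>

lemma sum_prod3_le:
  fixes \<beta>1 \<beta>2 \<beta>3 :: "'k \<Rightarrow> real"
  assumes K: "finite K" and e: "0 \<le> e1" "0 \<le> e2" "0 \<le> e3" "e1 + e2 + e3 = 1" and Y: "Y \<ge> 0"
    and pos: "\<And>k. k \<in> K \<Longrightarrow> 0 < \<beta>1 k" "\<And>k. k \<in> K \<Longrightarrow> 0 < \<beta>2 k" "\<And>k. k \<in> K \<Longrightarrow> 0 < \<beta>3 k"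
    and \<beta>: "if e1 = 0 then \<forall>k\<in>K. \<beta>1 k \<le> 1 else (\<Sum>k\<in>K. \<beta>1 k powr (1 / e1)) \<le> Y"
      "if e2 = 0 then \<forall>k\<in>K. \<beta>2 k \<le> 1 else (\<Sum>k\<in>K. \<beta>2 k powr (1 / e2)) \<le> Y"
      "if e3 = 0 then \<forall>k\<in>K. \<beta>3 k \<le> 1 else (\<Sum>k\<in>K. \<beta>3 k powr (1 / e3)) \<le> Y"
  shows "(\<Sum>k\<in>K. \<beta>1 k * \<beta>2 k * \<beta>3 k) \<le> Y"
proof -
  \<comment> \<open>For \<open>e = 0\<close> the value 1 encodes the sup bound: its power 0 still
    majorizes \<open>\<beta> k\<close>, and the weight \<open>e\<close> removes it from the final
    sum.\<close>
  define y where "y e \<beta> k = (if e = 0 then 1 else \<beta> k powr (1 / e))" for e :: real and \<beta> :: "'k \<Rightarrow> real" and k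
  have y: "y e \<beta> k > 0" "\<beta> k \<le> y e \<beta> k powr e"
    if "\<beta> k > 0" "0 \<le> e" "k \<in> K" "if e = 0 then \<forall>k\<in>K. \<beta> k \<le> 1 else (\<Sum>k\<in>K. \<beta> k powr (1 / e)) \<le> Y" for e \<beta> k
    using that by (auto simp: y_def powr_powr split: if_splits)
  have sum: "e * (\<Sum>k\<in>K. y e \<beta> k) \<le> e * Y"
    if "0 \<le> e" "if e = 0 then \<forall>k\<in>K. \<beta> k \<le> 1 else (\<Sum>k\<in>K. \<beta> k powr (1 / e)) \<le> Y" for e \<beta>
    using that by (auto simp: y_def split: if_splits)
  have "(\<Sum>k\<in>K. \<beta>1 k * \<beta>2 k * \<beta>3 k) \<le> (\<Sum>k\<in>K. e1 * y e1 \<beta>1 k + e2 * y e2 \<beta>2 k + e3 * y e3 \<beta>3 k)"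
  proof (rule sum_mono)
    fix k assume k: "k \<in> K"
    have "\<beta>1 k * \<beta>2 k * \<beta>3 k \<le> y e1 \<beta>1 k powr e1 * y e2 \<beta>2 k powr e2 * y e3 \<beta>3 k powr e3"
      using pos[OF k] k e \<beta> by (intro mult_mono y mult_nonneg_nonneg) (auto intro: less_imp_le)
    also have "\<dots> \<le> e1 * y e1 \<beta>1 k + e2 * y e2 \<beta>2 k + e3 * y e3 \<beta>3 k"
      using pos[OF k] k e \<beta> by (intro weighted_am_gm3 y) auto
    finally show "\<beta>1 k * \<beta>2 k * \<beta>3 k \<le> e1 * y e1 \<beta>1 k + e2 * y e2 \<beta>2 k + e3 * y e3 \<beta>3 k" .
  qed
  also have "\<dots> = e1 * (\<Sum>k\<in>K. y e1 \<beta>1 k) + e2 * (\<Sum>k\<in>K. y e2 \<beta>2 k) + e3 * (\<Sum>k\<in>K. y e3 \<beta>3 k)"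
    by (simp add: sum.distrib sum_distrib_left)
  also have "\<dots> \<le> e1 * Y + e2 * Y + e3 * Y"
    by (intro add_mono sum e \<beta>)
  also have "\<dots> = Y" using e by (simp flip: distrib_right)
  finally show ?thesis .
qed

lemma cut_in_L1_L2:
  fixes F :: "'a::euclidean_space \<Rightarrow> complex"
  assumes F: "F \<in> L1_L2" and [measurable]: "A \<in> sets borel"
  shows "(\<lambda>x. indicator A x *\<^sub>R F x) \<in> L1_L2"
proof -
  have "sq_integral (\<lambda>x. indicator A x *\<^sub>R F x) \<le> sq_integral F"
    unfolding sq_integral_def by (intro nn_integral_mono ennreal_leI power_mono) (auto split: split_indicator)
  then show ?thesis
    using F integrable_mult_indicator[of A lborel F] by (auto simp: L1_L2_def intro: le_less_trans)
qed

text \<open>Stated for an abstract functional because it is applied both to the approximating form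
  at scale 1 and to the difference of two consecutive approximations.\<close>

lemma local_functional_bound:
  fixes D :: "('a::euclidean_space \<Rightarrow> complex) \<Rightarrow> ('a \<Rightarrow> complex) \<Rightarrow> ('a \<Rightarrow> complex) \<Rightarrow> complex"
  assumes bd: "\<And>F G H. F \<in> L1_L2 \<Longrightarrow> G \<in> L1_L2 \<Longrightarrow> H \<in> L1_L2 \<Longrightarrow> norm (D F G H) \<le> B * (l2norm F * l2norm G * l2norm H)"
    and loc: "\<And>F F' G G' H. F \<in> L1_L2 \<Longrightarrow> F' \<in> L1_L2 \<Longrightarrow> G \<in> L1_L2 \<Longrightarrow> G' \<in> L1_L2 \<Longrightarrow> H \<in> L1_L2 \<Longrightarrow>
       (\<And>x y. H x \<noteq> 0 \<Longrightarrow> near s x y \<Longrightarrow> F y = F' y) \<Longrightarrow> (\<And>x y. H x \<noteq> 0 \<Longrightarrow> near s x y \<Longrightarrow> G y = G' y) \<Longrightarrow>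
       D F G H = D F' G' H"
    and add: "\<And>F G I (H :: 'a \<Rightarrow> 'a \<Rightarrow> complex). F \<in> L1_L2 \<Longrightarrow> G \<in> L1_L2 \<Longrightarrow> (\<And>k. k \<in> I \<Longrightarrow> H k \<in> L1_L2) \<Longrightarrow>
       D F G (\<lambda>x. \<Sum>k\<in>I. H k x) = (\<Sum>k\<in>I. D F G (H k))"
    and B: "B \<ge> 0" and s: "s > 0"
    and F: "F \<in> L1_L2" and G: "G \<in> L1_L2" and H: "H \<in> L1_L2" and supp: "bounded {x. H x \<noteq> 0}"
    and e: "0 \<le> e1" "0 \<le> e2" "0 \<le> e3" "e1 \<le> 1 / 2" "e2 \<le> 1 / 2" "e3 \<le> 1 / 2" "e1 + e2 + e3 = 1"
    and \<nu>: "\<nu>1 > 0" "\<nu>2 > 0" "\<nu>3 > 0"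
    and Lp: "Lp_bounded e1 \<nu>1 F" "Lp_bounded e2 \<nu>2 G" "Lp_bounded e3 \<nu>3 H"
  shows "norm (D F G H) \<le> B * ((3 / s) ^ DIM('a)) powr (1 / 2) * (3 ^ DIM('a) + 1) * (\<nu>1 * \<nu>2 * \<nu>3)"
proof -
  let ?V = "(3 / s) ^ DIM('a)"
  have V: "?V > 0" using s by simp
  define K where "K = lattice_point s ` {x. H x \<noteq> 0}"
  have K: "finite K" "K \<subseteq> range (lattice_point s)"
    using finite_lattice_points[OF supp] by (auto simp: K_def)
  \<comment> \<open>\<open>H\<close> is cut along disjoint cubes, so that the pieces add up to it
    exactly; \<open>F\<close> and \<open>G\<close> are cut to the overlapping neighborhoods, which
    contain all that a piece of \<open>H\<close> can see.\<close>
  define Hk where "Hk k x = indicator {x. lattice_point s x = k} x *\<^sub>R H x" for k x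
  have [measurable]: "{x. lattice_point s x = k} \<in> sets borel" for k :: 'a
  proof -
    have "{x \<in> space borel. lattice_point s x = k} \<in> sets borel" by measurable
    then show ?thesis by simp
  qed
  have Hk: "Hk k \<in> L1_L2" for k
    unfolding Hk_def[abs_def] by (rule cut_in_L1_L2[OF H]) measurable
  have cut: "cell_cut s k F \<in> L1_L2" if "F \<in> L1_L2" for k F
    unfolding cell_cut_def[abs_def] by (rule cut_in_L1_L2[OF that]) measurable
  have Hsum: "H = (\<lambda>x. \<Sum>k\<in>K. Hk k x)"
  proof
    fix x
    have "(\<Sum>k\<in>K. Hk k x) = (\<Sum>k\<in>K. if k = lattice_point s x then H x else 0)"
      by (intro sum.cong) (auto simp: Hk_def indicator_def)
    also have "\<dots> = H x" using K(1) by (auto simp: K_def)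
    finally show "H x = (\<Sum>k\<in>K. Hk k x)" by simp
  qed
  obtain \<beta>1 where \<beta>1: "\<And>k. k \<in> K \<Longrightarrow> 0 < \<beta>1 k" "\<And>k. k \<in> K \<Longrightarrow> l2norm (cell_cut s k F) \<le> ?V powr (1 / 2 - e1) * \<nu>1 * \<beta>1 k"
    "if e1 = 0 then \<forall>k\<in>K. \<beta>1 k \<le> 1 else (\<Sum>k\<in>K. \<beta>1 k powr (1 / e1)) \<le> 3 ^ DIM('a) + 1"
    using cell_profile[OF L1_L2_measurable[OF F] e(1,4) \<nu>(1) Lp(1) s K] by blast
  obtain \<beta>2 where \<beta>2: "\<And>k. k \<in> K \<Longrightarrow> 0 < \<beta>2 k" "\<And>k. k \<in> K \<Longrightarrow> l2norm (cell_cut s k G) \<le> ?V powr (1 / 2 - e2) * \<nu>2 * \<beta>2 k"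
    "if e2 = 0 then \<forall>k\<in>K. \<beta>2 k \<le> 1 else (\<Sum>k\<in>K. \<beta>2 k powr (1 / e2)) \<le> 3 ^ DIM('a) + 1"
    using cell_profile[OF L1_L2_measurable[OF G] e(2,5) \<nu>(2) Lp(2) s K] by blast
  obtain \<beta>3 where \<beta>3: "\<And>k. k \<in> K \<Longrightarrow> 0 < \<beta>3 k" "\<And>k. k \<in> K \<Longrightarrow> l2norm (cell_cut s k H) \<le> ?V powr (1 / 2 - e3) * \<nu>3 * \<beta>3 k"
    "if e3 = 0 then \<forall>k\<in>K. \<beta>3 k \<le> 1 else (\<Sum>k\<in>K. \<beta>3 k powr (1 / e3)) \<le> 3 ^ DIM('a) + 1"
    using cell_profile[OF L1_L2_measurable[OF H] e(3,6) \<nu>(3) Lp(3) s K] by blast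
  have each: "norm (D F G (Hk k)) \<le> B * (?V powr (1 / 2) * (\<nu>1 * \<nu>2 * \<nu>3)) * (\<beta>1 k * \<beta>2 k * \<beta>3 k)" if k: "k \<in> K" for k
  proof -
    have near: "y \<in> cell_neighborhood s k" if "Hk k x \<noteq> 0" "near s x y" for x y
      using near_imp_cell_neighborhood[OF that(2)] that(1) by (auto simp: Hk_def indicator_def split: if_splits)
    have "D F G (Hk k) = D (cell_cut s k F) (cell_cut s k G) (Hk k)"
      by (rule loc) (use near F G Hk cut in \<open>auto simp: cell_cut_def\<close>)
    then have "norm (D F G (Hk k)) \<le> B * (l2norm (cell_cut s k F) * l2norm (cell_cut s k G) * l2norm (Hk k))"
      using bd[OF cut[OF F] cut[OF G] Hk] by simp
    also have "\<dots> \<le> B * ((?V powr (1 / 2 - e1) * \<nu>1 * \<beta>1 k) * (?V powr (1 / 2 - e2) * \<nu>2 * \<beta>2 k) * (?V powr (1 / 2 - e3) * \<nu>3 * \<beta>3 k))"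
    proof -
      \<comment> \<open>Enlarging the cube to its neighborhood lets \<open>cell_profile\<close>
        serve for \<open>H\<close> as well.\<close>
      have "l2norm (Hk k) \<le> l2norm (cell_cut s k H)"
        using cut[OF H, of k] lattice_point_self[of _ s]
        by (intro l2norm_mono) (auto simp: Hk_def cell_cut_def L1_L2_def split: split_indicator)
      then have "l2norm (Hk k) \<le> ?V powr (1 / 2 - e3) * \<nu>3 * \<beta>3 k" using \<beta>3(2)[OF k] by simp
      then show ?thesis
        using \<beta>1(1,2)[OF k] \<beta>2(1,2)[OF k] \<beta>3(1)[OF k] \<nu> V B
        by (intro mult_left_mono mult_mono mult_nonneg_nonneg) (auto intro: less_imp_le)
    qed
    also have "\<dots> = B * ((?V powr (1 / 2 - e1) * ?V powr (1 / 2 - e2) * ?V powr (1 / 2 - e3)) * (\<nu>1 * \<nu>2 * \<nu>3)) * (\<beta>1 k * \<beta>2 k * \<beta>3 k)"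
      by (simp only: mult_ac)
    also have "?V powr (1 / 2 - e1) * ?V powr (1 / 2 - e2) * ?V powr (1 / 2 - e3) = ?V powr (1 / 2)"
    proof -
      have "1 / 2 - e1 + (1 / 2 - e2) + (1 / 2 - e3) = 1 / 2" using e by simp
      then show ?thesis by (simp only: powr_add[symmetric])
    qed
    finally show ?thesis .
  qed
  have "norm (D F G H) = norm (\<Sum>k\<in>K. D F G (Hk k))"
    by (subst Hsum) (simp add: add[OF F G Hk])
  also have "\<dots> \<le> (\<Sum>k\<in>K. norm (D F G (Hk k)))" by (rule norm_sum)
  also have "\<dots> \<le> (\<Sum>k\<in>K. B * (?V powr (1 / 2) * (\<nu>1 * \<nu>2 * \<nu>3)) * (\<beta>1 k * \<beta>2 k * \<beta>3 k))"
    by (rule sum_mono[OF each])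
  also have "\<dots> = B * (?V powr (1 / 2) * (\<nu>1 * \<nu>2 * \<nu>3)) * (\<Sum>k\<in>K. \<beta>1 k * \<beta>2 k * \<beta>3 k)"
    by (simp add: sum_distrib_left)
  also have "\<dots> \<le> B * (?V powr (1 / 2) * (\<nu>1 * \<nu>2 * \<nu>3)) * (3 ^ DIM('a) + 1)"
    using B \<nu> by (intro mult_left_mono sum_prod3_le[OF K(1) e(1,2,3,7) _ \<beta>1(1) \<beta>2(1) \<beta>3(1) \<beta>1(3) \<beta>2(3) \<beta>3(3)]) auto
  finally show ?thesis by (simp add: mult_ac)
qed

section \<open>Summation over the scales\<close>

definition power_integral :: "real \<Rightarrow> ('a::euclidean_space \<Rightarrow> complex) \<Rightarrow> ennreal" where
  "power_integral q g = (\<integral>\<^sup>+z. ennreal (norm (g z) powr q) \<partial>lborel)"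

text \<open>Of the four powers, \<open>4 - q\<close> are taken out in sup norm and \<open>q\<close>
  stay in the integral; for differences of \<open>m\<close> only the former become small.\<close>

lemma quartic_integral_le:
  assumes [measurable]: "g \<in> borel_measurable borel" and c: "\<And>z. norm (g z) \<le> c" and q: "q < 4"
  shows "quartic_integral g \<le> ennreal (c powr (4 - q)) * power_integral q g"
proof -
  have "quartic_integral g \<le> (\<integral>\<^sup>+z. ennreal (c powr (4 - q)) * ennreal (norm (g z) powr q) \<partial>lborel)"
    unfolding quartic_integral_def
  proof (intro nn_integral_mono)
    fix z
    have "norm (g z) ^ 4 \<le> c powr (4 - q) * norm (g z) powr q"
    proof (cases "g z = 0")
      case False
      then have "norm (g z) ^ 4 = norm (g z) powr (4 - q) * norm (g z) powr q"
        by (simp add: powr_add[symmetric])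
      also have "\<dots> \<le> c powr (4 - q) * norm (g z) powr q"
        using c q by (intro mult_right_mono powr_mono2) auto
      finally show ?thesis .
    qed simp
    then show "ennreal (norm (g z) ^ 4) \<le> ennreal (c powr (4 - q)) * ennreal (norm (g z) powr q)"
      by (simp add: ennreal_mult[symmetric])
  qed
  then show ?thesis by (simp add: nn_integral_cmult power_integral_def)
qed

text \<open>Translation invariance makes the constant independent of the step \<open>y\<close>, so
  all gain in \<open>y\<close> has to come from the sup norm.\<close>

lemma power_integral_fdiff_le:
  fixes g :: "'a::euclidean_space \<Rightarrow> complex"
  assumes "g \<in> borel_measurable borel" and q: "1 \<le> q"
  shows "power_integral q (fdiff k y g) \<le> ennreal (2 * 2 powr q) ^ k * power_integral q g"
  using assms(1)
proof (induction k arbitrary: g)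
  case (Suc k)
  note [measurable] = Suc.prems
  have "power_integral q (fdiff (Suc k) y g) \<le> ennreal (2 * 2 powr q) ^ k * power_integral q (\<lambda>x. g (x + y) - g x)"
    unfolding fdiff.simps by (rule Suc.IH) measurable
  also have "\<dots> \<le> ennreal (2 * 2 powr q) ^ k * (ennreal (2 * 2 powr q) * power_integral q g)"
  proof (rule mult_left_mono)
    have "power_integral q (\<lambda>x. g (x + y) - g x)
       \<le> (\<integral>\<^sup>+x. ennreal (2 powr q) * ennreal (norm (g (y + x)) powr q) + ennreal (2 powr q) * ennreal (norm (g x) powr q) \<partial>lborel)"
      unfolding power_integral_def
    proof (intro nn_integral_mono)
      fix x
      define a b where "a = norm (g (y + x))" and "b = norm (g x)"
      have ab: "0 \<le> a" "0 \<le> b" by (auto simp: a_def b_def)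
      have "norm (g (x + y) - g x) \<le> a + b"
        unfolding a_def b_def by (metis add.commute norm_triangle_ineq4)
      also have "\<dots> \<le> 2 * max a b" by simp
      finally have "norm (g (x + y) - g x) powr q \<le> (2 * max a b) powr q"
        using q by (intro powr_mono2) auto
      also have "\<dots> = 2 powr q * max a b powr q" using ab by (simp add: powr_mult)
      also have "\<dots> \<le> 2 powr q * (a powr q + b powr q)"
        by (intro mult_left_mono) (auto simp: max_def)
      finally have "norm (g (x + y) - g x) powr q \<le> 2 powr q * a powr q + 2 powr q * b powr q"
        by (simp add: distrib_left)
      then have "ennreal (norm (g (x + y) - g x) powr q) \<le> ennreal (2 powr q * a powr q + 2 powr q * b powr q)"
        by (rule ennreal_leI)
      then show "ennreal (norm (g (x + y) - g x) powr q) \<le> ennreal (2 powr q) * ennreal (norm (g (y + x)) powr q) + ennreal (2 powr q) * ennreal (norm (g x) powr q)"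
        by (simp add: ennreal_mult a_def b_def)
    qed
    also have "\<dots> = ennreal (2 powr q) * (\<integral>\<^sup>+x. ennreal (norm (g (y + x)) powr q) \<partial>lborel) + ennreal (2 powr q) * power_integral q g"
      by (simp add: nn_integral_add nn_integral_cmult power_integral_def)
    also have "(\<integral>\<^sup>+x. ennreal (norm (g (y + x)) powr q) \<partial>lborel) = power_integral q g"
      unfolding power_integral_def by (rule nn_integral_lborel_translate) measurable
    also have "ennreal (2 powr q) * power_integral q g + ennreal (2 powr q) * power_integral q g = ennreal (2 * 2 powr q) * power_integral q g"
      by (simp add: distrib_right[symmetric] ennreal_plus[symmetric] del: ennreal_plus)
    finally show "power_integral q (\<lambda>x. g (x + y) - g x) \<le> ennreal (2 * 2 powr q) * power_integral q g" .
  qed simp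
  finally show ?case by (simp add: mult_ac)
qed simp

lemma powr_quarter: "x \<ge> 0 \<Longrightarrow> (x powr (1 / 4)) ^ 4 = (x::real)"
  by (cases "x = 0") (simp_all add: powr_powr flip: powr_realpow)

text \<open>One constant \<open>A\<close>, chosen before the functions and the exponents, is
  possible because the total cost of Hoelder on a cube does not depend on how the three exponents
  share it.\<close>

theorem trilinear_form_bound:
  fixes m :: "'a::euclidean_space \<times> 'a \<Rightarrow> complex"
  assumes q: "1 \<le> q" "q < 4" and M: "real M > 2 * real DIM('a) / (4 - q)"
    and m: "m \<in> C_class M"
    and C: "\<And>\<alpha> z. multiindex \<alpha> \<Longrightarrow> length \<alpha> \<le> M \<Longrightarrow> norm (iter_partial \<alpha> m z) \<le> C"
    and int: "power_integral q m < \<infinity>"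
  obtains A where "A \<ge> 0" and "\<And>F G H e1 e2 e3 \<nu>1 \<nu>2 \<nu>3. F \<in> L1_L2 \<Longrightarrow> G \<in> L1_L2 \<Longrightarrow> H \<in> L1_L2 \<Longrightarrow> bounded {x. H x \<noteq> 0} \<Longrightarrow>
      0 \<le> e1 \<Longrightarrow> 0 \<le> e2 \<Longrightarrow> 0 \<le> e3 \<Longrightarrow> e1 \<le> 1 / 2 \<Longrightarrow> e2 \<le> 1 / 2 \<Longrightarrow> e3 \<le> 1 / 2 \<Longrightarrow> e1 + e2 + e3 = 1 \<Longrightarrow>
      \<nu>1 > 0 \<Longrightarrow> \<nu>2 > 0 \<Longrightarrow> \<nu>3 > 0 \<Longrightarrow> Lp_bounded e1 \<nu>1 F \<Longrightarrow> Lp_bounded e2 \<nu>2 G \<Longrightarrow> Lp_bounded e3 \<nu>3 H \<Longrightarrow>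
      norm (shifted_form m F G H 0) \<le> A * (\<nu>1 * \<nu>2 * \<nu>3)"
proof -
  have M1: "M \<ge> 1"
  proof (rule ccontr)
    assume "\<not> M \<ge> 1"
    moreover have "2 * real DIM('a) / (4 - q) \<ge> 0" using q by simp
    ultimately show False using M by simp
  qed
  have C0: "C \<ge> 0" using C[of "[]" 0] by (simp add: multiindex_def order_trans[OF norm_ge_zero])
  obtain v where v: "\<forall>t. v t \<ge> 0" "integrable lborel (\<lambda>t. v t * (1 + \<bar>t\<bar>) ^ M)" "integrable lborel v"
     "(LINT t|lborel. v t) = 1"
     "\<forall>u. \<bar>u\<bar> > 1 \<longrightarrow> (LINT t|lborel. cis (2 * pi * u * t) * complex_of_real (v t)) = 0"
    using band_limited_kernel_exists[of M] by blast
  interpret band_limited_kernel v M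
    using v by unfold_locales auto
  have "continuous_on UNIV m" using m by (auto simp: C_class_def multiindex_def dest!: spec[of _ "[]"])
  then have meas[measurable]: "m \<in> borel_measurable borel" by (rule borel_measurable_continuous_onI)
  define I where "I = enn2real (power_integral q m)"
  have I: "power_integral q m = ennreal I" "I \<ge> 0" using int by (auto simp: I_def less_top)
  define Q where "Q = (C powr (4 - q) * I) powr (1 / 4)"
  have Q: "quartic_integral m \<le> ennreal (Q ^ 4)" "Q \<ge> 0"
  proof -
    have "quartic_integral m \<le> ennreal (C powr (4 - q)) * power_integral q m"
      using C[of "[]"] q by (intro quartic_integral_le) (auto simp: multiindex_def)
    also have "\<dots> = ennreal (Q ^ 4)"
      using I by (simp add: Q_def powr_quarter ennreal_mult)
    finally show "quartic_integral m \<le> ennreal (Q ^ 4)" .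
  qed (simp add: Q_def)
  \<comment> \<open>The sup norm contributes \<open>l1_norm y ^ M\<close>,
    \<open>quartic_integral_le\<close> raises it to the power \<open>4 - q\<close>, and the L^4 norm
    takes a fourth root.\<close>
  define \<delta> where "\<delta> = real M * (4 - q) / 4"
  define n where "n = real DIM('a)"
  have \<delta>: "0 \<le> \<delta>" "\<delta> \<le> real M" "\<delta> > n / 2"
  proof -
    show "0 \<le> \<delta>" using q by (simp add: \<delta>_def)
    show "\<delta> \<le> real M" using q by (simp add: \<delta>_def algebra_simps mult_left_le)
    \<comment> \<open>This is the hypothesis on \<open>M\<close> rewritten: the gain 2^(-\<delta>)
      per scale beats the cost 2^(n/2) of doubling the cubes.\<close>
    show "\<delta> > n / 2" using M q by (simp add: \<delta>_def n_def field_simps)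
  qed
  define K where "K = (C powr (4 - q) * ((2 * 2 powr q) ^ M * I)) powr (1 / 4)"
  have K: "K \<ge> 0" by (simp add: K_def)
  have K4: "K ^ 4 = C powr (4 - q) * ((2 * 2 powr q) ^ M * I)"
    unfolding K_def using I by (intro powr_quarter) auto
  have diff: "quartic_integral (fdiff M y m) \<le> ennreal ((K * l1_norm y powr \<delta>) ^ 4)" for y :: "'a \<times> 'a"
  proof -
    have "quartic_integral (fdiff M y m) \<le> ennreal ((l1_norm y ^ M * C) powr (4 - q)) * power_integral q (fdiff M y m)"
    proof (rule quartic_integral_le[OF fdiff_measurable[OF meas] _ q(2)])
      show "norm (fdiff M y m z) \<le> l1_norm y ^ M * C" for z
        unfolding l1_norm_def by (rule norm_fdiff_le[OF m]) (use C in auto)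
    qed
    also have "\<dots> \<le> ennreal ((l1_norm y ^ M * C) powr (4 - q)) * (ennreal (2 * 2 powr q) ^ M * power_integral q m)"
      by (intro mult_left_mono power_integral_fdiff_le meas q) auto
    also have "\<dots> = ennreal ((l1_norm y ^ M * C) powr (4 - q) * ((2 * 2 powr q) ^ M * I))"
    proof -
      define c where "c = (2 * 2 powr q) ^ M"
      have c: "ennreal (2 * 2 powr q) ^ M = ennreal c" "c \<ge> 0"
        unfolding c_def by (rule ennreal_power) simp_all
      show ?thesis
        unfolding c_def[symmetric] c(1) I(1) using c(2) I(2) by (simp add: ennreal_mult)
    qed
    also have "(l1_norm y ^ M * C) powr (4 - q) * ((2 * 2 powr q) ^ M * I) = (K * l1_norm y powr \<delta>) ^ 4"
    proof -
      have "(l1_norm y ^ M) powr (4 - q) = (l1_norm y powr \<delta>) ^ 4"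
      proof (cases "l1_norm y = 0")
        case False
        then have l: "l1_norm y > 0" using l1_norm_nonneg[of y] by linarith
        have "(l1_norm y ^ M) powr (4 - q) = l1_norm y powr (real M * (4 - q))"
          using l by (simp add: powr_powr flip: powr_realpow)
        also have "real M * (4 - q) = \<delta> * real 4" by (simp add: \<delta>_def)
        also have "l1_norm y powr (\<delta> * real 4) = (l1_norm y powr \<delta>) powr real 4"
          by (simp only: powr_powr)
        also have "\<dots> = (l1_norm y powr \<delta>) ^ 4"
          using l by (intro powr_realpow) auto
        finally show ?thesis .
      \<comment> \<open>For \<open>l1_norm y = 0\<close> both sides vanish, because \<open>M\<close>
        is positive and \<open>0 powr \<delta>\<close> is 0.\<close>
      qed (use M1 in auto)
      then show ?thesis
        using C0 l1_norm_nonneg[of y] by (simp add: powr_mult power_mult_distrib K4)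
    qed
    finally show ?thesis .
  qed
  define E where "E = K * moment TYPE('a)"
  have E: "E \<ge> 0" using K moment_nonneg[where 'a='a] by (simp add: E_def)
  define s :: "nat \<Rightarrow> real" where "s j = (1 / 2) ^ j" for j
  have s: "s j > 0" "s 0 = 1" "s (Suc j) = s j / 2" for j by (auto simp: s_def)
  define r where "r = (1 / 2 :: real) powr \<delta>"
  have s_powr: "s j powr \<delta> = r ^ j" for j
  proof -
    have "s j powr \<delta> = (1 / 2) powr (real j * \<delta>)"
      by (simp add: s_def powr_powr flip: powr_realpow)
    also have "\<dots> = (r powr real j)" by (simp add: r_def powr_powr mult.commute)
    also have "\<dots> = r ^ j" by (rule powr_realpow) (simp add: r_def)
    finally show ?thesis .
  qed
  have n: "n \<ge> 1" by (simp add: n_def Suc_leI)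
  have r: "0 < r" "r < 1"
  proof -
    have "(2 :: real) powr \<delta> > 2 powr 0" using \<delta> n by (intro powr_less_mono) auto
    then show "0 < r" "r < 1" by (simp_all add: r_def powr_divide)
  qed
  have err: "norm (shifted_form m F G H 0 - approx_form (s j) m F G H) \<le> E * r ^ j * (l2norm F * l2norm G * l2norm H)"
    if "F \<in> L1_L2" "G \<in> L1_L2" "H \<in> L1_L2" for F G H j
    using approx_form_error[OF meas Q that K \<delta>(1,2) s(1)[of j] diff] by (simp add: E_def s_powr)
  define V where "V = (3 :: real) ^ DIM('a)"
  have V: "V > 0" by (simp add: V_def)
  \<comment> \<open>\<open>Q + E\<close> bounds the approximating form at scale 1: the form itself
    gives \<open>Q\<close> and the approximation error gives \<open>E\<close>.\<close>
  define A0 where "A0 = (Q + E) * V powr (1 / 2) * (V + 1)"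
  \<comment> \<open>The ratio of the geometric series: gain \<open>r\<close> in the error against
    loss 2^(n/2) in the volume factor.\<close>
  define \<rho> where "\<rho> = r * 2 powr (n / 2)"
  have \<rho>: "0 < \<rho>" "\<rho> < 1"
  proof -
    have "\<rho> = 2 powr (n / 2 - \<delta>)"
      by (simp add: \<rho>_def r_def powr_divide powr_diff)
    moreover have "(2 :: real) powr (n / 2 - \<delta>) < 2 powr 0"
      using \<delta>(3) by (intro powr_less_mono) auto
    ultimately show "0 < \<rho>" "\<rho> < 1" by simp_all
  qed
  \<comment> \<open>The factor 2 counts the two errors in a consecutive difference; the extra
    2^(n/2) arises because that difference is local only at the larger of the two spatial scales,
    \<open>1 / s (Suc j)\<close>.\<close>
  define A1 where "A1 = 2 * E * ((2 :: real) powr (n / 2) * V powr (1 / 2)) * (V + 1)"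
  have A: "A0 \<ge> 0" "A1 \<ge> 0" using E Q V by (auto simp: A0_def A1_def)
  show thesis
  proof (rule that[of "A0 + A1 / (1 - \<rho>)"])
    show "0 \<le> A0 + A1 / (1 - \<rho>)" using A \<rho> by simp
    fix F G H :: "'a \<Rightarrow> complex" and e1 e2 e3 \<nu>1 \<nu>2 \<nu>3 :: real
    assume F: "F \<in> L1_L2" and G: "G \<in> L1_L2" and H: "H \<in> L1_L2" and supp: "bounded {x. H x \<noteq> 0}"
      and e: "0 \<le> e1" "0 \<le> e2" "0 \<le> e3" "e1 \<le> 1 / 2" "e2 \<le> 1 / 2" "e3 \<le> 1 / 2" "e1 + e2 + e3 = 1"
      and \<nu>: "\<nu>1 > 0" "\<nu>2 > 0" "\<nu>3 > 0"
      and Lp: "Lp_bounded e1 \<nu>1 F" "Lp_bounded e2 \<nu>2 G" "Lp_bounded e3 \<nu>3 H"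
    let ?N = "\<nu>1 * \<nu>2 * \<nu>3" and ?L = "l2norm F * l2norm G * l2norm H"
    have N: "?N > 0" using \<nu> by simp
    have start: "norm (approx_form (s 0) m F G H) \<le> A0 * ?N"
    proof -
      have "norm (approx_form (s 0) m F G H) \<le> (Q + E) * ((3 / s 0) ^ DIM('a)) powr (1 / 2) * (3 ^ DIM('a) + 1) * ?N"
      proof (rule local_functional_bound[OF _ _ _ _ s(1) F G H supp e \<nu> Lp])
        fix F G H :: "'a \<Rightarrow> complex" assume FGH: "F \<in> L1_L2" "G \<in> L1_L2" "H \<in> L1_L2"
        have "norm (approx_form (s 0) m F G H) \<le> norm (shifted_form m F G H 0) + norm (shifted_form m F G H 0 - approx_form (s 0) m F G H)"
          by (metis norm_minus_commute norm_triangle_sub)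
        then show "norm (approx_form (s 0) m F G H) \<le> (Q + E) * (l2norm F * l2norm G * l2norm H)"
          using norm_shifted_form_le[OF meas Q FGH, of 0] err[OF FGH, of 0] by (simp add: distrib_right)
      qed (use Q E in \<open>auto intro: approx_form_local[OF meas Q] approx_form_sum[OF meas Q]\<close>)
      then show ?thesis by (simp add: s A0_def V_def)
    qed
    have step: "norm (approx_form (s (Suc j)) m F G H - approx_form (s j) m F G H) \<le> A1 * \<rho> ^ j * ?N" for j
    proof -
      have "norm (approx_form (s (Suc j)) m F G H - approx_form (s j) m F G H)
          \<le> (2 * E * r ^ j) * ((3 / s (Suc j)) ^ DIM('a)) powr (1 / 2) * (3 ^ DIM('a) + 1) * ?N"
      proof (rule local_functional_bound[OF _ _ _ _ s(1) F G H supp e \<nu> Lp])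
        fix F G H :: "'a \<Rightarrow> complex" assume FGH: "F \<in> L1_L2" "G \<in> L1_L2" "H \<in> L1_L2"
        let ?L = "l2norm F * l2norm G * l2norm H"
        have "norm (approx_form (s (Suc j)) m F G H - approx_form (s j) m F G H)
          \<le> norm (shifted_form m F G H 0 - approx_form (s j) m F G H) + norm (shifted_form m F G H 0 - approx_form (s (Suc j)) m F G H)"
          using norm_triangle_ineq4[of "shifted_form m F G H 0 - approx_form (s j) m F G H" "shifted_form m F G H 0 - approx_form (s (Suc j)) m F G H"]
          by simp
        also have "\<dots> \<le> E * r ^ j * ?L + E * r ^ Suc j * ?L"
          by (intro add_mono err FGH)
        also have "\<dots> \<le> E * r ^ j * ?L + E * r ^ j * ?L"
          using r E by (intro add_left_mono mult_right_mono mult_left_mono power_decreasing) auto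
        finally show "norm (approx_form (s (Suc j)) m F G H - approx_form (s j) m F G H) \<le> 2 * E * r ^ j * ?L" by (simp add: mult_ac)
      next
        fix F F' G G' H :: "'a \<Rightarrow> complex"
        assume FGH: "F \<in> L1_L2" "F' \<in> L1_L2" "G \<in> L1_L2" "G' \<in> L1_L2" "H \<in> L1_L2"
          and eq: "\<And>x y. H x \<noteq> 0 \<Longrightarrow> near (s (Suc j)) x y \<Longrightarrow> F y = F' y" "\<And>x y. H x \<noteq> 0 \<Longrightarrow> near (s (Suc j)) x y \<Longrightarrow> G y = G' y"
        \<comment> \<open>Neighborhoods grow with \<open>j\<close>, so a form that is local at
          \<open>s j\<close> is also local at \<open>s (Suc j)\<close>.\<close>
        have near: "near (s (Suc j)) x y" if "near (s j) x y" for x y :: 'a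
          using that s(1)[of j] by (elim near_mono) (simp add: s(3))
        have "approx_form (s (Suc j)) m F G H = approx_form (s (Suc j)) m F' G' H"
          by (rule approx_form_local[OF meas Q FGH]) (auto intro: eq)
        moreover have "approx_form (s j) m F G H = approx_form (s j) m F' G' H"
          by (rule approx_form_local[OF meas Q FGH]) (auto intro: eq near)
        ultimately show "approx_form (s (Suc j)) m F G H - approx_form (s j) m F G H = approx_form (s (Suc j)) m F' G' H - approx_form (s j) m F' G' H"
          by simp
      next
        fix F G :: "'a \<Rightarrow> complex" and I :: "'a set" and H :: "'a \<Rightarrow> 'a \<Rightarrow> complex"
        assume FG: "F \<in> L1_L2" "G \<in> L1_L2" and H: "\<And>k. k \<in> I \<Longrightarrow> H k \<in> L1_L2"
        show "approx_form (s (Suc j)) m F G (\<lambda>x. \<Sum>k\<in>I. H k x) - approx_form (s j) m F G (\<lambda>x. \<Sum>k\<in>I. H k x)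
           = (\<Sum>k\<in>I. approx_form (s (Suc j)) m F G (H k) - approx_form (s j) m F G (H k))"
          by (simp add: approx_form_sum[OF meas Q FG H] sum_subtractf)
      qed (use E r in auto)
      also have "((3 / s (Suc j)) ^ DIM('a)) powr (1 / 2) = (2 powr (n / 2) * V powr (1 / 2)) * (2 powr (n / 2)) ^ j"
      proof -
        have "(3 / s (Suc j)) ^ DIM('a) = V * 2 ^ DIM('a) * (2 ^ DIM('a)) ^ j"
          using power_mult_distrib[of 2 "3 :: real" "DIM('a)"]
          by (simp add: s_def V_def power_divide power_mult_distrib power_mult[symmetric] mult.commute)
        moreover have "(2 ^ DIM('a) :: real) powr (1 / 2) = 2 powr (n / 2)"
          by (simp add: n_def powr_powr flip: powr_realpow)
        moreover have "(((2 :: real) ^ DIM('a)) ^ j) powr (1 / 2) = ((2 ^ DIM('a)) powr (1 / 2)) ^ j"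
          by (simp add: powr_powr mult.commute flip: powr_realpow)
        ultimately show ?thesis using V by (simp add: powr_mult mult_ac)
      qed
      also have "(2 * E * r ^ j) * (2 powr (n / 2) * V powr (1 / 2) * (2 powr (n / 2)) ^ j) * (3 ^ DIM('a) + 1) * ?N
         = A1 * \<rho> ^ j * ?N"
        by (simp add: A1_def \<rho>_def V_def power_mult_distrib mult_ac)
      finally show ?thesis .
    qed
    have partial: "norm (approx_form (s J) m F G H) \<le> (A0 + A1 * (\<Sum>j<J. \<rho> ^ j)) * ?N" for J
    proof (induction J)
      case 0
      then show ?case using start by simp
    next
      case (Suc J)
      have "norm (approx_form (s (Suc J)) m F G H) \<le> norm (approx_form (s J) m F G H) + norm (approx_form (s (Suc J)) m F G H - approx_form (s J) m F G H)"
        by (metis add.commute norm_triangle_sub)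
      also have "\<dots> \<le> (A0 + A1 * (\<Sum>j<J. \<rho> ^ j)) * ?N + A1 * \<rho> ^ J * ?N"
        by (intro add_mono Suc step)
      finally show ?case by (simp add: algebra_simps)
    qed
    have bound: "norm (shifted_form m F G H 0) \<le> (A0 + A1 / (1 - \<rho>)) * ?N + E * r ^ J * ?L" for J
    proof -
      have "(\<Sum>j<J. \<rho> ^ j) \<le> 1 / (1 - \<rho>)"
        using \<rho> by (simp add: sum_gp_strict divide_right_mono)
      then have "A1 * (\<Sum>j<J. \<rho> ^ j) \<le> A1 * (1 / (1 - \<rho>))"
        by (intro mult_left_mono A)
      then have "(A0 + A1 * (\<Sum>j<J. \<rho> ^ j)) * ?N \<le> (A0 + A1 / (1 - \<rho>)) * ?N"
        using N by (intro mult_right_mono) auto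
      then have "norm (approx_form (s J) m F G H) \<le> (A0 + A1 / (1 - \<rho>)) * ?N"
        using partial[of J] by linarith
      moreover have "norm (shifted_form m F G H 0) \<le> norm (approx_form (s J) m F G H) + norm (shifted_form m F G H 0 - approx_form (s J) m F G H)"
        by (metis add.commute norm_triangle_sub)
      ultimately show ?thesis using err[OF F G H, of J] by linarith
    qed
    \<comment> \<open>The L^2 norms of the three functions are fixed while \<open>J\<close> grows,
      so they disappear from the bound together with \<open>r ^ J\<close>.\<close>
    have "(\<lambda>J. (A0 + A1 / (1 - \<rho>)) * ?N + E * r ^ J * ?L) \<longlonglongrightarrow> (A0 + A1 / (1 - \<rho>)) * ?N + E * 0 * ?L"
      using r by (intro tendsto_intros LIMSEQ_realpow_zero) auto
    then show "norm (shifted_form m F G H 0) \<le> (A0 + A1 / (1 - \<rho>)) * ?N"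
      using bound by (intro LIMSEQ_le_const[of _ _ "norm (shifted_form m F G H 0)"]) auto
  qed
qed

section \<open>Duality\<close>

text \<open>Fourier transforms of Schwartz functions are integrable and \<open>m\<close> is bounded,
  so the double integral converges absolutely. In the pairing, integrating the exponential against
  \<open>H\<close> produces the transform of \<open>H\<close> at
  \<open>- (\<xi> + \<eta>)\<close>.\<close>

lemma
  fixes m :: "'a::euclidean_space \<times> 'a \<Rightarrow> complex"
  assumes [measurable]: "m \<in> borel_measurable borel" and C: "\<And>z. norm (m z) \<le> C"
    and f: "f \<in> schwartz" and g: "g \<in> schwartz"
  shows bilinear_multiplier_measurable: "bilinear_multiplier m f g \<in> borel_measurable borel"
    and norm_bilinear_multiplier_le: "\<exists>B. \<forall>x. norm (bilinear_multiplier m f g x) \<le> B"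
    and bilinear_multiplier_pairing: "H \<in> L1_L2 \<Longrightarrow> (LINT x|lborel. bilinear_multiplier m f g x * H x) = shifted_form m f g H 0"
proof -
  have int_f: "integrable lborel (fourier f)" and int_g: "integrable lborel (fourier g)"
    using f g by (auto intro: schwartz_fourier_integrable)
  then have [measurable]: "fourier f \<in> borel_measurable borel" "fourier g \<in> borel_measurable borel" by auto
  let ?k = "\<lambda>z. m z * fourier f (fst z) * fourier g (snd z)"
  have k: "integrable lborel ?k"
  proof (rule Bochner_Integration.integrable_bound)
    show "integrable lborel (\<lambda>z::'a \<times> 'a. C * (norm (fourier f (fst z)) * norm (fourier g (snd z))))"
      using has_bochner_integral_lborel_pair[of "\<lambda>x. norm (fourier f x)" "\<lambda>x. norm (fourier g x)"] int_f int_g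
      by (intro integrable_mult_right) (auto simp: has_bochner_integral_iff)
    show "?k \<in> borel_measurable lborel" by measurable
    show "AE z in lborel. norm (?k z) \<le> norm (C * (norm (fourier f (fst z)) * norm (fourier g (snd z))))"
      using C by (intro AE_I2) (auto simp: norm_mult abs_mult mult.assoc intro!: mult_right_mono order_trans[OF C abs_ge_self])
  qed
  have kx: "integrable lborel (\<lambda>z. ?k z * cis (2 * pi * (x \<bullet> (fst z + snd z))))" for x
    by (rule integrable_mult_cis[OF k]) measurable
  have eq: "bilinear_multiplier m f g x = (LINT z|lborel. ?k z * cis (2 * pi * (x \<bullet> (fst z + snd z))))" for x
  proof -
    have "(LINT z|lborel. ?k z * cis (2 * pi * (x \<bullet> (fst z + snd z))))
       = (LINT \<xi>|lborel. LINT \<eta>|lborel. ?k (\<xi>, \<eta>) * cis (2 * pi * (x \<bullet> (\<xi> + \<eta>))))"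
      using integral_lborel_pair[OF kx] by simp
    also have "\<dots> = (LINT \<eta>|lborel. LINT \<xi>|lborel. ?k (\<xi>, \<eta>) * cis (2 * pi * (x \<bullet> (\<xi> + \<eta>))))"
      by (rule lborel_fubini[symmetric]) (use kx in simp)
    also have "\<dots> = bilinear_multiplier m f g x"
      unfolding bilinear_multiplier_def by (simp add: cis_conv_exp mult_ac)
    finally show ?thesis by simp
  qed
  show "bilinear_multiplier m f g \<in> borel_measurable borel"
    unfolding eq[abs_def] cis_conv_exp by measurable
  show "\<exists>B. \<forall>x. norm (bilinear_multiplier m f g x) \<le> B"
  proof (intro exI allI)
    fix x
    show "norm (bilinear_multiplier m f g x) \<le> (LINT z|lborel. norm (?k z))"
      unfolding eq by (rule order_trans[OF integral_norm_bound]) (simp add: norm_mult)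
  qed
  assume H: "H \<in> L1_L2"
  then have [measurable]: "H \<in> borel_measurable borel" by (rule L1_L2_measurable)
  let ?h = "\<lambda>z x. ?k z * (H x * cis (2 * pi * (x \<bullet> (fst z + snd z))))"
  have int: "integrable lborel (\<lambda>w. ?h (fst w) (snd w))"
  proof (rule Bochner_Integration.integrable_bound)
    show "integrable lborel (\<lambda>w. norm (?k (fst w)) * norm (H (snd w)))"
      using has_bochner_integral_lborel_pair[of "\<lambda>z. norm (?k z)" "\<lambda>x. norm (H x)"] k L1_L2_integrable[OF H]
      by (auto simp: has_bochner_integral_iff)
    show "(\<lambda>w. ?h (fst w) (snd w)) \<in> borel_measurable lborel"
      unfolding cis_conv_exp by measurable
  qed (simp add: norm_mult)
  have "(LINT x|lborel. bilinear_multiplier m f g x * H x) = (LINT x|lborel. LINT z|lborel. ?h z x)"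
  proof (intro Bochner_Integration.integral_cong refl)
    fix x
    have "(LINT z|lborel. ?h z x) = (LINT z|lborel. (?k z * cis (2 * pi * (x \<bullet> (fst z + snd z)))) * H x)"
      by (intro Bochner_Integration.integral_cong refl) (simp add: mult_ac)
    then show "bilinear_multiplier m f g x * H x = (LINT z|lborel. ?h z x)"
      unfolding eq by (simp only: integral_mult_left_zero)
  qed
  also have "\<dots> = (LINT z|lborel. LINT x|lborel. ?h z x)"
    by (rule lborel_fubini[OF int])
  also have "\<dots> = shifted_form m f g H 0"
  proof -
    have "fourier H (- \<zeta>) = (LINT x|lborel. H x * cis (2 * pi * (x \<bullet> \<zeta>)))" for \<zeta>
      unfolding fourier_cis by (simp only: inner_minus_right mult_minus_left mult_minus_right minus_minus)
    then show ?thesis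
      unfolding shifted_form_def trilinear_def by (simp only: integral_mult_right_zero add_0_right)
  qed
  finally show "(LINT x|lborel. bilinear_multiplier m f g x * H x) = shifted_form m f g H 0" .
qed

lemma bounded_support_in_L1_L2:
  fixes H :: "'a::euclidean_space \<Rightarrow> complex"
  assumes [measurable]: "H \<in> borel_measurable borel" and B: "\<And>x. norm (H x) \<le> B"
    and supp: "\<And>x. x \<notin> cball 0 r \<Longrightarrow> H x = 0"
  shows "H \<in> L1_L2"
proof -
  have B0: "B \<ge> 0" using B[of 0] norm_ge_zero[of "H 0"] by linarith
  have fin: "emeasure lborel (cball (0::'a) r) < \<infinity>"
    by (rule emeasure_bounded_finite) simp
  have "integrable lborel H"
  proof (rule Bochner_Integration.integrable_bound)
    show "integrable lborel (\<lambda>x::'a. indicator (cball 0 r) x * B)"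
      using fin by (intro integrable_mult_left integrable_real_indicator) auto
    show "AE x in lborel. norm (H x) \<le> norm (indicator (cball 0 r) x * B)"
      using B B0 supp by (intro AE_I2) (auto split: split_indicator)
  qed simp
  moreover have "sq_integral H \<le> (\<integral>\<^sup>+x. ennreal (B\<^sup>2) * indicator (cball (0::'a) r) x \<partial>lborel)"
    unfolding sq_integral_def
    by (intro nn_integral_mono) (use B B0 supp in \<open>auto split: split_indicator intro!: ennreal_leI power_mono\<close>)
  moreover have "(\<integral>\<^sup>+x. ennreal (B\<^sup>2) * indicator (cball (0::'a) r) x \<partial>lborel) < \<infinity>"
    using fin by (subst nn_integral_cmult_indicator) (auto simp: ennreal_mult_less_top)
  ultimately show ?thesis by (auto simp: L1_L2_def intro: le_less_trans)
qed

text \<open>\<open>T\<close> is tested against its conjugate times |T|^(p - 2), cut to a ball. The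
  cut and the boundedness of \<open>T\<close> make the test function admissible and all integrals
  finite; the resulting bound does not depend on the radius, so Fatou's lemma finishes.\<close>

lemma power_integral_le_by_duality:
  fixes T :: "'a::euclidean_space \<Rightarrow> complex"
  assumes [measurable]: "T \<in> borel_measurable borel" and B: "\<And>x. norm (T x) \<le> B"
    and p: "1 \<le> p" and D: "D \<ge> 0"
    and dual: "\<And>H \<nu>. H \<in> L1_L2 \<Longrightarrow> bounded {x. H x \<noteq> 0} \<Longrightarrow> \<nu> > 0 \<Longrightarrow> Lp_bounded (1 - 1 / p) \<nu> H \<Longrightarrow>
       norm (LINT x|lborel. T x * H x) \<le> D * \<nu>"
  shows "power_integral p T \<le> ennreal (D powr p)"
proof -
  have B0: "B \<ge> 0" using B[of 0] norm_ge_zero[of "T 0"] by linarith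
  have ball: "(\<integral>\<^sup>+x. ennreal (indicator (cball 0 r) x * norm (T x) powr p) \<partial>lborel) \<le> ennreal (D powr p)" for r
  proof -
    \<comment> \<open>The modulus is |T|^(p - 1) on the ball where \<open>T\<close> is nonzero. At
      zeros of \<open>T\<close> the conjugate makes \<open>H\<close> vanish, also for
      \<open>p < 2\<close>, where the power is negative.\<close>
    define H where "H x = indicator (cball 0 r) x *\<^sub>R (cnj (T x) * complex_of_real (norm (T x) powr (p - 2)))" for x
    have [measurable]: "cball (0::'a) r \<in> sets borel" by simp
    have [measurable]: "(\<lambda>x. cnj (T x)) \<in> borel_measurable borel"
      by (rule borel_measurable_continuous_on[OF _ assms(1)]) (intro continuous_intros)
    have [measurable]: "H \<in> borel_measurable borel" unfolding H_def[abs_def] by measurable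
    have nH: "norm (H x) = indicator (cball 0 r) x * norm (T x) powr (p - 1)" if "T x \<noteq> 0" for x
    proof -
      have "norm (T x) * norm (T x) powr (p - 2) = norm (T x) powr (1 + (p - 2))"
        using that by (simp only: powr_add) simp
      then show ?thesis by (simp add: H_def norm_mult)
    qed
    have H0: "H x = 0" if "T x = 0" for x using that by (simp add: H_def)
    have HB: "norm (H x) \<le> B powr (p - 1) + 1" for x
    proof (cases "T x = 0")
      case False
      then have "norm (T x) powr (p - 1) \<le> B powr (p - 1)"
        using B p by (intro powr_mono2) auto
      then show ?thesis using nH[OF False] by (auto split: split_indicator simp: add_increasing2)
    qed (simp add: H0)
    have supp: "H x = 0" if "x \<notin> cball 0 r" for x using that by (simp add: H_def)
    have HL: "H \<in> L1_L2" by (rule bounded_support_in_L1_L2[of H _ r]) (use HB supp in auto)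
    have bs: "bounded {x. H x \<noteq> 0}"
      by (rule bounded_subset[of "cball 0 r"]) (simp, use supp in blast)
    let ?t = "\<lambda>x. indicator (cball 0 r) x * norm (T x) powr p"
    have TH: "T x * H x = complex_of_real (?t x)" for x
    proof (cases "T x = 0")
      case False
      have "(norm (T x))\<^sup>2 * norm (T x) powr (p - 2) = norm (T x) powr (2 + (p - 2))"
        using False by (simp only: powr_add) simp
      then have "complex_of_real ((norm (T x))\<^sup>2 * norm (T x) powr (p - 2)) = complex_of_real (norm (T x) powr p)" by simp
      then show ?thesis
        unfolding of_real_mult complex_norm_square
        by (auto simp: H_def mult_ac split: split_indicator)
    qed (use p in \<open>simp add: H0\<close>)
    have int: "integrable lborel ?t"
    proof (rule Bochner_Integration.integrable_bound)
      show "integrable lborel (\<lambda>x::'a. indicator (cball 0 r) x * B powr p)"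
        using emeasure_bounded_finite[of "cball (0::'a) r"] by (intro integrable_mult_left integrable_real_indicator) auto
      show "AE x in lborel. norm (?t x) \<le> norm (indicator (cball 0 r) x * B powr p)"
        using B p by (intro AE_I2) (auto split: split_indicator intro!: powr_mono2)
    qed measurable
    define X where "X = (LINT x|lborel. ?t x)"
    have X: "(\<integral>\<^sup>+x. ennreal (?t x) \<partial>lborel) = ennreal X" "X \<ge> 0"
      unfolding X_def by (auto intro!: nn_integral_eq_integral int Bochner_Integration.integral_nonneg)
    have pair: "(LINT x|lborel. T x * H x) = complex_of_real X"
      unfolding TH X_def by (rule integral_complex_of_real)
    have "X \<le> D powr p"
    proof (cases "p = 1")
      case True
      \<comment> \<open>For \<open>p = 1\<close> the dual exponent is infinite and \<open>H\<close>
        has modulus at most 1.\<close>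
      have "norm (H x) \<le> 1" for x
        by (cases "T x = 0") (auto simp: H0 nH True split: split_indicator)
      then have "Lp_bounded (1 - 1 / p) 1 H" by (simp add: Lp_bounded_def True)
      from dual[OF HL bs _ this] show ?thesis using D X by (simp add: pair True)
    next
      case False
      show ?thesis
      proof (cases "X = 0")
        case False
        then have X0: "X > 0" using X by simp
        define e where "e = 1 - 1 / p"
        have e: "e > 0" "(p - 1) * (1 / e) = p" using p \<open>p \<noteq> 1\<close> by (auto simp: e_def field_simps)
        have "norm (H x) powr (1 / e) = ?t x" for x
        proof (cases "T x = 0")
          case False
          have "(norm (T x) powr (p - 1)) powr (1 / e) = norm (T x) powr p"
            by (simp only: powr_powr e(2))
          then show ?thesis using e by (auto simp: nH[OF False] split: split_indicator)
        qed (use p e in \<open>simp add: H0\<close>)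
        then have "(\<integral>\<^sup>+x. ennreal (norm (H x) powr (1 / e)) \<partial>lborel) = ennreal X"
          using X(1) by simp
        also have "X = (X powr e) powr (1 / e)" using X0 e by (simp add: powr_powr)
        finally have "Lp_bounded e (X powr e) H" using e by (simp add: Lp_bounded_def)
        from dual[OF HL bs _ this[unfolded e_def]] have "X \<le> D * X powr e"
          using X0 X by (simp add: pair e_def)
        \<comment> \<open>Dividing by \<open>X powr e\<close> is legitimate since \<open>X\<close>
          is positive and, thanks to the cut, finite; what remains is
          \<open>X powr (1 / p)\<close>.\<close>
        then have "X powr 1 / X powr e \<le> D" using X0 by (simp add: field_simps)
        moreover have "1 / p = 1 - e" by (simp add: e_def)
        then have "X powr (1 / p) = X powr 1 / X powr e" by (simp only: powr_diff)
        ultimately have "X powr (1 / p) \<le> D" by (simp only:)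
        then have "(X powr (1 / p)) powr p \<le> D powr p" using p by (intro powr_mono2) auto
        then show ?thesis using X0 p by (simp add: powr_powr)
      qed simp
    qed
    then show ?thesis using X by (simp add: ennreal_leI)
  qed
  have [measurable]: "cball (0::'a) t \<in> sets borel" for t by simp
  have "power_integral p T = (\<integral>\<^sup>+x. liminf (\<lambda>k. ennreal (indicator (cball 0 (real k)) x * norm (T x) powr p)) \<partial>lborel)"
    unfolding power_integral_def
  proof (intro nn_integral_cong lim_imp_Liminf[symmetric])
    fix x :: 'a
    have "eventually (\<lambda>k. ennreal (norm (T x) powr p) = ennreal (indicator (cball 0 (real k)) x * norm (T x) powr p)) sequentially"
      using eventually_ge_at_top[of "nat \<lceil>norm x\<rceil>"]
      by eventually_elim (auto split: split_indicator simp: nat_le_iff ceiling_le_iff)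
    then show "(\<lambda>k. ennreal (indicator (cball 0 (real k)) x * norm (T x) powr p)) \<longlonglongrightarrow> ennreal (norm (T x) powr p)"
      by (rule Lim_transform_eventually[OF tendsto_const])
  qed simp
  also have "\<dots> \<le> liminf (\<lambda>k. \<integral>\<^sup>+x. ennreal (indicator (cball 0 (real k)) x * norm (T x) powr p) \<partial>lborel)"
    by (rule nn_integral_liminf) measurable
  also have "\<dots> \<le> liminf (\<lambda>k::nat. ennreal (D powr p))"
    by (intro Liminf_mono always_eventually allI ball)
  finally show ?thesis by (simp add: Liminf_const)
qed

text \<open>A nonempty open set is not null. This turns essential bounds on the continuous
  derivatives of \<open>m\<close> into pointwise ones, as the mean value inequality
  requires.\<close>

lemma continuous_AE_le_imp_le:
  fixes g :: "'a::euclidean_space \<Rightarrow> real"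
  assumes g: "continuous_on UNIV g" and AE: "AE x in lborel. g x \<le> c"
  shows "g x \<le> c"
proof (rule ccontr)
  assume "\<not> g x \<le> c"
  let ?S = "{x. c < g x}"
  have "open ?S" using open_Collect_less[OF continuous_on_const g] by simp
  moreover have "x \<in> ?S" using \<open>\<not> g x \<le> c\<close> by simp
  ultimately have "\<not> negligible ?S" using open_not_negligible by blast
  moreover have "?S \<in> null_sets lborel"
  proof -
    have "?S \<in> sets lborel" using \<open>open ?S\<close> by simp
    moreover have "emeasure lborel ?S = 0"
      using AE \<open>open ?S\<close> by (subst (asm) AE_iff_measurable[of ?S]) (auto simp: not_le)
    ultimately show ?thesis by (simp add: null_setsI)
  qed
  ultimately show False
    by (simp add: negligible_iff_null_sets null_sets_completionI)
qed

section \<open>Lp norms, Schwartz functions and reciprocal exponents\<close>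

lemma Lp_norm_infinity_bound:
  fixes g :: "'a::euclidean_space \<Rightarrow> complex"
  assumes g: "continuous_on UNIV g" and le: "Lp_norm \<infinity> g \<le> C" and C: "C < \<infinity>"
  shows "norm (g x) \<le> enn2real C"
proof -
  have [measurable]: "g \<in> borel_measurable borel" using g by (rule borel_measurable_continuous_onI)
  have "AE x in lborel. ennreal (norm (g x)) \<le> Lp_norm \<infinity> g"
    unfolding Lp_norm_def by simp (rule esssup_AE, measurable)
  then have "AE x in lborel. norm (g x) \<le> enn2real C"
  proof eventually_elim
    case (elim x)
    then have "ennreal (norm (g x)) \<le> ennreal (enn2real C)" using le C by (auto simp: less_top)
    then show ?case by simp
  qed
  then show ?thesis
    by (rule continuous_AE_le_imp_le[rotated]) (intro continuous_intros g)
qed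

lemma schwartz_power_integral_finite:
  fixes f :: "'a::euclidean_space \<Rightarrow> complex"
  assumes f: "f \<in> schwartz" and r: "1 \<le> r"
  shows "power_integral r f < \<infinity>" and "\<exists>B. \<forall>x. norm (f x) \<le> B"
proof -
  have mi: "multiindex []" by (simp add: multiindex_def)
  have int: "integrable lborel f" using schwartz_integrable[OF f mi] by simp
  obtain B where B: "\<And>x. norm (f x) * decay_weight x \<le> B"
    using schwartz_decay[OF f mi] by auto
  have fB: "norm (f x) \<le> B" for x
    using B[of x] mult_left_mono[OF decay_weight_ge_1[of x] norm_ge_zero[of "f x"]] by simp
  then show "\<exists>B. \<forall>x. norm (f x) \<le> B" by blast
  have "power_integral r f \<le> (\<integral>\<^sup>+x. ennreal (B powr (r - 1)) * ennreal (norm (f x)) \<partial>lborel)"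
    unfolding power_integral_def
  proof (intro nn_integral_mono)
    fix x
    have "norm (f x) powr r \<le> B powr (r - 1) * norm (f x)"
    proof (cases "f x = 0")
      case False
      have "norm (f x) powr r = norm (f x) powr ((r - 1) + 1)" by simp
      also have "\<dots> = norm (f x) powr (r - 1) * norm (f x)"
        using False by (simp only: powr_add) simp
      also have "\<dots> \<le> B powr (r - 1) * norm (f x)"
        using fB r by (intro mult_right_mono powr_mono2) auto
      finally show ?thesis .
    qed (use r in simp)
    then show "ennreal (norm (f x) powr r) \<le> ennreal (B powr (r - 1)) * ennreal (norm (f x))"
      by (simp add: ennreal_mult[symmetric])
  qed
  also have "\<dots> = ennreal (B powr (r - 1)) * (\<integral>\<^sup>+x. ennreal (norm (f x)) \<partial>lborel)"
    using int by (intro nn_integral_cmult) auto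
  also have "\<dots> < \<infinity>"
    using int by (auto simp: integrable_iff_bounded ennreal_mult_less_top)
  finally show "power_integral r f < \<infinity>" .
qed

lemma schwartz_in_L1_L2: "f \<in> schwartz \<Longrightarrow> f \<in> L1_L2"
  using schwartz_power_integral_finite(1)[of f 2] schwartz_integrable[of f "[]"]
  by (simp add: L1_L2_def sq_integral_def power_integral_def multiindex_def)

lemma Lp_norm_eq:
  "r > 0 \<Longrightarrow> Lp_norm (ennreal r) f = (if power_integral r f = \<infinity> then \<infinity> else ennreal (enn2real (power_integral r f) powr (1 / r)))"
  by (simp add: Lp_norm_def power_integral_def Let_def)

text \<open>\<open>enn2real (1 / p)\<close> is the reciprocal exponent that
  \<open>Lp_bounded\<close> expects, with the value 0 for an infinite exponent.\<close>

lemma ennreal_exponent_cases [consumes 1, case_names infinite finite]: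
  assumes "1 \<le> p"
  obtains "p = \<infinity>" "enn2real (1 / p) = 0" | r where "p = ennreal r" "1 \<le> r" "enn2real (1 / p) = 1 / r"
proof (cases p)
  case (real r)
  then have r: "1 \<le> r" using assms by simp
  have "1 / p = ennreal (1 / r)" using r real divide_ennreal[of 1 r] by simp
  then show ?thesis using that(2)[of r] real r by simp
next
  case top
  then show ?thesis using that(1) by simp
qed

lemma schwartz_Lp_norm_finite:
  assumes f: "f \<in> schwartz" and p: "1 \<le> p"
  shows "Lp_norm p f < \<infinity>"
  using p
proof (cases rule: ennreal_exponent_cases)
  case infinite
  obtain B where B: "\<And>x. norm (f x) \<le> B" using schwartz_power_integral_finite(2)[OF f, of 1] by auto
  have "esssup lborel (\<lambda>x. ennreal (norm (f x))) \<le> ennreal B"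
    using schwartz_measurable[OF f, of "[]"] B by (intro esssup_I) (auto simp: multiindex_def ennreal_leI)
  then show ?thesis unfolding infinite Lp_norm_def by (simp add: le_less_trans)
next
  case (finite r)
  then show ?thesis using schwartz_power_integral_finite(1)[OF f, of r] by (simp add: Lp_norm_eq)
qed

lemma Lp_norm_le_imp_Lp_bounded:
  fixes f :: "'a::euclidean_space \<Rightarrow> complex"
  assumes [measurable]: "f \<in> borel_measurable borel" and p: "1 \<le> p" and \<nu>: "\<nu> > 0" and le: "Lp_norm p f \<le> ennreal \<nu>"
  shows "Lp_bounded (enn2real (1 / p)) \<nu> f"
  using p
proof (cases rule: ennreal_exponent_cases)
  case infinite
  have "AE x in lborel. ennreal (norm (f x)) \<le> Lp_norm p f"
    unfolding Lp_norm_def using infinite(1) by simp (rule esssup_AE, measurable)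
  then have "AE x in lborel. norm (f x) \<le> \<nu>"
    by eventually_elim (use le \<nu> in \<open>auto dest: order_trans\<close>)
  then show ?thesis by (simp add: Lp_bounded_def infinite)
next
  case (finite r)
  have fin: "power_integral r f \<noteq> \<infinity>" using le finite by (auto simp: Lp_norm_eq top_unique)
  then have "enn2real (power_integral r f) powr (1 / r) \<le> \<nu>"
    using le finite \<nu> by (simp add: Lp_norm_eq)
  then have "(enn2real (power_integral r f) powr (1 / r)) powr r \<le> \<nu> powr r"
    using finite by (intro powr_mono2) auto
  then have "enn2real (power_integral r f) \<le> \<nu> powr r"
    using finite by (simp add: powr_powr)
  then have "power_integral r f \<le> ennreal (\<nu> powr r)"
    using fin by (metis ennreal_enn2real ennreal_leI less_top infinity_ennreal_def)
  then show ?thesis using finite by (simp add: Lp_bounded_def power_integral_def)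
qed

text \<open>\<open>trilinear_form_bound\<close> takes positive bounds, while the norms of
  \<open>f\<close> and \<open>g\<close> may vanish; they are enlarged by \<open>d\<close>, and then
  \<open>d\<close> tends to 0.\<close>

lemma ennreal_le_of_le_perturbation:
  assumes "A \<ge> 0" "a \<ge> 0" "b \<ge> 0" and le: "\<And>d. d > 0 \<Longrightarrow> x \<le> ennreal (A * ((a + d) * (b + d)))"
  shows "x \<le> ennreal (A * (a * b))"
proof (rule LIMSEQ_le_const)
  have "(\<lambda>k. A * ((a + inverse (real (Suc k))) * (b + inverse (real (Suc k))))) \<longlonglongrightarrow> A * ((a + 0) * (b + 0))"
    by (intro tendsto_intros LIMSEQ_inverse_real_of_nat)
  then show "(\<lambda>k. ennreal (A * ((a + inverse (real (Suc k))) * (b + inverse (real (Suc k)))))) \<longlonglongrightarrow> ennreal (A * (a * b))"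
    by (simp add: tendsto_ennrealI)
  show "\<exists>N. \<forall>n\<ge>N. x \<le> ennreal (A * ((a + inverse (real (Suc n))) * (b + inverse (real (Suc n)))))"
    using le by (intro exI[of _ 0]) auto
qed

theorem corollary1p4:
  fixes m :: "(real ^ 'n) \<times> (real ^ 'n) \<Rightarrow> complex"
    and q :: real and M\<^sub>q :: nat and C\<^sub>0 :: ennreal
  assumes q: "1 \<le> q" "q < 4"
    and Mq: "M\<^sub>q = nat \<lfloor>2 * real CARD('n) / (4 - q)\<rfloor> + 1"
    and m: "m \<in> Lp_space (ennreal q) \<inter> C_class M\<^sub>q"
    and C0: "C\<^sub>0 < \<infinity>"
    and bound: "\<And>\<alpha>. multiindex \<alpha> \<Longrightarrow> length \<alpha> \<le> M\<^sub>q \<Longrightarrow> Lp_norm \<infinity> (iter_partial \<alpha> m) \<le> C\<^sub>0"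
  shows "\<forall>p\<^sub>1 p\<^sub>2 p. 2 \<le> p\<^sub>1 \<and> p\<^sub>1 \<le> \<infinity> \<and> 2 \<le> p\<^sub>2 \<and> p\<^sub>2 \<le> \<infinity> \<and> 1 \<le> p \<and> p \<le> 2 \<and>
           1 / p = 1 / p\<^sub>1 + 1 / p\<^sub>2 \<longrightarrow>
           bilinear_multiplier_norm p\<^sub>1 p\<^sub>2 p m < \<infinity>"
proof -
  have mC: "m \<in> C_class M\<^sub>q" using m by simp
  have C: "norm (iter_partial \<alpha> m z) \<le> enn2real C\<^sub>0" if "multiindex \<alpha>" "length \<alpha> \<le> M\<^sub>q" for \<alpha> z
    using mC that bound C0 by (intro Lp_norm_infinity_bound) (auto simp: C_class_def)
  have mC': "norm (m z) \<le> enn2real C\<^sub>0" for z using C[of "[]" z] by (simp add: multiindex_def)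
  have meas: "m \<in> borel_measurable borel" using m by (simp add: Lp_space_def)
  have int: "power_integral q m < \<infinity>"
    using m q by (auto simp: Lp_space_def Lp_norm_eq less_top split: if_splits)
  \<comment> \<open>Adding 1 to the integer part gives the strict inequality that the convergence of
    the dyadic series demands.\<close>
  have "2 * real DIM(real ^ 'n) / (4 - q) < real M\<^sub>q"
    using q unfolding Mq by (simp add: of_nat_nat) linarith
  then show ?thesis
  proof (rule trilinear_form_bound[OF q _ mC])
    show "norm (iter_partial \<alpha> m z) \<le> enn2real C\<^sub>0" if "multiindex \<alpha>" "length \<alpha> \<le> M\<^sub>q" for \<alpha> z
      using that by (rule C)
    show "power_integral q m < \<infinity>" by (rule int)
    fix A :: real
    assume A: "A \<ge> 0" and tri: "\<And>F G H e1 e2 e3 \<nu>1 \<nu>2 \<nu>3. F \<in> L1_L2 \<Longrightarrow> G \<in> L1_L2 \<Longrightarrow> H \<in> L1_L2 \<Longrightarrow> bounded {x. H x \<noteq> 0} \<Longrightarrow>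
      0 \<le> e1 \<Longrightarrow> 0 \<le> e2 \<Longrightarrow> 0 \<le> e3 \<Longrightarrow> e1 \<le> 1 / 2 \<Longrightarrow> e2 \<le> 1 / 2 \<Longrightarrow> e3 \<le> 1 / 2 \<Longrightarrow> e1 + e2 + e3 = 1 \<Longrightarrow>
      \<nu>1 > 0 \<Longrightarrow> \<nu>2 > 0 \<Longrightarrow> \<nu>3 > 0 \<Longrightarrow> Lp_bounded e1 \<nu>1 F \<Longrightarrow> Lp_bounded e2 \<nu>2 G \<Longrightarrow> Lp_bounded e3 \<nu>3 H \<Longrightarrow>
      norm (shifted_form m F G H 0) \<le> A * (\<nu>1 * \<nu>2 * \<nu>3)"
    show ?thesis
    proof (intro allI impI, elim conjE)
      fix p\<^sub>1 p\<^sub>2 p :: ennreal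
      assume p1: "2 \<le> p\<^sub>1" and p2: "2 \<le> p\<^sub>2" and p: "1 \<le> p" "p \<le> 2" and sum: "1 / p = 1 / p\<^sub>1 + 1 / p\<^sub>2"
      have half: "enn2real (1 / s) \<le> 1 / 2" "1 / s < \<infinity>" if "2 \<le> s" for s
      proof -
        have le: "1 / s \<le> ennreal (1 / 2)"
        proof -
          have "1 \<le> s" using that by (rule order_trans[rotated]) simp
          then show ?thesis
          proof (cases rule: ennreal_exponent_cases)
            case (finite r)
            then have "2 \<le> r" "1 / s = ennreal (1 / r)"
              using that divide_ennreal[of 1 r] by auto
            then show ?thesis by (simp only:) (intro ennreal_leI, simp add: field_simps)
          qed simp
        qed
        show "enn2real (1 / s) \<le> 1 / 2" by (rule enn2real_leI[OF _ le]) simp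
        show "1 / s < \<infinity>" by (rule le_less_trans[OF le]) (simp only: infinity_ennreal_def ennreal_less_top)
      qed
      obtain r where r: "p = ennreal r" "1 \<le> r" "r \<le> 2" "enn2real (1 / p) = 1 / r"
        using p(1)
      proof (cases rule: ennreal_exponent_cases)
        case infinite
        moreover have "p < \<infinity>" using p(2) by (rule le_less_trans) simp
        ultimately show ?thesis by simp
      next
        case (finite r)
        have "ennreal r \<le> ennreal 2" using p(2) finite(1) by simp
        then have "r \<le> 2" by (subst (asm) ennreal_le_iff) simp_all
        then show ?thesis using that[of r] finite by simp
      qed
      let ?e1 = "enn2real (1 / p\<^sub>1)" and ?e2 = "enn2real (1 / p\<^sub>2)"
      \<comment> \<open>Both reciprocals are at most 1/2 and hence finite, so
        \<open>enn2real\<close> respects their sum.\<close>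
      have e: "?e1 + ?e2 = 1 / r"
        unfolding r(4)[symmetric] sum
        by (intro enn2real_plus[symmetric]) (use half(2)[OF p1] half(2)[OF p2] in simp_all)
      have "Lp_norm p (bilinear_multiplier m f g) \<le> ennreal A * Lp_norm p\<^sub>1 f * Lp_norm p\<^sub>2 g"
        if f: "f \<in> schwartz" and g: "g \<in> schwartz" for f g
      proof -
        let ?T = "bilinear_multiplier m f g"
        have p12: "1 \<le> p\<^sub>1" "1 \<le> p\<^sub>2" using p1 p2 by (auto intro: order_trans[of 1 2])
        define a b where "a = enn2real (Lp_norm p\<^sub>1 f)" and "b = enn2real (Lp_norm p\<^sub>2 g)"
        have ab: "Lp_norm p\<^sub>1 f = ennreal a" "Lp_norm p\<^sub>2 g = ennreal b" "a \<ge> 0" "b \<ge> 0"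
          using schwartz_Lp_norm_finite[OF f p12(1)] schwartz_Lp_norm_finite[OF g p12(2)]
          by (auto simp: a_def b_def less_top)
        have fg: "f \<in> L1_L2" "g \<in> L1_L2" using f g by (auto intro: schwartz_in_L1_L2)
        have "Lp_norm p ?T \<le> ennreal (A * ((a + d) * (b + d)))" if d: "d > 0" for d
        proof -
          obtain B where B: "\<And>x. norm (?T x) \<le> B"
            using norm_bilinear_multiplier_le[OF meas mC' f g] by blast
          have "power_integral r ?T \<le> ennreal ((A * ((a + d) * (b + d))) powr r)"
          proof (rule power_integral_le_by_duality[OF bilinear_multiplier_measurable[OF meas mC' f g] B r(2)])
            show "0 \<le> A * ((a + d) * (b + d))" using A ab d by simp
            fix H :: "real ^ 'n \<Rightarrow> complex" and \<nu> :: real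
            assume H: "H \<in> L1_L2" "bounded {x. H x \<noteq> 0}" "\<nu> > 0" "Lp_bounded (1 - 1 / r) \<nu> H"
            have "norm (shifted_form m f g H 0) \<le> A * ((a + d) * (b + d) * \<nu>)"
            proof (rule tri[OF fg H(1,2)])
              show "Lp_bounded ?e1 (a + d) f" "Lp_bounded ?e2 (b + d) g"
                using fg ab d p12 by (auto intro!: Lp_norm_le_imp_Lp_bounded L1_L2_measurable ennreal_leI)
              \<comment> \<open>Here the range of \<open>p\<close> between 1 and 2 enters: the dual
                exponent is then at least 2, as the estimate on cubes requires.\<close>
              show "1 - 1 / r \<le> 1 / 2" "0 \<le> 1 - 1 / r" using r by (auto simp: field_simps)
              show "?e1 + ?e2 + (1 - 1 / r) = 1" using e by simp
            qed (use half(1) p1 p2 H ab d in auto)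
            then show "norm (LINT x|lborel. ?T x * H x) \<le> A * ((a + d) * (b + d)) * \<nu>"
              unfolding bilinear_multiplier_pairing[OF meas mC' f g H(1)] by (simp add: mult_ac)
          qed
          then have "power_integral r ?T \<noteq> \<infinity>" "enn2real (power_integral r ?T) \<le> (A * ((a + d) * (b + d))) powr r"
            by (auto simp: top_unique enn2real_leI)
          then have "power_integral r ?T \<noteq> \<infinity>" "enn2real (power_integral r ?T) powr (1 / r) \<le> ((A * ((a + d) * (b + d))) powr r) powr (1 / r)"
            using r by (auto intro!: powr_mono2)
          moreover have "((A * ((a + d) * (b + d))) powr r) powr (1 / r) = A * ((a + d) * (b + d))"
            using r A ab d by (simp add: powr_powr)
          ultimately show ?thesis
            using r by (simp add: Lp_norm_eq ennreal_leI)
        qed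
        then have "Lp_norm p ?T \<le> ennreal (A * (a * b))"
          by (rule ennreal_le_of_le_perturbation[OF A ab(3,4)])
        then show ?thesis
          using A ab by (simp add: ennreal_mult mult.assoc)
      qed
      then have "bilinear_multiplier_norm p\<^sub>1 p\<^sub>2 p m \<le> ennreal A"
        unfolding bilinear_multiplier_norm_def by (intro Inf_lower) auto
      then show "bilinear_multiplier_norm p\<^sub>1 p\<^sub>2 p m < \<infinity>"
        by (rule le_less_trans) simp
    qed
  qed
qed

end
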